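(* Let $A\in\mathrm{GL}(n,\mathbb{R})$ be an expansive matrix, $B=A^T$, let $\mathcal{T}\subset\mathbb{R}^n$ be a full rank lattice with $B\mathcal{T}\subseteq\mathcal{T}$, let $q=|\det B|$, and let $v_0,v_1,\dots,v_{q-1}$ be representatives of the elements of the quotient group $\mathcal{T}/B\mathcal{T}$. Let $K\subset\mathbb{R}^n$ be a scaling set, with associated spaces $V_j$, $j\in\mathbb{Z}$, and set $$K_i=(B^{-1}K+B^{-1}v_i+\mathcal{T})\cap K,\qquad \Omega_i=BK_i .$$ Then: (i) $\widehat{V}_0=L^2(K)$ and $\widehat{V}_j=L^2(B^jK)$; (ii) $\{\psi^i=\mathcal{F}^{-1}\chi_{\Omega_i}\}_{i=1}^{q-1}$ is an SMRA multiwavelet.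
   Context: A matrix is expansive if all its eigenvalues have absolute value greater than $1$. $|\cdot|$ of a set is Lebesgue measure. The Fourier transform is $\mathcal{F}(f)(\lambda)=\hat f(\lambda)=\int_{\mathbb{R}^n} f(x)e^{-2\pi i(x,\lambda)}\,dx$; for a subspace $V\subset L^2(\mathbb{R}^n)$, $\widehat{V}=\mathcal{F}(V)$, and $L^2(K)$ is regarded as the subspace of $L^2(\mathbb{R}^n)$ of functions vanishing a.e. outside $K$. For measurable $M\subseteq\mathbb{R}^n$, $L^2_M(\mathbb{R}^n)$ is the space of $f\in L^2(\mathbb{R}^n)$ such that $\mathcal{F}(f)$ is supported in $M$. A multiresolution analysis (relative to $A$ and $\mathcal{T}$) is a sequence $\{V_j\}_{j\in\mathbb{Z}}$ of subspaces of $L^2(\mathbb{R}^n)$ such that: (i) $V_j\subseteq V_{j+1}$ for all $j$; (ii) if $f(\cdot)\in V_j$ then $f(A\,\cdot)\in V_{j+1}$; (iii) $\bigcap_jV_j=\{0\}$; (iv) $\overline{\bigcup_jV_j}=L^2(\mathbb{R}^n)$; (v) there is $\phi\in L^2(\mathbb{R}^n)$, called a scaling function, such that $\{\phi(\cdot+t)\mid t\in\mathcal{T}\}$ is an orthonormal basis of $V_0$. A subspace multiresolution analysis (SMRA) is defined in the same way with (iv) replaced by (iv$'$) $\overline{\bigcup_jV_j}=L^2_M(\mathbb{R}^n)$ for some subset $M\subseteq\mathbb{R}^n$. A measurable set $K$ with $|K|=1$ is a scaling set if, with $V_0=L^2_K(\mathbb{R}^n)$ and $V_j=\{f(A^j\,\cdot)\mid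 f\in V_0\}$, the sequence $\{V_j\}_{j\in\mathbb{Z}}$ is a multiresolution analysis with scaling function $\phi=\mathcal{F}^{-1}\chi_K$. Functions $\psi^1,\dots,\psi^m$ form an SMRA multiwavelet associated with $\{V_j\}$ if $\{\psi^i(\cdot+t)\mid 1\le i\le m,\ t\in\mathcal{T}\}$ is an orthonormal basis of $W_0=V_1\ominus V_0$ (the orthogonal complement of $V_0$ in $V_1$), so that $\{|\det A|^{j/2}\psi^i(A^jx+t)\mid 1\le i\le m,\ j\in\mathbb{Z},\ t\in\mathcal{T}\}$ is an orthonormal basis of $\overline{\bigcup_jV_j}$.
   Formalization: Translations in the multiresolution analysis, scaling set and multiwavelet run over the dual lattice of T (equal to T if self-dual, e.g. Z^n), while T itself is kept in K_i and T/BT; v_0 is required to represent the trivial coset. Without these changes (ii) is false. *)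

theory Defs
  imports "HOL-Analysis.Analysis"
begin

text \<open>
  Elements of \<open>L\<^sup>2(\<real>\<^sup>n)\<close> are represented by Lebesgue measurable, square integrable functions.
  There is no quotient by null sets; instead every subspace is required to be closed under
  modification on null sets, so that subspaces of the quotient space and the sets satisfying
  \<open>l2_subspace\<close> correspond to each other, and equality of subspaces is equality of sets.
\<close>

definition L2 :: "(real^'n \<Rightarrow> complex) set" where
  "L2 = {f \<in> borel_measurable lebesgue. integrable lebesgue (\<lambda>x. (cmod (f x))\<^sup>2)}"

definition L2_on :: "(real^'n) set \<Rightarrow> (real^'n \<Rightarrow> complex) set" where
  "L2_on K = {f \<in> L2. AE x in lebesgue. x \<notin> K \<longrightarrow> f x = 0}"

definition l2_subspace :: "(real^'n \<Rightarrow> complex) set \<Rightarrow> bool" where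
  "l2_subspace V \<longleftrightarrow> V \<subseteq> L2 \<and> (\<lambda>x. 0) \<in> V
     \<and> (\<forall>f\<in>V. \<forall>g\<in>V. (\<lambda>x. f x + g x) \<in> V)
     \<and> (\<forall>c. \<forall>f\<in>V. (\<lambda>x. c * f x) \<in> V)
     \<and> (\<forall>f\<in>V. \<forall>g\<in>L2. (AE x in lebesgue. g x = f x) \<longrightarrow> g \<in> V)"

definition l2_inner :: "(real^'n \<Rightarrow> complex) \<Rightarrow> (real^'n \<Rightarrow> complex) \<Rightarrow> complex" where
  "l2_inner f g = (LINT x|lebesgue. f x * cnj (g x))"

text \<open>
  The nonnegative integral is used so that a difference outside \<open>L\<^sup>2\<close> counts as infinite,
  whereas its Bochner integral would be \<open>0\<close>.
\<close>

definition l2_tendsto :: "(nat \<Rightarrow> real^'n \<Rightarrow> complex) \<Rightarrow> (real^'n \<Rightarrow> complex) \<Rightarrow> bool" where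
  "l2_tendsto s f \<longleftrightarrow>
     (\<lambda>k. \<integral>\<^sup>+ x. ennreal ((cmod (s k x - f x))\<^sup>2) \<partial>lebesgue) \<longlonglongrightarrow> 0"

definition l2_closure :: "(real^'n \<Rightarrow> complex) set \<Rightarrow> (real^'n \<Rightarrow> complex) set" where
  "l2_closure V = {f \<in> L2. \<exists>s. (\<forall>k. s k \<in> V) \<and> l2_tendsto s f}"

definition l2_span ::
    "'i set \<Rightarrow> ('i \<Rightarrow> real^'n \<Rightarrow> complex) \<Rightarrow> (real^'n \<Rightarrow> complex) set" where
  "l2_span I b = {(\<lambda>x. \<Sum>i\<in>F. c i * b i x) | F c. finite F \<and> F \<subseteq> I}"

definition l2_orthonormal_basis ::
    "'i set \<Rightarrow> ('i \<Rightarrow> real^'n \<Rightarrow> complex) \<Rightarrow> (real^'n \<Rightarrow> complex) set \<Rightarrow> bool" where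
  "l2_orthonormal_basis I b V \<longleftrightarrow>
     (\<forall>i\<in>I. b i \<in> L2)
     \<and> (\<forall>i\<in>I. \<forall>j\<in>I. l2_inner (b i) (b j) = (if i = j then 1 else 0))
     \<and> V = l2_closure (l2_span I b)"

definition l2_orth_complement_in ::
    "(real^'n \<Rightarrow> complex) set \<Rightarrow> (real^'n \<Rightarrow> complex) set \<Rightarrow> (real^'n \<Rightarrow> complex) set" where
  "l2_orth_complement_in W V = {f \<in> W. \<forall>g\<in>V. l2_inner f g = 0}"

definition fourier_integral :: "(real^'n \<Rightarrow> complex) \<Rightarrow> real^'n \<Rightarrow> complex" where
  "fourier_integral f l =
     (LINT x|lebesgue. f x * exp (- 2 * of_real pi * \<i> * of_real (x \<bullet> l)))"

text \<open>
  The Fourier transform on \<open>L\<^sup>2\<close> is the continuous extension of the integral transform from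
  \<open>L\<^sup>1 \<inter> L\<^sup>2\<close>. It is given here by its graph (the closure of the graph of the integral
  transform), since its values are only determined up to null sets.
\<close>

definition has_fourier :: "(real^'n \<Rightarrow> complex) \<Rightarrow> (real^'n \<Rightarrow> complex) \<Rightarrow> bool" where
  "has_fourier f g \<longleftrightarrow> f \<in> L2 \<and> g \<in> L2 \<and>
     (\<exists>s. (\<forall>k. s k \<in> L2 \<and> integrable lebesgue (s k)) \<and> l2_tendsto s f
        \<and> l2_tendsto (\<lambda>k. fourier_integral (s k)) g)"

text \<open>A representative of the inverse transform.\<close>

definition inv_fourier :: "(real^'n \<Rightarrow> complex) \<Rightarrow> real^'n \<Rightarrow> complex" where
  "inv_fourier g = (SOME f. has_fourier f g)"

definition fourier_image :: "(real^'n \<Rightarrow> complex) set \<Rightarrow> (real^'n \<Rightarrow> complex) set" where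
  "fourier_image V = {g. \<exists>f\<in>V. has_fourier f g}"

definition L2_spectrum :: "(real^'n) set \<Rightarrow> (real^'n \<Rightarrow> complex) set" where
  "L2_spectrum M = {f \<in> L2. \<exists>g\<in>L2_on M. has_fourier f g}"

definition expansive :: "real^'n^'n \<Rightarrow> bool" where
  "expansive A \<longleftrightarrow>
     (\<forall>(c::complex) (x::complex^'n). x \<noteq> 0 \<and> map_matrix of_real A *v x = c *s x \<longrightarrow> 1 < cmod c)"

text \<open>Integer powers of a matrix; note that \<open>^\<close> on \<open>real^'n^'n\<close> is componentwise.\<close>

definition matrix_zpow :: "real^'n^'n \<Rightarrow> int \<Rightarrow> real^'n^'n" where
  "matrix_zpow A j =
     (if 0 \<le> j then (((**) A) ^^ nat j) (mat 1) else (((**) (matrix_inv A)) ^^ nat (- j)) (mat 1))"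

definition full_rank_lattice :: "(real^'n) set \<Rightarrow> bool" where
  "full_rank_lattice T \<longleftrightarrow>
     (\<exists>P::real^'n^'n. invertible P \<and> T = (\<lambda>k. P *v k) ` {k. \<forall>i. k $ i \<in> \<int>})"

definition dual_lattice :: "(real^'n) set \<Rightarrow> (real^'n) set" where
  "dual_lattice T = {l. \<forall>t\<in>T. t \<bullet> l \<in> \<int>}"

definition coset_rel :: "'a::group_add set \<Rightarrow> 'a set \<Rightarrow> ('a \<times> 'a) set" where
  "coset_rel G H = {(x, y). x \<in> G \<and> y \<in> G \<and> x - y \<in> H}"

definition coset_representatives :: "'a::group_add set \<Rightarrow> 'a set \<Rightarrow> nat \<Rightarrow> (nat \<Rightarrow> 'a) \<Rightarrow> bool" where
  "coset_representatives G H q v \<longleftrightarrow>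
     (\<forall>i<q. v i \<in> G) \<and> bij_betw (\<lambda>i. coset_rel G H `` {v i}) {..<q} (G // coset_rel G H)"

definition scaling_function ::
    "(real^'n) set \<Rightarrow> (real^'n \<Rightarrow> complex) set \<Rightarrow> (real^'n \<Rightarrow> complex) \<Rightarrow> bool" where
  "scaling_function T V0 \<phi> \<longleftrightarrow> \<phi> \<in> L2 \<and> l2_orthonormal_basis T (\<lambda>t x. \<phi> (x + t)) V0"

text \<open>
  The axioms common to multiresolution analyses and subspace multiresolution analyses, relative
  to the dilation matrix \<open>A\<close> and the lattice \<open>T\<close> of translations.
\<close>

definition pre_mra ::
    "real^'n^'n \<Rightarrow> (real^'n) set \<Rightarrow> (int \<Rightarrow> (real^'n \<Rightarrow> complex) set) \<Rightarrow> bool" where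
  "pre_mra A T V \<longleftrightarrow>
     (\<forall>j. l2_subspace (V j))
     \<and> (\<forall>j. V j \<subseteq> V (j + 1))
     \<and> (\<forall>j. \<forall>f\<in>V j. (\<lambda>x. f (A *v x)) \<in> V (j + 1))
     \<and> (\<Inter>j. V j) = {f \<in> L2. AE x in lebesgue. f x = 0}
     \<and> (\<exists>\<phi>. scaling_function T (V 0) \<phi>)"

definition mra ::
    "real^'n^'n \<Rightarrow> (real^'n) set \<Rightarrow> (int \<Rightarrow> (real^'n \<Rightarrow> complex) set) \<Rightarrow> bool" where
  "mra A T V \<longleftrightarrow> pre_mra A T V \<and> l2_closure (\<Union>j. V j) = L2"

definition smra ::
    "real^'n^'n \<Rightarrow> (real^'n) set \<Rightarrow> (int \<Rightarrow> (real^'n \<Rightarrow> complex) set) \<Rightarrow> bool" where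
  "smra A T V \<longleftrightarrow>
     pre_mra A T V \<and> (\<exists>M\<in>sets lebesgue. l2_closure (\<Union>j. V j) = L2_spectrum M)"

definition scaling_spaces ::
    "real^'n^'n \<Rightarrow> (real^'n) set \<Rightarrow> int \<Rightarrow> (real^'n \<Rightarrow> complex) set" where
  "scaling_spaces A K j = (\<lambda>f x. f (matrix_zpow A j *v x)) ` L2_spectrum K"

definition scaling_set :: "real^'n^'n \<Rightarrow> (real^'n) set \<Rightarrow> (real^'n) set \<Rightarrow> bool" where
  "scaling_set A T K \<longleftrightarrow>
     K \<in> sets lebesgue \<and> emeasure lebesgue K = 1
     \<and> mra A T (scaling_spaces A K)
     \<and> scaling_function T (scaling_spaces A K 0) (inv_fourier (indicator K))"

text \<open>The family \<open>\<psi> 1, \<dots>, \<psi> m\<close> is a multiwavelet associated with \<open>V\<close>.\<close>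

definition smra_multiwavelet ::
    "real^'n^'n \<Rightarrow> (real^'n) set \<Rightarrow> (int \<Rightarrow> (real^'n \<Rightarrow> complex) set) \<Rightarrow>
     nat \<Rightarrow> (nat \<Rightarrow> real^'n \<Rightarrow> complex) \<Rightarrow> bool" where
  "smra_multiwavelet A T V m \<psi> \<longleftrightarrow>
     smra A T V
     \<and> l2_orthonormal_basis ({1..m} \<times> T) (\<lambda>(i, t) x. \<psi> i (x + t))
         (l2_orth_complement_in (V 1) (V 0))
     \<and> l2_orthonormal_basis ({1..m} \<times> (UNIV :: int set) \<times> T)
         (\<lambda>(i, j, t) x. of_real (\<bar>det A\<bar> powr (of_int j / 2)) * \<psi> i (matrix_zpow A j *v x + t))
         (l2_closure (\<Union>j. V j))"

text \<open>
  The set \<open>(B\<^sup>-\<^sup>1 K + B\<^sup>-\<^sup>1 w + T) \<inter> K\<close>. It lives on the frequency side, and so does \<open>T\<close> here. If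
  the translates of \<open>\<phi>\<close> with Fourier transform \<open>indicator K\<close> by a lattice are orthonormal,
  then the translates of \<open>K\<close> by the dual lattice tile the space. Thus the lattice of
  translations matching \<open>T\<close> is \<open>dual_lattice T\<close>, which is \<open>T\<close> itself for the integer lattice.
\<close>

definition frequency_piece ::
    "real^'n^'n \<Rightarrow> (real^'n) set \<Rightarrow> (real^'n) set \<Rightarrow> real^'n \<Rightarrow> (real^'n) set" where
  "frequency_piece B T K w =
     {matrix_inv B *v k + matrix_inv B *v w + t | k t. k \<in> K \<and> t \<in> T} \<inter> K"

end

theory Submission
  imports Defs "HOL-Probability.Characteristic_Functions"
begin

text \<open>
  On the frequency side the translates of the scaling function become the exponentials
  \<open>wave t\<close>, with \<open>t\<close> in the dual lattice, restricted to \<open>K\<close>. Since they form an orthonormal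
  basis of \<open>L2_on K\<close>, the set \<open>K\<close> tiles the space under \<open>T\<close>: completeness makes the translates
  of \<open>K\<close> disjoint up to null sets, and orthonormality bounds the covolume of \<open>T\<close> by \<open>1 = |K|\<close>.
  Each \<open>\<Omega>\<^sub>i\<close> is assembled from the translates of \<open>K + v\<^sub>i\<close> by \<open>B T\<close>, cut along the tiling by
  \<open>B K\<close>. Hence it tiles under \<open>T\<close> as well and, the exponentials being \<open>T\<close>-periodic, the basis
  of \<open>L2_on K\<close> can be transported to \<open>L2_on \<Omega>\<^sub>i\<close>. The sets \<open>\<Omega>\<^sub>i\<close> partition \<open>B K\<close>
  and \<open>\<Omega>\<^sub>0 = K\<close>, so \<open>\<Omega>\<^sub>1, \<dots>, \<Omega>\<^bsub>q-1\<^esub>\<close> partition \<open>B K - K\<close>, whose dilates by the powers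
  of \<open>B\<close> partition the whole space because the spaces \<open>V\<^sub>j\<close> have dense union and trivial
  intersection. Plancherel's theorem translates all of this back to the \<open>\<psi>\<^sup>i\<close>. It is proved
  by Gaussian regularization: this yields a contraction, which is isometric on indicators of
  open sets and therefore everywhere.
\<close>

section \<open>The seminorm of square integrable functions\<close>

text \<open>The obstacle is that \<open>K\<close> is known only through its function spaces, so its
  geometry has to be read off from a Hilbert space basis. No completeness theorem for Fourier series
  enters: the one complete exponential system available is the given one on \<open>K\<close>. It can
  be moved because folding along \<open>T\<close> turns one tile into another without changing
  integrals of periodic functions; norms, by polarization inner products, and approximations all
  survive. The tiling has no gaps because disjoint translates fold \<open>K\<close> injectively into
  a fundamental domain whose volume is at most that of \<open>K\<close>. The Fourier transform is a
  relation, determined up to null sets. Bases are therefore moved along abstract unitary relations,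
  which treat the transform, its converse and dilations alike. In Plancherel's theorem the upper
  bound is available for every function, but the lower bound only where smoothing at small scale
  converges pointwise on the support, which openness guarantees. Equality in a linear contraction is
  inherited by sums, by the parallelogram law, and by limits; this spreads it from open sets to all
  functions.\<close>

definition l2_norm :: "(real^'n \<Rightarrow> complex) \<Rightarrow> real" where
  "l2_norm f = sqrt (LINT x|lebesgue. (cmod (f x))\<^sup>2)"

lemma L2_measurable [measurable_dest]: "f \<in> L2 \<Longrightarrow> f \<in> borel_measurable lebesgue"
  by (simp add: L2_def)

lemma L2_integrable: "f \<in> L2 \<Longrightarrow> integrable lebesgue (\<lambda>x. (cmod (f x))\<^sup>2)"
  by (simp add: L2_def)

lemma L2_iff_nn_integral:
  "f \<in> L2 \<longleftrightarrow> f \<in> borel_measurable lebesgue \<and> (\<integral>\<^sup>+ x. ennreal ((cmod (f x))\<^sup>2) \<partial>lebesgue) < \<infinity>"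
  unfolding L2_def by (auto simp: integrable_iff_bounded)

lemma l2_norm_nonneg [simp]: "0 \<le> l2_norm f"
  by (simp add: l2_norm_def)

lemma l2_norm_squared: "(l2_norm f)\<^sup>2 = (LINT x|lebesgue. (cmod (f x))\<^sup>2)"
  by (simp add: l2_norm_def)

lemma nn_integral_l2_norm:
  "f \<in> L2 \<Longrightarrow> (\<integral>\<^sup>+ x. ennreal ((cmod (f x))\<^sup>2) \<partial>lebesgue) = ennreal ((l2_norm f)\<^sup>2)"
  unfolding l2_norm_squared by (rule nn_integral_eq_integral) (auto intro: L2_integrable)

lemma L2_dominated:
  assumes "g \<in> L2" "f \<in> borel_measurable lebesgue" "AE x in lebesgue. cmod (f x) \<le> cmod (g x)"
  shows "f \<in> L2"
proof -
  have "AE x in lebesgue. norm ((cmod (f x))\<^sup>2) \<le> norm ((cmod (g x))\<^sup>2)"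
    using assms(3) by (auto intro: power_mono)
  moreover have "(\<lambda>x. (cmod (f x))\<^sup>2) \<in> borel_measurable lebesgue"
    using assms(2) by measurable
  ultimately have "integrable lebesgue (\<lambda>x. (cmod (f x))\<^sup>2)"
    using Bochner_Integration.integrable_bound[OF L2_integrable[OF assms(1)]] by blast
  then show ?thesis using assms(2) by (simp add: L2_def)
qed

lemma L2_zero [simp]: "(\<lambda>x. 0) \<in> L2"
  by (simp add: L2_def)

lemma L2_cmult [intro]: "f \<in> L2 \<Longrightarrow> (\<lambda>x. c * f x) \<in> L2"
  by (auto simp: L2_def norm_mult power_mult_distrib)

lemma norm_add_squared_le: "(cmod (a + b))\<^sup>2 \<le> 2 * (cmod a)\<^sup>2 + 2 * (cmod b)\<^sup>2"
proof -
  have "(cmod (a + b))\<^sup>2 \<le> (cmod a + cmod b)\<^sup>2"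
    by (intro power_mono norm_triangle_ineq) auto
  also have "\<dots> \<le> 2 * (cmod a)\<^sup>2 + 2 * (cmod b)\<^sup>2"
    using sum_squares_bound[of "cmod a" "cmod b"] by (simp add: power2_sum)
  finally show ?thesis .
qed

lemma L2_add [intro]:
  assumes "f \<in> L2" "g \<in> L2" shows "(\<lambda>x. f x + g x) \<in> L2"
proof -
  have "integrable lebesgue (\<lambda>x. 2 * (cmod (f x))\<^sup>2 + 2 * (cmod (g x))\<^sup>2)"
    using assms by (auto intro!: integrable_add integrable_mult_right L2_integrable)
  then have "integrable lebesgue (\<lambda>x. (cmod (f x + g x))\<^sup>2)"
    by (rule Bochner_Integration.integrable_bound)
      (use assms in \<open>auto simp: norm_add_squared_le intro!: borel_measurable_power borel_measurable_norm borel_measurable_add L2_measurable\<close>)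
  then show ?thesis using assms by (auto simp: L2_def)
qed

lemma L2_uminus [intro]: "f \<in> L2 \<Longrightarrow> (\<lambda>x. - f x) \<in> L2"
  using L2_cmult[of f "-1"] by simp

lemma L2_diff [intro]: "f \<in> L2 \<Longrightarrow> g \<in> L2 \<Longrightarrow> (\<lambda>x. f x - g x) \<in> L2"
  using L2_add[of f "\<lambda>x. - g x"] by auto

lemma borel_measurable_cnj [measurable]: "cnj \<in> borel_measurable borel"
  by (intro borel_measurable_continuous_onI continuous_intros)

lemma L2_cnj [intro]: "f \<in> L2 \<Longrightarrow> (\<lambda>x. cnj (f x)) \<in> L2"
  by (rule L2_dominated[of f]) auto

lemma L2_sum [intro]: "(\<And>i. i \<in> F \<Longrightarrow> f i \<in> L2) \<Longrightarrow> (\<lambda>x. \<Sum>i\<in>F. f i x) \<in> L2"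
  by (induction F rule: infinite_finite_induct) auto

lemma L2_inner_integrable:
  assumes "f \<in> L2" "g \<in> L2" shows "integrable lebesgue (\<lambda>x. f x * cnj (g x))"
proof -
  have "integrable lebesgue (\<lambda>x. (cmod (f x))\<^sup>2 + (cmod (g x))\<^sup>2)"
    using assms by (auto intro!: integrable_add L2_integrable)
  then show ?thesis
  proof (rule Bochner_Integration.integrable_bound)
    show "AE x in lebesgue. norm (f x * cnj (g x)) \<le> norm ((cmod (f x))\<^sup>2 + (cmod (g x))\<^sup>2)"
    proof (rule AE_I2)
      fix x
      have "0 \<le> cmod (f x) * cmod (g x)" by simp
      then show "norm (f x * cnj (g x)) \<le> norm ((cmod (f x))\<^sup>2 + (cmod (g x))\<^sup>2)"
        using sum_squares_bound[of "cmod (f x)" "cmod (g x)"] unfolding norm_mult complex_mod_cnj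
        by (simp del: mult_nonneg_nonneg zero_le_mult_iff)
    qed
  qed (use assms in \<open>simp add: L2_measurable\<close>)
qed

lemma l2_inner_self: "l2_inner f f = of_real ((l2_norm f)\<^sup>2)"
proof -
  have "l2_inner f f = (LINT x|lebesgue. complex_of_real ((cmod (f x))\<^sup>2))"
    unfolding l2_inner_def by (intro Bochner_Integration.integral_cong) (auto simp: complex_norm_square simp del: of_real_power)
  then show ?thesis
    by (simp add: l2_norm_squared del: of_real_power)
qed

lemma l2_inner_add_left:
  "f \<in> L2 \<Longrightarrow> g \<in> L2 \<Longrightarrow> h \<in> L2 \<Longrightarrow> l2_inner (\<lambda>x. f x + g x) h = l2_inner f h + l2_inner g h"
  unfolding l2_inner_def by (simp add: distrib_right L2_inner_integrable)

lemma l2_inner_diff_left: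
  "f \<in> L2 \<Longrightarrow> g \<in> L2 \<Longrightarrow> h \<in> L2 \<Longrightarrow> l2_inner (\<lambda>x. f x - g x) h = l2_inner f h - l2_inner g h"
  unfolding l2_inner_def by (simp add: left_diff_distrib L2_inner_integrable)

lemma l2_inner_cmult_left: "l2_inner (\<lambda>x. c * f x) g = c * l2_inner f g"
  unfolding l2_inner_def by (simp add: mult.assoc)

lemma l2_inner_commute: "l2_inner g f = cnj (l2_inner f g)"
  unfolding l2_inner_def by (subst Bochner_Integration.integral_cnj[symmetric]) (simp add: mult.commute)

lemma l2_inner_sum_left:
  assumes "\<And>i. i \<in> F \<Longrightarrow> f i \<in> L2" "h \<in> L2"
  shows "l2_inner (\<lambda>x. \<Sum>i\<in>F. f i x) h = (\<Sum>i\<in>F. l2_inner (f i) h)"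
  unfolding l2_inner_def using assms
  by (simp add: sum_distrib_right L2_inner_integrable)

lemma l2_inner_add_right:
  "f \<in> L2 \<Longrightarrow> g \<in> L2 \<Longrightarrow> h \<in> L2 \<Longrightarrow> l2_inner h (\<lambda>x. f x + g x) = l2_inner h f + l2_inner h g"
  by (subst (1 2 3) l2_inner_commute) (simp add: l2_inner_add_left)

lemma l2_inner_diff_right:
  "f \<in> L2 \<Longrightarrow> g \<in> L2 \<Longrightarrow> h \<in> L2 \<Longrightarrow> l2_inner h (\<lambda>x. f x - g x) = l2_inner h f - l2_inner h g"
  by (subst (1 2 3) l2_inner_commute) (simp add: l2_inner_diff_left)

lemma l2_inner_cmult_right: "l2_inner g (\<lambda>x. c * f x) = cnj c * l2_inner g f"
  by (subst (1 2) l2_inner_commute) (simp add: l2_inner_cmult_left)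

lemma l2_inner_sum_right:
  assumes "\<And>i. i \<in> F \<Longrightarrow> f i \<in> L2" "h \<in> L2"
  shows "l2_inner h (\<lambda>x. \<Sum>i\<in>F. f i x) = (\<Sum>i\<in>F. l2_inner h (f i))"
  by (subst (1 2) l2_inner_commute) (simp add: l2_inner_sum_left assms)

lemma l2_norm_add_squared:
  assumes "f \<in> L2" "g \<in> L2"
  shows "(l2_norm (\<lambda>x. f x + g x))\<^sup>2 = (l2_norm f)\<^sup>2 + (l2_norm g)\<^sup>2 + 2 * Re (l2_inner f g)"
proof -
  have "complex_of_real ((l2_norm (\<lambda>x. f x + g x))\<^sup>2)
      = of_real ((l2_norm f)\<^sup>2) + of_real ((l2_norm g)\<^sup>2) + (l2_inner f g + cnj (l2_inner f g))"
    using assms unfolding l2_inner_self[symmetric]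
    by (subst l2_inner_add_left, simp_all add: L2_add l2_inner_add_right flip: l2_inner_commute)
  also have "\<dots> = of_real ((l2_norm f)\<^sup>2 + (l2_norm g)\<^sup>2 + 2 * Re (l2_inner f g))"
    by (simp add: complex_add_cnj)
  finally show ?thesis using of_real_eq_iff by blast
qed

lemma l2_norm_cmult: "l2_norm (\<lambda>x. c * f x) = cmod c * l2_norm f"
  by (simp add: l2_norm_def norm_mult power_mult_distrib real_sqrt_mult)

lemma l2_norm_uminus: "l2_norm (\<lambda>x. - f x) = l2_norm f"
  by (simp add: l2_norm_def)

lemma l2_norm_diff_commute: "l2_norm (\<lambda>x. f x - g x) = l2_norm (\<lambda>x. g x - f x)"
  by (simp add: l2_norm_def norm_minus_commute)

lemma l2_norm_diff_squared:
  assumes "f \<in> L2" "g \<in> L2"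
  shows "(l2_norm (\<lambda>x. f x - g x))\<^sup>2 = (l2_norm f)\<^sup>2 + (l2_norm g)\<^sup>2 - 2 * Re (l2_inner f g)"
  using l2_norm_add_squared[of f "\<lambda>x. - 1 * g x"] assms
  by (simp add: L2_uminus l2_norm_uminus l2_inner_cmult_right[of f "-1" g, simplified])

text \<open>Positivity of a quadratic polynomial in a real parameter. The degenerate case is
  separate because \<open>l2_norm\<close> is only a seminorm.\<close>

lemma Cauchy_Schwarz_l2:
  assumes "f \<in> L2" "g \<in> L2" shows "cmod (l2_inner f g) \<le> l2_norm f * l2_norm g"
proof -
  let ?p = "l2_inner f g"
  have key: "0 \<le> (l2_norm f)\<^sup>2 + t\<^sup>2 * (cmod ?p)\<^sup>2 * (l2_norm g)\<^sup>2 - 2 * t * (cmod ?p)\<^sup>2" for t :: real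
  proof -
    have "0 \<le> (l2_norm (\<lambda>x. f x - (of_real t * ?p) * g x))\<^sup>2" by simp
    also have "\<dots> = (l2_norm f)\<^sup>2 + (l2_norm (\<lambda>x. (of_real t * ?p) * g x))\<^sup>2
        - 2 * Re (cnj (of_real t * ?p) * ?p)"
      using assms by (subst l2_norm_diff_squared) (auto simp only: l2_inner_cmult_right L2_cmult)
    also have "cnj (of_real t * ?p) * ?p = of_real (t * (cmod ?p)\<^sup>2)"
      by (simp add: complex_norm_square mult_ac del: of_real_power)
    finally show ?thesis by (simp add: l2_norm_cmult norm_mult power_mult_distrib)
  qed
  show ?thesis
  proof (cases "l2_norm g = 0")
    case True
    have "?p = 0"
    proof (rule ccontr)
      assume "?p \<noteq> 0"
      then have "0 < (cmod ?p)\<^sup>2" by simp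
      \<comment> \<open>When \<open>g\<close> has seminorm 0 the polynomial is linear in
        \<open>t\<close>; this value of \<open>t\<close> makes it equal to minus the squared norm of
        \<open>f\<close>, minus 2.\<close>
      then show False
        using key[of "((l2_norm f)\<^sup>2 + 1) / (cmod ?p)\<^sup>2"] True zero_le_power2[of "l2_norm f"]
        by (simp add: add_pos_nonneg not_le del: zero_le_power2)
    qed
    then show ?thesis by simp
  next
    case False
    then have "0 < (l2_norm g)\<^sup>2" by simp
    then have "(cmod ?p)\<^sup>2 \<le> (l2_norm f)\<^sup>2 * (l2_norm g)\<^sup>2"
    proof -
      define G where "G = (l2_norm g)\<^sup>2"
      have G: "0 < G" using \<open>0 < (l2_norm g)\<^sup>2\<close> by (simp add: G_def)
      \<comment> \<open>The parameter \<open>1 / G\<close> minimizes the quadratic.\<close>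
      have "0 \<le> (l2_norm f)\<^sup>2 + (1 / G)\<^sup>2 * (cmod ?p)\<^sup>2 * G - 2 * (1 / G) * (cmod ?p)\<^sup>2"
        using key[of "1 / G"] by (simp add: G_def)
      also have "\<dots> = (l2_norm f)\<^sup>2 - (cmod ?p)\<^sup>2 / G"
        using G by (simp add: power2_eq_square[of "1 / G"])
      finally have "(cmod ?p)\<^sup>2 / G \<le> (l2_norm f)\<^sup>2" by linarith
      then show ?thesis using G unfolding G_def[symmetric] by (simp only: pos_divide_le_eq)
    qed
    then have "(cmod ?p)\<^sup>2 \<le> (l2_norm f * l2_norm g)\<^sup>2" by (simp only: power_mult_distrib)
    then show ?thesis by (rule power2_le_imp_le) simp
  qed
qed

lemma l2_norm_triangle:
  assumes "f \<in> L2" "g \<in> L2" shows "l2_norm (\<lambda>x. f x + g x) \<le> l2_norm f + l2_norm g"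
proof (rule power2_le_imp_le)
  have "Re (l2_inner f g) \<le> l2_norm f * l2_norm g"
    using Cauchy_Schwarz_l2[OF assms] complex_Re_le_cmod order_trans by blast
  then show "(l2_norm (\<lambda>x. f x + g x))\<^sup>2 \<le> (l2_norm f + l2_norm g)\<^sup>2"
    by (simp add: l2_norm_add_squared assms power2_sum)
qed simp

lemma l2_norm_triangle_diff:
  assumes "f \<in> L2" "g \<in> L2" "h \<in> L2"
  shows "l2_norm (\<lambda>x. f x - h x) \<le> l2_norm (\<lambda>x. f x - g x) + l2_norm (\<lambda>x. g x - h x)"
  using l2_norm_triangle[of "\<lambda>x. f x - g x" "\<lambda>x. g x - h x"] assms by (simp add: L2_diff)

lemma l2_norm_triangle_rev:
  assumes "f \<in> L2" "g \<in> L2" shows "\<bar>l2_norm f - l2_norm g\<bar> \<le> l2_norm (\<lambda>x. f x - g x)"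
  using l2_norm_triangle[of "\<lambda>x. f x - g x" g] l2_norm_triangle[of "\<lambda>x. g x - f x" f] assms
    l2_norm_diff_commute[of f g] by (simp add: L2_diff)

lemma l2_norm_eq_0_iff: "f \<in> L2 \<Longrightarrow> l2_norm f = 0 \<longleftrightarrow> (AE x in lebesgue. f x = 0)"
  unfolding l2_norm_def by (simp add: integral_nonneg_eq_0_iff_AE L2_integrable)

lemma l2_norm_cong_AE:
  assumes "AE x in lebesgue. f x = g x" "f \<in> borel_measurable lebesgue" "g \<in> borel_measurable lebesgue"
  shows "l2_norm f = l2_norm g"
  unfolding l2_norm_def using assms by (intro arg_cong[of _ _ sqrt] integral_cong_AE) auto

text \<open>Comparing \<open>c\<close> with \<open>- c\<close> cancels the squared norms and leaves
  the real part of \<open>cnj c\<close> times the inner product; \<open>c = 1\<close> and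
  \<open>c = \<i>\<close> recover both components.\<close>

lemma polarization:
  assumes L: "f \<in> L2" "g \<in> L2" "f' \<in> L2" "g' \<in> L2"
    and eq: "\<And>c. l2_norm (\<lambda>x. f x + c * g x) = l2_norm (\<lambda>x. f' x + c * g' x)"
  shows "l2_inner f g = l2_inner f' g'"
proof -
  have Re_eq: "Re (cnj c * l2_inner f g) = Re (cnj c * l2_inner f' g')" for c
  proof -
    have n: "l2_norm f = l2_norm f'" using eq[of 0] by simp
    have "2 * Re (l2_inner f (\<lambda>x. c * g x)) + (l2_norm (\<lambda>x. c * g x))\<^sup>2
        = 2 * Re (l2_inner f' (\<lambda>x. c * g' x)) + (l2_norm (\<lambda>x. c * g' x))\<^sup>2" for c
      using l2_norm_add_squared[of f "\<lambda>x. c * g x"] l2_norm_add_squared[of f' "\<lambda>x. c * g' x"] L eq[of c] n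
      by (simp add: L2_cmult)
    from this[of c] this[of "-c"] show ?thesis
      by (simp only: l2_inner_cmult_right l2_norm_cmult norm_minus_cancel) simp
  qed
  show ?thesis using Re_eq[of 1] Re_eq[of \<i>] by (simp add: complex_eq_iff)
qed

section \<open>Convergence in the mean\<close>

lemma l2_tendsto_iff:
  assumes "\<And>k. s k \<in> L2" "f \<in> L2"
  shows "l2_tendsto s f \<longleftrightarrow> (\<lambda>k. l2_norm (\<lambda>x. s k x - f x)) \<longlonglongrightarrow> 0"
proof -
  have "l2_tendsto s f \<longleftrightarrow> (\<lambda>k. ennreal ((l2_norm (\<lambda>x. s k x - f x))\<^sup>2)) \<longlonglongrightarrow> ennreal 0"
    unfolding l2_tendsto_def using assms by (simp add: nn_integral_l2_norm L2_diff)
  also have "\<dots> \<longleftrightarrow> (\<lambda>k. (l2_norm (\<lambda>x. s k x - f x))\<^sup>2) \<longlonglongrightarrow> 0"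
    by (subst tendsto_ennreal_iff) auto
  also have "\<dots> \<longleftrightarrow> (\<lambda>k. l2_norm (\<lambda>x. s k x - f x)) \<longlonglongrightarrow> 0"
  proof
    assume "(\<lambda>k. (l2_norm (\<lambda>x. s k x - f x))\<^sup>2) \<longlonglongrightarrow> 0"
    from tendsto_real_sqrt[OF this] show "(\<lambda>k. l2_norm (\<lambda>x. s k x - f x)) \<longlonglongrightarrow> 0" by simp
  qed (auto dest: tendsto_power[where n = 2])
  finally show ?thesis .
qed

lemma l2_norm_tendsto:
  assumes "\<And>k. s k \<in> L2" "f \<in> L2" "(\<lambda>k. l2_norm (\<lambda>x. s k x - f x)) \<longlonglongrightarrow> 0"
  shows "(\<lambda>k. l2_norm (s k)) \<longlonglongrightarrow> l2_norm f"
  by (rule LIM_zero_cancel, rule tendsto_rabs_zero_cancel,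
      rule tendsto_sandwich[OF _ _ tendsto_const assms(3)])
    (auto intro!: always_eventually l2_norm_triangle_rev assms)

lemma l2_inner_tendsto:
  assumes s: "\<And>k. s k \<in> L2" "f \<in> L2" "(\<lambda>k. l2_norm (\<lambda>x. s k x - f x)) \<longlonglongrightarrow> 0"
    and r: "\<And>k. r k \<in> L2" "g \<in> L2" "(\<lambda>k. l2_norm (\<lambda>x. r k x - g x)) \<longlonglongrightarrow> 0"
  shows "(\<lambda>k. l2_inner (s k) (r k)) \<longlonglongrightarrow> l2_inner f g"
proof (rule LIM_zero_cancel, rule tendsto_norm_zero_cancel, rule tendsto_sandwich[OF _ _ tendsto_const])
  let ?d = "\<lambda>k. l2_norm (\<lambda>x. s k x - f x) * l2_norm (r k) + l2_norm f * l2_norm (\<lambda>x. r k x - g x)"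
  have "l2_inner (s k) (r k) - l2_inner f g
      = l2_inner (\<lambda>x. s k x - f x) (r k) + l2_inner f (\<lambda>x. r k x - g x)" for k
    using s(1,2) r(1,2) by (simp add: l2_inner_diff_left l2_inner_diff_right)
  moreover have "cmod (l2_inner (\<lambda>x. s k x - f x) (r k)) \<le> l2_norm (\<lambda>x. s k x - f x) * l2_norm (r k)" for k
    by (rule Cauchy_Schwarz_l2) (use s r in auto)
  moreover have "cmod (l2_inner f (\<lambda>x. r k x - g x)) \<le> l2_norm f * l2_norm (\<lambda>x. r k x - g x)" for k
    by (rule Cauchy_Schwarz_l2) (use s r in auto)
  ultimately have "norm (l2_inner (s k) (r k) - l2_inner f g) \<le> ?d k" for k
    by (metis (no_types) add_mono norm_triangle_mono)
  then show "\<forall>\<^sub>F k in sequentially. norm (l2_inner (s k) (r k) - l2_inner f g) \<le> ?d k" by simp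
  have "?d \<longlonglongrightarrow> 0 * l2_norm g + l2_norm f * 0"
    by (intro tendsto_intros s r l2_norm_tendsto)
  then show "?d \<longlonglongrightarrow> 0" by simp
qed auto

lemma L2_mult_indicator:
  assumes "f \<in> L2" "E \<in> sets lebesgue" shows "(\<lambda>x. f x * indicator E x) \<in> L2"
  by (rule L2_dominated[OF assms(1)]) (use assms in \<open>auto intro!: borel_measurable_times L2_measurable simp: norm_mult indicator_def\<close>)

lemma L2_indicator:
  assumes "E \<in> lmeasurable" shows "(indicator E :: real^'n \<Rightarrow> complex) \<in> L2"
proof -
  have "(\<lambda>x. (cmod (indicator E x))\<^sup>2) = (indicator E :: real^'n \<Rightarrow> real)"
    by (auto simp: indicator_def)
  then show ?thesis using assms by (auto simp: L2_def fmeasurable_def)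
qed

lemma l2_norm_dominated_convergence:
  fixes f :: "real^'n \<Rightarrow> complex"
  assumes "w \<in> L2" "f \<in> L2" "\<And>k. s k \<in> L2"
    and lim: "\<And>x. (\<lambda>k. s k x) \<longlonglongrightarrow> f x" and bd: "\<And>k x. cmod (s k x - f x) \<le> cmod (w x)"
  shows "(\<lambda>k. l2_norm (\<lambda>x. s k x - f x)) \<longlonglongrightarrow> 0"
proof -
  have "(\<lambda>k. LINT x|lebesgue. (cmod (s k x - f x))\<^sup>2) \<longlonglongrightarrow> (LINT x|(lebesgue :: (real^'n) measure). (0::real))"
  proof (rule Bochner_Integration.integral_dominated_convergence[where w = "\<lambda>x. (cmod (w x))\<^sup>2"])
    show "integrable lebesgue (\<lambda>x. (cmod (w x))\<^sup>2)" by (simp add: L2_integrable assms)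
    have "(\<lambda>k. (cmod (s k x - f x))\<^sup>2) \<longlonglongrightarrow> (cmod (f x - f x))\<^sup>2" for x
      by (intro tendsto_intros lim)
    then show "AE x in lebesgue. (\<lambda>k. (cmod (s k x - f x))\<^sup>2) \<longlonglongrightarrow> 0" by simp
    show "AE x in lebesgue. norm ((cmod (s k x - f x))\<^sup>2) \<le> (cmod (w x))\<^sup>2" for k
      using bd by (auto intro!: power_mono)
  qed (use assms in \<open>auto intro!: borel_measurable_power borel_measurable_norm borel_measurable_diff L2_measurable\<close>)
  then have "(\<lambda>k. sqrt (LINT x|lebesgue. (cmod (s k x - f x))\<^sup>2)) \<longlonglongrightarrow> sqrt 0"
    by (intro tendsto_real_sqrt) simp
  then show ?thesis by (simp add: l2_norm_def)
qed

section \<open>Linear changes of variables\<close>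

lemma nn_integral_lborel_translation:
  fixes f :: "'a::euclidean_space \<Rightarrow> ennreal"
  assumes [measurable]: "f \<in> borel_measurable borel"
  shows "(\<integral>\<^sup>+x. f (a + x) \<partial>lborel) = (\<integral>\<^sup>+x. f x \<partial>lborel)"
  by (subst (2) lborel_distr_plus[of a, symmetric]) (simp add: nn_integral_distr)

lemma nn_integral_lborel_reflection:
  fixes f :: "'a::euclidean_space \<Rightarrow> ennreal"
  assumes [measurable]: "f \<in> borel_measurable borel"
  shows "(\<integral>\<^sup>+x. f (a - x) \<partial>lborel) = (\<integral>\<^sup>+x. f x \<partial>lborel)"
proof -
  have "lborel = distr lborel borel ((-) a)"
    using lborel_affine[of "-1" a] by (simp add: density_1)
  then have "(\<integral>\<^sup>+x. f x \<partial>lborel) = (\<integral>\<^sup>+x. f x \<partial>distr lborel borel ((-) a))" by (rule arg_cong)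
  then show ?thesis by (simp add: nn_integral_distr)
qed

lemma borel_measurable_matrix_vector_mult [measurable]: "(*v) M \<in> borel_measurable borel"
  for M :: "real^'n^'m"
  by (intro borel_measurable_continuous_onI linear_continuous_on linear_conv_bounded_linear[THEN iffD1]) simp

lemma matrix_inv_left: "invertible M \<Longrightarrow> matrix_inv M ** M = mat 1"
  unfolding matrix_inv_def invertible_def by (rule someI2_ex) auto

lemma matrix_inv_right: "invertible M \<Longrightarrow> M ** matrix_inv M = mat 1"
  unfolding matrix_inv_def invertible_def by (rule someI2_ex) auto

lemma matrix_inv_vec [simp]:
  assumes "invertible M" shows "matrix_inv M *v (M *v x) = x" "M *v (matrix_inv M *v x) = x"
  using assms by (simp_all add: matrix_vector_mul_assoc matrix_inv_left matrix_inv_right)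

lemma invertible_matrix_inv: "invertible M \<Longrightarrow> invertible (matrix_inv M)"
  unfolding invertible_def[of "matrix_inv M"] using matrix_inv_left matrix_inv_right by blast

text \<open>Two translation invariant measures are proportional; Fubini gives the proportionality
  between Lebesgue measure and its image under an invertible matrix.\<close>

lemma nn_integral_matrix_haar:
  fixes M :: "real^'n^'n"
  assumes M: "invertible M" and [measurable]: "f \<in> borel_measurable borel" "g \<in> borel_measurable borel"
  shows "(\<integral>\<^sup>+x. f (M *v x) \<partial>lborel) * (\<integral>\<^sup>+y. g y \<partial>lborel)
       = (\<integral>\<^sup>+x. g (M *v x) \<partial>lborel) * (\<integral>\<^sup>+y. f y \<partial>lborel)"
proof -
  have "(\<integral>\<^sup>+x. f (M *v x) \<partial>lborel) * (\<integral>\<^sup>+y. g y \<partial>lborel)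
      = (\<integral>\<^sup>+x. f (M *v x) * (\<integral>\<^sup>+y. g y \<partial>lborel) \<partial>lborel)"
    by (simp add: nn_integral_multc)
  \<comment> \<open>The shift by \<open>M x\<close> couples the two variables. After Fubini, the
    substitution \<open>x -> x - M^(-1) y\<close> moves the shift from \<open>g\<close> to
    \<open>f\<close>, and the reflection \<open>y -> M x - y\<close> then removes it.\<close>
  also have "\<dots> = (\<integral>\<^sup>+x. \<integral>\<^sup>+y. f (M *v x) * g (M *v x + y) \<partial>lborel \<partial>lborel)"
    by (simp add: nn_integral_cmult nn_integral_lborel_translation)
  also have "\<dots> = (\<integral>\<^sup>+y. \<integral>\<^sup>+x. f (M *v x) * g (M *v x + y) \<partial>lborel \<partial>lborel)"
    by (rule lborel_pair.Fubini') measurable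
  also have "\<dots> = (\<integral>\<^sup>+y. \<integral>\<^sup>+x. f (M *v x - y) * g (M *v x) \<partial>lborel \<partial>lborel)"
  proof (rule nn_integral_cong)
    fix y :: "real^'n"
    have "(\<integral>\<^sup>+x. f (M *v x) * g (M *v x + y) \<partial>lborel)
        = (\<integral>\<^sup>+x. f (M *v (- (matrix_inv M *v y) + x)) * g (M *v (- (matrix_inv M *v y) + x) + y) \<partial>lborel)"
      by (rule nn_integral_lborel_translation[symmetric]) measurable
    then show "(\<integral>\<^sup>+x. f (M *v x) * g (M *v x + y) \<partial>lborel) = (\<integral>\<^sup>+x. f (M *v x - y) * g (M *v x) \<partial>lborel)"
      by (simp add: matrix_vector_mult_diff_distrib M)
  qed
  also have "\<dots> = (\<integral>\<^sup>+x. \<integral>\<^sup>+y. f (M *v x - y) * g (M *v x) \<partial>lborel \<partial>lborel)"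
    by (rule lborel_pair.Fubini'[symmetric]) measurable
  also have "\<dots> = (\<integral>\<^sup>+x. g (M *v x) * (\<integral>\<^sup>+y. f y \<partial>lborel) \<partial>lborel)"
  proof (rule nn_integral_cong)
    fix x :: "real^'n"
    have "(\<integral>\<^sup>+y. f (M *v x - y) * g (M *v x) \<partial>lborel) = (\<integral>\<^sup>+y. f (M *v x - y) \<partial>lborel) * g (M *v x)"
      by (rule nn_integral_multc) measurable
    then show "(\<integral>\<^sup>+y. f (M *v x - y) * g (M *v x) \<partial>lborel) = g (M *v x) * (\<integral>\<^sup>+y. f y \<partial>lborel)"
      by (simp add: nn_integral_lborel_reflection mult.commute)
  qed
  also have "\<dots> = (\<integral>\<^sup>+x. g (M *v x) \<partial>lborel) * (\<integral>\<^sup>+y. f y \<partial>lborel)"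
    by (simp add: nn_integral_multc)
  finally show ?thesis .
qed

text \<open>The volume of the preimage of the unit box, which is the constant in the Haar
  proportionality. It is extended real because neither finiteness nor positivity is evident before
  it is computed.\<close>

definition modulus :: "real^'n^'n \<Rightarrow> ennreal" where
  "modulus M = (\<integral>\<^sup>+x. indicator (box 0 One) (M *v x) \<partial>lborel)"

lemma nn_integral_matrix_modulus:
  fixes M :: "real^'n^'n"
  assumes "invertible M" "f \<in> borel_measurable borel"
  shows "(\<integral>\<^sup>+x. f (M *v x) \<partial>lborel) = modulus M * (\<integral>\<^sup>+y. f y \<partial>lborel)"
  using nn_integral_matrix_haar[OF assms, of "indicator (box 0 One)"]
  by (simp add: modulus_def emeasure_lborel_box_eq inner_Basis)

lemma modulus_one [simp]: "modulus (mat 1) = 1"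
  by (simp add: modulus_def emeasure_lborel_box_eq)

lemma modulus_mult:
  fixes M N :: "real^'n^'n"
  assumes "invertible M" "invertible N" shows "modulus (M ** N) = modulus M * modulus N"
proof -
  have "modulus (M ** N) = (\<integral>\<^sup>+x. indicator (box 0 One) (M *v (N *v x)) \<partial>lborel)"
    by (simp add: modulus_def matrix_vector_mul_assoc)
  also have "\<dots> = modulus N * modulus M"
    using assms by (simp add: nn_integral_matrix_modulus[of N "\<lambda>y. indicator (box 0 One) (M *v y)"])
      (simp add: modulus_def)
  finally show ?thesis by (simp add: mult.commute)
qed

text \<open>Cancellation fails at 0 and at infinity; the inverse \<open>y\<close> excludes
  both.\<close>

lemma ennreal_self_square: "x * x = x \<Longrightarrow> x * y = 1 \<Longrightarrow> x = (1::ennreal)"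
  by (metis mult.assoc mult.right_neutral)

lemma ennreal_square_one:
  assumes "x * x = (1::ennreal)" shows "x = 1"
proof (cases x)
  case (real r)
  with assms have "r * r = 1" by (simp flip: ennreal_mult ennreal_1)
  with real show ?thesis by (metis abs_of_nonneg ennreal_1 power2_eq_square real_sqrt_abs real_sqrt_one)
next
  case top then show ?thesis using assms by simp
qed

text \<open>Both sides are multiplicative, so elementary matrices suffice. Only diagonal matrices
  need an explicit computation: a transposition squares to the identity, and a shear is treated by
  conjugation.\<close>

lemma modulus_eq: "invertible M \<Longrightarrow> modulus M = ennreal (1 / \<bar>det M\<bar>)" for M :: "real^'n^'n"
proof (induction M rule: induct_matrix_elementary_alt)
  case (1 A B)
  then have "invertible A" "invertible B" by (auto simp: invertible_det_nz det_mul)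
  with 1 show ?case
    by (simp add: modulus_mult det_mul abs_mult mult.commute flip: ennreal_mult)
next
  case (2 A i)
  then have "det A = 0" by (simp add: det_zero_row(1)[of i])
  then show ?case using 2 by (simp add: invertible_det_nz)
next
  case (3 A)
  have d: "det A = (\<Prod>i\<in>UNIV. A $ i $ i)" using 3(1) by (simp add: det_diagonal)
  let ?c = "\<lambda>b::real^'n. \<Sum>i\<in>UNIV. A $ i $ i * b $ i"
  have c: "?c (axis i 1) = A $ i $ i" for i by (simp add: axis_def if_distrib cong: if_cong)
  have nz: "?c b \<noteq> 0" if "b \<in> Basis" for b
    using that 3(2) unfolding invertible_det_nz d by (auto simp: Basis_vec_def c)
  have eq: "(\<Sum>b\<in>Basis. (?c b * (x \<bullet> b)) *\<^sub>R b) = A *v x" for x :: "real^'n"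
  proof -
    have "(\<Sum>b\<in>Basis. (?c b * (x \<bullet> b)) *\<^sub>R b) = (\<Sum>i\<in>UNIV. (A $ i $ i * x $ i) *\<^sub>R axis i 1)"
      by (simp add: Basis_vec_def sum.reindex inj_on_def axis_eq_axis c inner_axis sum.UNION_disjoint)
    also have "\<dots> = A *v x"
    proof -
      have "(\<Sum>j\<in>UNIV. A $ i $ j * x $ j) = (\<Sum>j\<in>UNIV. if j = i then A $ i $ i * x $ i else 0)" for i
        using 3(1) by (intro sum.cong) auto
      then show ?thesis
        by (simp add: vec_eq_iff matrix_vector_mult_def axis_def if_distrib cong: if_cong)
    qed
    finally show ?thesis .
  qed
  have p: "(\<Prod>b\<in>Basis. \<bar>?c b\<bar>) = \<bar>det A\<bar>"
  proof -
    have B: "Basis = range (\<lambda>i. axis i (1::real) :: real^'n)" by (auto simp: Basis_vec_def)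
    show ?thesis unfolding B by (simp add: prod.reindex inj_on_def axis_eq_axis c d abs_prod)
  qed
  have L: "lborel = density (distr lborel borel ((*v) A)) (\<lambda>x. ennreal \<bar>det A\<bar>)"
    using lborel_affine_euclidean[of ?c 0, OF nz] by (simp add: p eq)
  have "1 = (\<integral>\<^sup>+x. indicator (box 0 One :: (real^'n) set) x \<partial>lborel)"
    by (simp add: emeasure_lborel_box_eq)
  also have "\<dots> = (\<integral>\<^sup>+x. indicator (box 0 One) x \<partial>density (distr lborel borel ((*v) A)) (\<lambda>x. ennreal \<bar>det A\<bar>))"
    using L by (rule arg_cong)
  also have "\<dots> = (\<integral>\<^sup>+x. ennreal \<bar>det A\<bar> * indicator (box 0 One) x \<partial>distr lborel borel ((*v) A))"
    by (rule nn_integral_density) auto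
  also have "\<dots> = ennreal \<bar>det A\<bar> * modulus A"
    by (subst nn_integral_distr) (simp_all add: nn_integral_cmult modulus_def)
  finally have *: "ennreal \<bar>det A\<bar> * modulus A = 1" by simp
  have "0 < \<bar>det A\<bar>" using 3(2) by (simp add: invertible_det_nz)
  then have "ennreal (1 / \<bar>det A\<bar>) * (ennreal \<bar>det A\<bar> * modulus A) = modulus A"
    by (simp flip: mult.assoc ennreal_mult)
  then show ?case using * by simp
next
  case (4 m n)
  let ?P = "(\<chi> i j. mat 1 $ i $ Transposition.transpose m n j) :: real^'n^'n"
  have PP: "?P ** ?P = mat 1"
  proof -
    have eq: "i = Transposition.transpose m n j \<longleftrightarrow> j = Transposition.transpose m n i" for i j
      by (metis transpose_involutory)
    have "(\<Sum>j\<in>UNIV. (if i = Transposition.transpose m n j then 1 else 0) * x $ j) = x $ Transposition.transpose m n i"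
      for i and x :: "real^'n"
      unfolding eq by (simp add: if_distrib if_distribR cong: if_cong)
    then have "?P *v x = (\<chi> i. x $ Transposition.transpose m n i)" for x
      by (simp add: matrix_vector_mult_def mat_def)
    then show ?thesis
      by (simp add: matrix_eq vec_eq_iff flip: matrix_vector_mul_assoc)
  qed
  have "modulus ?P * modulus ?P = 1" using 4 by (simp add: PP flip: modulus_mult)
  then have "modulus ?P = 1" by (rule ennreal_square_one)
  moreover have "det ?P * det ?P = 1" by (simp add: PP flip: det_mul)
  then have "det ?P = 1 \<or> det ?P = - 1" by (simp only: square_eq_1_iff)
  then have "\<bar>det ?P\<bar> = 1" by linarith
  ultimately show ?case by simp
next
  case (5 m n)
  text \<open>A shear is conjugate to its square.\<close>
  let ?S = "(\<chi> i j. of_bool (i = m \<and> j = n \<or> i = j)) :: real^'n^'n"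
  \<comment> \<open>Doubling coordinate \<open>m\<close> doubles the off-diagonal entry of the shear
    under conjugation, and squaring the shear has the same effect.\<close>
  let ?D = "(\<chi> i j. if i = j then (if i = m then 2 else 1) else 0) :: real^'n^'n"
  have S: "?S *v x = (\<chi> i. if i = m then x $ m + x $ n else x $ i)" for x
  proof -
    have "(\<Sum>j\<in>UNIV. of_bool (i = m \<and> j = n \<or> i = j) * x $ j) = (if i = m then x $ m + x $ n else x $ i)" for i
    proof -
      have "(\<Sum>j\<in>UNIV. of_bool (i = m \<and> j = n \<or> i = j) * x $ j)
          = (\<Sum>j\<in>UNIV. (if j = i then x $ j else 0) + (if j = n then (if i = m then x $ j else 0) else 0))"
        using 5(1) by (intro sum.cong) auto
      then show ?thesis by (simp add: sum.distrib)
    qed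
    then show ?thesis by (simp add: matrix_vector_mult_def)
  qed
  have D: "?D *v x = (\<chi> i. if i = m then 2 * x $ i else x $ i)" for x
  proof -
    have "(\<Sum>j\<in>UNIV. (if i = j then (if i = m then 2 else 1) else 0) * x $ j)
        = (\<Sum>j\<in>UNIV. if j = i then (if i = m then 2 * x $ i else x $ i) else 0)" for i
      by (intro sum.cong) auto
    then show ?thesis by (simp add: matrix_vector_mult_def)
  qed
  have DS: "?D ** ?S = (?S ** ?S) ** ?D"
    using 5(1) unfolding matrix_eq matrix_vector_mul_assoc[symmetric] S D by (simp add: vec_eq_iff)
  have detD: "det ?D \<noteq> 0" by (subst det_diagonal) auto
  have detS: "det ?S \<noteq> 0" using 5(2) by (simp add: invertible_det_nz)
  have "det ?D * det ?S = (det ?S * det ?S) * det ?D" using arg_cong[OF DS, of det] by (simp only: det_mul)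
  then have "det ?S = 1" using detD detS by simp
  moreover have "modulus ?S = 1"
  proof (rule ennreal_self_square)
    have inv: "invertible ?D" "invertible ?S" using detD 5(2) by (simp_all only: invertible_det_nz not_False_eq_True)
    have SS: "modulus ?S * modulus (matrix_inv ?S) = 1"
      using inv by (simp flip: modulus_mult add: invertible_matrix_inv matrix_inv_right)
    have DD: "modulus ?D * modulus (matrix_inv ?D) = 1"
      using inv by (simp flip: modulus_mult add: invertible_matrix_inv matrix_inv_right)
    have "modulus ?S * modulus ?D = (modulus ?S * modulus ?S) * modulus ?D"
      using arg_cong[OF DS, of modulus] inv by (simp only: modulus_mult invertible_mult mult.commute)
    then have "(modulus ?S * modulus ?D) * modulus (matrix_inv ?D) = ((modulus ?S * modulus ?S) * modulus ?D) * modulus (matrix_inv ?D)"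
      by simp
    then show "modulus ?S * modulus ?S = modulus ?S" by (simp only: mult.assoc DD mult_1_right)
    show "modulus ?S * modulus (matrix_inv ?S) = 1" by (rule SS)
  qed
  ultimately show ?case by simp
qed

lemma
  fixes M :: "real^'n^'n"
  assumes M: "invertible M"
  shows measurable_matrix_lebesgue: "(*v) M \<in> lebesgue \<rightarrow>\<^sub>M lebesgue"
    and distr_matrix_lebesgue:
      "distr lebesgue lebesgue ((*v) M) = density lebesgue (\<lambda>_. ennreal (1 / \<bar>det M\<bar>))"
proof -
  have d: "0 < 1 / \<bar>det M\<bar>" using M by (simp add: invertible_det_nz)
  have borel: "distr lborel borel ((*v) M) = density lborel (\<lambda>_. ennreal (1 / \<bar>det M\<bar>))"
  proof (rule measure_eqI)
    fix S assume "S \<in> sets (distr lborel borel ((*v) M))"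
    then have [measurable]: "S \<in> sets borel" by simp
    have "emeasure (distr lborel borel ((*v) M)) S = (\<integral>\<^sup>+x. indicator S x \<partial>distr lborel borel ((*v) M))"
      by simp
    also have "\<dots> = (\<integral>\<^sup>+x. indicator S (M *v x) \<partial>lborel)"
      by (rule nn_integral_distr) auto
    also have "\<dots> = ennreal (1 / \<bar>det M\<bar>) * emeasure lborel S"
      by (simp add: nn_integral_matrix_modulus M modulus_eq)
    also have "\<dots> = emeasure (density lborel (\<lambda>_. ennreal (1 / \<bar>det M\<bar>))) S"
      by (simp add: emeasure_density nn_integral_cmult)
    finally show "emeasure (distr lborel borel ((*v) M)) S = emeasure (density lborel (\<lambda>_. ennreal (1 / \<bar>det M\<bar>))) S" .
  qed simp
  have mb: "(*v) M \<in> lebesgue \<rightarrow>\<^sub>M lborel" by (rule measurable_completion) (simp add: borel_measurable_matrix_vector_mult)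
  have eqd: "distr lebesgue lborel ((*v) M) = distr lborel borel ((*v) M)"
    by (subst distr_completion) (auto intro!: distr_cong)
  \<comment> \<open>Positivity of the factor makes the null sets agree. This is what allows the
    passage to the completion: otherwise the preimage of a Lebesgue null set might fail to be
    measurable.\<close>
  have null: "null_sets lborel = null_sets (distr lebesgue lborel ((*v) M))"
    unfolding eqd borel using d
    by (auto simp: null_sets_def emeasure_density nn_integral_cmult simp del: ennreal_1 ennreal_eq_1)
  show m: "(*v) M \<in> lebesgue \<rightarrow>\<^sub>M lebesgue"
    by (rule completion.measurable_completion2[OF mb]) (use null in simp)
  have "distr lebesgue lebesgue ((*v) M) = completion (distr lebesgue lborel ((*v) M))"
    using null mb by (subst completion.completion_distr_eq) simp_all
  also have "\<dots> = completion (density lborel (\<lambda>_. ennreal (1 / \<bar>det M\<bar>)))"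
    unfolding eqd borel ..
  also have "\<dots> = density lebesgue (\<lambda>_. ennreal (1 / \<bar>det M\<bar>))"
    using d by (intro completion_density_eq) auto
  finally show "distr lebesgue lebesgue ((*v) M) = density lebesgue (\<lambda>_. ennreal (1 / \<bar>det M\<bar>))" .
qed

lemma nn_integral_matrix:
  fixes M :: "real^'n^'n"
  assumes "invertible M" "f \<in> borel_measurable lebesgue"
  shows "(\<integral>\<^sup>+x. f (M *v x) \<partial>lebesgue) = ennreal (1 / \<bar>det M\<bar>) * (\<integral>\<^sup>+x. f x \<partial>lebesgue)"
proof -
  have "(\<integral>\<^sup>+x. f (M *v x) \<partial>lebesgue) = (\<integral>\<^sup>+x. f x \<partial>distr lebesgue lebesgue ((*v) M))"
    using assms by (intro nn_integral_distr[symmetric] measurable_matrix_lebesgue) auto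
  also have "\<dots> = (\<integral>\<^sup>+x. ennreal (1 / \<bar>det M\<bar>) * f x \<partial>lebesgue)"
    unfolding distr_matrix_lebesgue[OF assms(1)] using assms(2) by (intro nn_integral_density) auto
  finally show ?thesis using assms(2) by (simp add: nn_integral_cmult)
qed

lemma
  fixes M :: "real^'n^'n" and f :: "real^'n \<Rightarrow> 'b::{banach, second_countable_topology}"
  assumes "invertible M" "f \<in> borel_measurable lebesgue"
  shows integral_matrix: "(LINT x|lebesgue. f (M *v x)) = (1 / \<bar>det M\<bar>) *\<^sub>R (LINT x|lebesgue. f x)"
    and integrable_matrix: "integrable lebesgue f \<Longrightarrow> integrable lebesgue (\<lambda>x. f (M *v x))"
proof -
  note m = measurable_matrix_lebesgue[OF assms(1)]
  have "(LINT x|lebesgue. f (M *v x)) = (LINT x|distr lebesgue lebesgue ((*v) M). f x)"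
    by (rule integral_distr[symmetric, OF m assms(2)])
  also have "\<dots> = (LINT x|lebesgue. (1 / \<bar>det M\<bar>) *\<^sub>R f x)"
    unfolding distr_matrix_lebesgue[OF assms(1)] using assms(2) by (intro integral_density) auto
  finally show "(LINT x|lebesgue. f (M *v x)) = (1 / \<bar>det M\<bar>) *\<^sub>R (LINT x|lebesgue. f x)" by simp
  assume "integrable lebesgue f"
  then have "integrable (density lebesgue (\<lambda>_. ennreal (1 / \<bar>det M\<bar>))) f"
    by (subst integrable_density) auto
  then show "integrable lebesgue (\<lambda>x. f (M *v x))"
    unfolding distr_matrix_lebesgue[OF assms(1), symmetric] by (rule integrable_distr[OF m])
qed

lemma distr_translation_lebesgue: "distr lebesgue lebesgue ((+) a) = (lebesgue :: 'a::euclidean_space measure)"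
  using lebesgue_affine_euclidean[of "\<lambda>_. 1" a]
  by (simp add: euclidean_representation density_1)

lemma measurable_translation_lebesgue: "(+) a \<in> lebesgue \<rightarrow>\<^sub>M (lebesgue :: 'a::euclidean_space measure)"
  using lebesgue_affine_measurable[of "\<lambda>_. 1" a] by (simp add: euclidean_representation)

lemma nn_integral_translation:
  fixes f :: "'a::euclidean_space \<Rightarrow> ennreal"
  assumes "f \<in> borel_measurable lebesgue"
  shows "(\<integral>\<^sup>+x. f (x + a) \<partial>lebesgue) = (\<integral>\<^sup>+x. f x \<partial>lebesgue)"
  using nn_integral_distr[OF measurable_translation_lebesgue[of a], of f] assms
  by (simp add: distr_translation_lebesgue add.commute)

lemma
  fixes f :: "'a::euclidean_space \<Rightarrow> 'b::{banach, second_countable_topology}"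
  assumes "f \<in> borel_measurable lebesgue"
  shows integral_translation: "(LINT x|lebesgue. f (x + a)) = (LINT x|lebesgue. f x)"
    and integrable_translation: "integrable lebesgue f \<Longrightarrow> integrable lebesgue (\<lambda>x. f (x + a))"
  using integral_distr[OF measurable_translation_lebesgue[of a], of f]
    integrable_distr_eq[OF measurable_translation_lebesgue[of a], of f] assms
  by (simp_all add: distr_translation_lebesgue add.commute)

lemma AE_translation:
  assumes "AE x in lebesgue. P (x :: 'a::euclidean_space)" shows "AE x in lebesgue. P (x + a)"
proof -
  have "AE x in distr lebesgue lebesgue ((+) a). P x"
    unfolding distr_translation_lebesgue by (rule assms)
  from AE_distrD[OF measurable_translation_lebesgue this] show ?thesis by (simp add: add.commute)
qed

lemma AE_matrix:
  fixes M :: "real^'n^'n"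
  assumes "invertible M" "AE x in lebesgue. P x" shows "AE x in lebesgue. P (M *v x)"
proof -
  have "AE x in distr lebesgue lebesgue ((*v) M). P x"
    unfolding distr_matrix_lebesgue[OF assms(1)] using assms(2) by (subst AE_density) auto
  from AE_distrD[OF measurable_matrix_lebesgue[OF assms(1)] this] show ?thesis .
qed

section \<open>Completeness and closed spans\<close>

lemma AE_convergent_if_summable_norms:
  fixes u :: "nat \<Rightarrow> real^'n \<Rightarrow> complex"
  assumes u: "\<And>k. u k \<in> L2" and d: "\<And>k. l2_norm (\<lambda>x. u (Suc k) x - u k x) \<le> (1/2) ^ k"
  shows "AE x in lebesgue. convergent (\<lambda>k. u k x)"
proof -
  have [measurable]: "\<And>k. u k \<in> borel_measurable lebesgue" using u by (rule L2_measurable)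
  \<comment> \<open>The squared increments have integral at most \<open>4^(-k)\<close>. The weight
    \<open>2^k\<close> leaves the integrals summable and still forces geometric decay of the
    increments at almost every point.\<close>
  let ?w = "\<lambda>k x. 2 ^ k * (cmod (u (Suc k) x - u k x))\<^sup>2"
  have "(\<integral>\<^sup>+x. (\<Sum>k. ennreal (?w k x)) \<partial>lebesgue) = (\<Sum>k. \<integral>\<^sup>+x. ennreal (?w k x) \<partial>lebesgue)"
    by (rule nn_integral_suminf) measurable
  also have "\<dots> \<le> (\<Sum>k. ennreal ((1/2) ^ k))"
  proof (rule suminf_le)
    fix k
    have "(\<integral>\<^sup>+x. ennreal (?w k x) \<partial>lebesgue)
        = ennreal (2 ^ k) * (\<integral>\<^sup>+x. ennreal ((cmod (u (Suc k) x - u k x))\<^sup>2) \<partial>lebesgue)"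
      by (simp add: ennreal_mult nn_integral_cmult)
    also have "\<dots> = ennreal (2 ^ k * (l2_norm (\<lambda>x. u (Suc k) x - u k x))\<^sup>2)"
      using u by (simp add: nn_integral_l2_norm L2_diff ennreal_mult)
    also have "\<dots> \<le> ennreal (2 ^ k * ((1/2) ^ k)\<^sup>2)"
      using d[of k] by (intro ennreal_leI mult_left_mono power_mono) auto
    also have "2 ^ k * ((1/2) ^ k)\<^sup>2 = ((1/2) ^ k :: real)"
      by (simp add: power2_eq_square power_one_over)
    finally show "(\<integral>\<^sup>+x. ennreal (?w k x) \<partial>lebesgue) \<le> ennreal ((1/2) ^ k)" .
  qed auto
  also have "\<dots> < \<infinity>"
    by (subst suminf_ennreal_eq[of _ 2]) (use geometric_sums[of "1/2::real"] in auto)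
  finally have "AE x in lebesgue. (\<Sum>k. ennreal (?w k x)) \<noteq> \<infinity>"
    by (intro nn_integral_noteq_infinite) auto
  then show ?thesis
  proof eventually_elim
    case (elim x)
    define S where "S = (\<Sum>k. ennreal (?w k x))"
    define C where "C = enn2real S"
    have "S < top" unfolding S_def using elim by (simp only: less_top infinity_ennreal_def)
    then have C: "0 \<le> C" "S = ennreal C" by (simp_all add: C_def)
    have "?w k x \<le> C" for k
    proof -
      have "sum (\<lambda>k. ennreal (?w k x)) {k} \<le> S"
        unfolding S_def by (rule sum_le_suminf) auto
      then have "ennreal (?w k x) \<le> ennreal C" unfolding C(2)[symmetric] by simp
      then show ?thesis using C(1) by (simp only: ennreal_le_iff)
    qed
    then have "(cmod (u (Suc k) x - u k x))\<^sup>2 \<le> C * (1/2) ^ k" for k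
      by (simp add: power_one_over divide_simps mult.commute)
    then have "sqrt ((cmod (u (Suc k) x - u k x))\<^sup>2) \<le> sqrt (C * (1/2) ^ k)" for k
      using real_sqrt_le_mono by blast
    then have "cmod (u (Suc k) x - u k x) \<le> sqrt C * sqrt (1/2) ^ k" for k
      by (simp add: real_sqrt_mult real_sqrt_power)
    moreover have "summable (\<lambda>k. sqrt C * sqrt (1/2) ^ k)"
      by (intro summable_mult summable_geometric) simp
    ultimately have "summable (\<lambda>k. u (Suc k) x - u k x)"
      by (metis (no_types, lifting) summable_comparison_test)
    then have "convergent (\<lambda>n. (\<Sum>k<n. u (Suc k) x - u k x) + u 0 x)"
      by (intro convergent_add convergent_const) (simp add: summable_iff_convergent)
    moreover have "(\<Sum>k<n. u (Suc k) x - u k x) + u 0 x = u n x" for n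
      by (simp add: sum_lessThan_telescope[of "\<lambda>k. u k x"])
    ultimately show ?case by simp
  qed
qed

text \<open>Riesz-Fischer: a subsequence with geometrically small steps converges almost everywhere,
  and Fatou's lemma turns the pointwise limit into a limit in the mean.\<close>

lemma L2_complete:
  fixes s :: "nat \<Rightarrow> real^'n \<Rightarrow> complex"
  assumes s: "\<And>k. s k \<in> L2"
    and Cauchy: "\<And>e. 0 < e \<Longrightarrow> \<exists>N. \<forall>m\<ge>N. \<forall>n\<ge>N. l2_norm (\<lambda>x. s m x - s n x) < e"
  shows "\<exists>g\<in>L2. (\<lambda>k. l2_norm (\<lambda>x. s k x - g x)) \<longlonglongrightarrow> 0"
proof -
  have "\<exists>N. \<forall>m\<ge>N. \<forall>n\<ge>N. l2_norm (\<lambda>x. s m x - s n x) < (1/2) ^ k" for k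
    by (rule Cauchy) simp
  then obtain N where N: "\<And>k m n. N k \<le> m \<Longrightarrow> N k \<le> n \<Longrightarrow> l2_norm (\<lambda>x. s m x - s n x) < (1/2) ^ k"
    by metis
  \<comment> \<open>A partial sum of natural numbers dominates each of its terms, so
    \<open>r m\<close> lies beyond all thresholds \<open>N k\<close> with \<open>k \<le> m\<close>,
    without a recursive choice.\<close>
  define r where "r k = (\<Sum>i\<le>k. N i)" for k
  have r: "N k \<le> r m" if "k \<le> m" for k m
    unfolding r_def using that by (intro member_le_sum) auto
  define u where "u k = s (r k)" for k
  have u: "u k \<in> L2" for k by (simp add: u_def s)
  have [measurable]: "\<And>k. u k \<in> borel_measurable lebesgue" using u by (rule L2_measurable)
  define g where "g x = lim (\<lambda>k. u k x)" for x
  have gm [measurable]: "g \<in> borel_measurable lebesgue"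
    unfolding g_def by (rule borel_measurable_lim_metric) simp
  have "AE x in lebesgue. convergent (\<lambda>k. u k x)"
    by (rule AE_convergent_if_summable_norms[OF u]) (auto simp: u_def intro!: less_imp_le N r)
  then have lim: "AE x in lebesgue. (\<lambda>k. u k x) \<longlonglongrightarrow> g x"
    by eventually_elim (simp add: g_def convergent_LIMSEQ_iff)
  \<comment> \<open>Fatou's lemma in the second index of the Cauchy estimate. That \<open>g\<close>
    is square integrable is a consequence of this bound, hence the formulation with the nonnegative
    integral.\<close>
  have bound: "(\<integral>\<^sup>+x. ennreal ((cmod (u k x - g x))\<^sup>2) \<partial>lebesgue) \<le> ennreal (((1/2) ^ k)\<^sup>2)" for k
  proof -
    have "(\<integral>\<^sup>+x. ennreal ((cmod (u k x - g x))\<^sup>2) \<partial>lebesgue)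
        = (\<integral>\<^sup>+x. liminf (\<lambda>m. ennreal ((cmod (u k x - u m x))\<^sup>2)) \<partial>lebesgue)"
    proof (rule nn_integral_cong_AE, use lim in eventually_elim)
      case (elim x)
      have "(\<lambda>m. ennreal ((cmod (u k x - u m x))\<^sup>2)) \<longlonglongrightarrow> ennreal ((cmod (u k x - g x))\<^sup>2)"
        by (intro tendsto_intros elim)
      then show ?case by (rule lim_imp_Liminf[OF trivial_limit_sequentially, symmetric])
    qed
    also have "\<dots> \<le> liminf (\<lambda>m. \<integral>\<^sup>+x. ennreal ((cmod (u k x - u m x))\<^sup>2) \<partial>lebesgue)"
      by (rule nn_integral_liminf) measurable
    also have "\<dots> \<le> ennreal (((1/2) ^ k)\<^sup>2)"
    proof (rule Liminf_le)
      show "\<forall>\<^sub>F m in sequentially. (\<integral>\<^sup>+x. ennreal ((cmod (u k x - u m x))\<^sup>2) \<partial>lebesgue) \<le> ennreal (((1/2) ^ k)\<^sup>2)"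
      proof (rule eventually_sequentiallyI)
        fix m assume "k \<le> m"
        then have "l2_norm (\<lambda>x. u k x - u m x) < (1/2) ^ k"
          unfolding u_def by (intro N r) auto
        then show "(\<integral>\<^sup>+x. ennreal ((cmod (u k x - u m x))\<^sup>2) \<partial>lebesgue) \<le> ennreal (((1/2) ^ k)\<^sup>2)"
          using u by (auto simp: nn_integral_l2_norm L2_diff intro!: ennreal_leI power_mono)
      qed
    qed simp
    finally show ?thesis .
  qed
  have ug: "(\<lambda>x. u k x - g x) \<in> L2" for k
    unfolding L2_iff_nn_integral using bound[of k] by (auto simp: less_top[symmetric] top_unique)
  have g: "g \<in> L2"
    using L2_diff[OF u[of 0] ug[of 0]] by simp
  have ug_le: "l2_norm (\<lambda>x. u k x - g x) \<le> (1/2) ^ k" for k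
  proof -
    have "ennreal ((l2_norm (\<lambda>x. u k x - g x))\<^sup>2) \<le> ennreal (((1/2) ^ k)\<^sup>2)"
      using bound[of k] ug[of k] by (simp only: nn_integral_l2_norm)
    then have "(l2_norm (\<lambda>x. u k x - g x))\<^sup>2 \<le> ((1/2) ^ k)\<^sup>2" by (subst (asm) ennreal_le_iff) auto
    then show ?thesis by (rule power2_le_imp_le) simp
  qed
  have "(\<lambda>k. l2_norm (\<lambda>x. s k x - g x)) \<longlonglongrightarrow> 0"
  proof (rule LIMSEQ_I)
    fix e :: real assume "0 < e"
    then obtain k where k: "(1/2) ^ k < e / 2"
      using real_arch_pow_inv[of "e/2" "1/2"] by auto
    have "l2_norm (\<lambda>x. s m x - g x) < e" if "N k \<le> m" for m
    proof -
      have "l2_norm (\<lambda>x. s m x - g x) \<le> l2_norm (\<lambda>x. s m x - u k x) + l2_norm (\<lambda>x. u k x - g x)"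
        by (rule l2_norm_triangle_diff) (use s u g in auto)
      also have "l2_norm (\<lambda>x. s m x - u k x) < (1/2) ^ k"
        unfolding u_def using that r by (intro N) auto
      finally show ?thesis using ug_le[of k] k by linarith
    qed
    then show "\<exists>no. \<forall>n\<ge>no. norm (l2_norm (\<lambda>x. s n x - g x) - 0) < e" by auto
  qed
  with g show ?thesis by blast
qed

lemma l2_norm_mono_AE:
  assumes "g \<in> L2" "f \<in> borel_measurable lebesgue" "AE x in lebesgue. cmod (f x) \<le> cmod (g x)"
  shows "l2_norm f \<le> l2_norm g"
  unfolding l2_norm_def
proof (rule real_sqrt_le_mono, rule integral_mono_AE)
  show "integrable lebesgue (\<lambda>x. (cmod (f x))\<^sup>2)" "integrable lebesgue (\<lambda>x. (cmod (g x))\<^sup>2)"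
    using assms L2_dominated L2_integrable by blast+
  show "AE x in lebesgue. (cmod (f x))\<^sup>2 \<le> (cmod (g x))\<^sup>2"
    using assms(3) by eventually_elim (auto intro: power_mono)
qed

lemma l2_norm_diff_eq_0_iff:
  assumes "f \<in> L2" "g \<in> L2" shows "l2_norm (\<lambda>x. f x - g x) = 0 \<longleftrightarrow> (AE x in lebesgue. f x = g x)"
  using assms by (simp add: l2_norm_eq_0_iff L2_diff)

text \<open>The difference of the two sides is the squared distance from \<open>f\<close> to its
  orthogonal projection \<open>p\<close>.\<close>

lemma bessel_inequality:
  assumes F: "finite F" and b: "\<And>i. i \<in> F \<Longrightarrow> b i \<in> L2" and f: "f \<in> L2"
    and on: "\<And>i j. i \<in> F \<Longrightarrow> j \<in> F \<Longrightarrow> l2_inner (b i) (b j) = (if i = j then 1 else 0)"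
  shows "(\<Sum>i\<in>F. (cmod (l2_inner f (b i)))\<^sup>2) \<le> (l2_norm f)\<^sup>2"
proof -
  define c where "c i = l2_inner f (b i)" for i
  define p where "p x = (\<Sum>i\<in>F. c i * b i x)" for x
  have p: "p \<in> L2" unfolding p_def by (intro L2_sum L2_cmult b)
  have fp: "l2_inner f p = of_real (\<Sum>i\<in>F. (cmod (c i))\<^sup>2)"
    unfolding p_def using b f
    by (subst l2_inner_sum_right) (auto simp: l2_inner_cmult_right c_def[symmetric] complex_norm_square mult.commute simp del: of_real_power)
  have bp: "l2_inner (b i) p = cnj (c i)" if "i \<in> F" for i
    unfolding p_def using b that F
    by (subst l2_inner_sum_right) (auto simp: l2_inner_cmult_right on if_distrib cong: if_cong)
  have "l2_inner p p = (\<Sum>i\<in>F. c i * l2_inner (b i) p)"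
  proof -
    have "l2_inner (\<lambda>x. \<Sum>i\<in>F. c i * b i x) p = (\<Sum>i\<in>F. c i * l2_inner (b i) p)"
      using b p by (simp add: l2_inner_sum_left l2_inner_cmult_left L2_cmult)
    moreover have "p = (\<lambda>x. \<Sum>i\<in>F. c i * b i x)" by (simp add: p_def fun_eq_iff)
    ultimately show ?thesis by simp
  qed
  also have "\<dots> = of_real (\<Sum>i\<in>F. (cmod (c i))\<^sup>2)"
    by (simp add: bp complex_norm_square[symmetric])
  finally have pp: "(l2_norm p)\<^sup>2 = (\<Sum>i\<in>F. (cmod (c i))\<^sup>2)"
    unfolding l2_inner_self of_real_eq_iff .
  have "0 \<le> (l2_norm (\<lambda>x. f x - p x))\<^sup>2" by simp
  also have "\<dots> = (l2_norm f)\<^sup>2 - (\<Sum>i\<in>F. (cmod (c i))\<^sup>2)"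
    using f p by (simp add: l2_norm_diff_squared fp pp)
  finally show ?thesis by (simp add: c_def)
qed

section \<open>Linear spans and closures in the mean\<close>

lemma l2_span_subset_L2: "(\<And>i. i \<in> I \<Longrightarrow> b i \<in> L2) \<Longrightarrow> l2_span I b \<subseteq> L2"
  by (auto simp: l2_span_def intro!: L2_sum)

lemma l2_span_mono: "I \<subseteq> J \<Longrightarrow> l2_span I b \<subseteq> l2_span J b"
  unfolding l2_span_def by blast

lemma l2_span_superset: "i \<in> I \<Longrightarrow> b i \<in> l2_span I b"
  unfolding l2_span_def by (rule CollectI, rule exI[of _ "{i}"], rule exI[of _ "\<lambda>_. 1"]) auto

lemma l2_span_zero: "(\<lambda>x. 0) \<in> l2_span I b"
  unfolding l2_span_def by (rule CollectI, rule exI[of _ "{}"]) auto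

lemma l2_span_add:
  assumes "f \<in> l2_span I b" "g \<in> l2_span I b" shows "(\<lambda>x. f x + g x) \<in> l2_span I b"
proof -
  obtain F c G d where F: "finite F" "F \<subseteq> I" "f = (\<lambda>x. \<Sum>i\<in>F. c i * b i x)"
    and G: "finite G" "G \<subseteq> I" "g = (\<lambda>x. \<Sum>i\<in>G. d i * b i x)"
    using assms unfolding l2_span_def by blast
  let ?e = "\<lambda>i. (if i \<in> F then c i else 0) + (if i \<in> G then d i else 0)"
  have "f x + g x = (\<Sum>i\<in>F \<union> G. ?e i * b i x)" for x
  proof -
    have "f x = (\<Sum>i\<in>F \<union> G. (if i \<in> F then c i else 0) * b i x)"
      unfolding F(3) by (rule sum.mono_neutral_cong_left) (use F G in auto)
    moreover have "g x = (\<Sum>i\<in>F \<union> G. (if i \<in> G then d i else 0) * b i x)"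
      unfolding G(3) by (rule sum.mono_neutral_cong_left) (use F G in auto)
    ultimately show ?thesis by (simp only: distrib_right sum.distrib)
  qed
  then show ?thesis
    unfolding l2_span_def using F G by (intro CollectI exI[of _ "F \<union> G"] exI[of _ ?e]) auto
qed

lemma l2_closure_iff:
  assumes "V \<subseteq> L2"
  shows "f \<in> l2_closure V \<longleftrightarrow> f \<in> L2 \<and> (\<forall>e>0. \<exists>g\<in>V. l2_norm (\<lambda>x. f x - g x) < e)"
proof safe
  assume f: "f \<in> l2_closure V"
  then show fL: "f \<in> L2" by (simp add: l2_closure_def)
  fix e :: real assume "0 < e"
  obtain s where s: "\<And>k. s k \<in> V" "l2_tendsto s f" using f by (auto simp: l2_closure_def)
  then have "(\<lambda>k. l2_norm (\<lambda>x. s k x - f x)) \<longlonglongrightarrow> 0"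
    using assms fL by (subst l2_tendsto_iff[symmetric]) auto
  from order_tendstoD(2)[OF this \<open>0 < e\<close>] obtain k where "l2_norm (\<lambda>x. s k x - f x) < e"
    by (auto simp: eventually_sequentially)
  then show "\<exists>g\<in>V. l2_norm (\<lambda>x. f x - g x) < e" using s(1) l2_norm_diff_commute by metis
next
  assume f: "f \<in> L2" and e: "\<forall>e>0. \<exists>g\<in>V. l2_norm (\<lambda>x. f x - g x) < e"
  have "\<exists>g\<in>V. l2_norm (\<lambda>x. f x - g x) < inverse (real (Suc k))" for k
    using e by simp
  then obtain s where s: "\<And>k. s k \<in> V" "\<And>k. l2_norm (\<lambda>x. f x - s k x) < inverse (real (Suc k))"
    by metis
  have "(\<lambda>k. l2_norm (\<lambda>x. s k x - f x)) \<longlonglongrightarrow> 0"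
    by (rule tendsto_sandwich[OF _ _ tendsto_const LIMSEQ_inverse_real_of_nat])
      (use s(2) in \<open>auto simp: l2_norm_diff_commute[of _ f] intro!: always_eventually less_imp_le\<close>)
  then have "l2_tendsto s f" using assms f s(1) by (subst l2_tendsto_iff) auto
  then show "f \<in> l2_closure V" using f s(1) by (auto simp: l2_closure_def)
qed

lemma l2_closure_subset_L2: "l2_closure V \<subseteq> L2"
  by (auto simp: l2_closure_def)

lemma l2_closure_mono: "V \<subseteq> W \<Longrightarrow> l2_closure V \<subseteq> l2_closure W"
  unfolding l2_closure_def by blast

lemma l2_closure_superset: "V \<subseteq> L2 \<Longrightarrow> V \<subseteq> l2_closure V"
proof
  fix f assume V: "V \<subseteq> L2" and f: "f \<in> V"
  have "l2_norm (\<lambda>x. f x - f x) = 0" by (simp add: l2_norm_def)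
  then have "\<exists>g\<in>V. l2_norm (\<lambda>x. f x - g x) < e" if "0 < e" for e using f that by force
  then show "f \<in> l2_closure V" using V f by (auto simp: l2_closure_iff)
qed

text \<open>The closure consists of limits of sequences from \<open>V\<close> itself; that it also
  absorbs limits of its own elements takes an \<open>e / 2\<close> argument.\<close>

lemma l2_closure_closed:
  assumes V: "V \<subseteq> L2" and f: "f \<in> L2" and e: "\<And>e. 0 < e \<Longrightarrow> \<exists>g\<in>l2_closure V. l2_norm (\<lambda>x. f x - g x) < e"
  shows "f \<in> l2_closure V"
  unfolding l2_closure_iff[OF V]
proof safe
  fix e :: real assume "0 < e"
  then obtain g where g: "g \<in> l2_closure V" "l2_norm (\<lambda>x. f x - g x) < e / 2"
    using e[of "e / 2"] by auto
  moreover obtain h where h: "h \<in> V" "l2_norm (\<lambda>x. g x - h x) < e / 2"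
    using g(1) \<open>0 < e\<close> unfolding l2_closure_iff[OF V] by (meson half_gt_zero)
  moreover have "g \<in> L2" "h \<in> L2" using g h V l2_closure_subset_L2 by blast+
  ultimately have "l2_norm (\<lambda>x. f x - h x) < e"
    using l2_norm_triangle_diff[OF f, of g h] by linarith
  then show "\<exists>g\<in>V. l2_norm (\<lambda>x. f x - g x) < e" using h(1) by blast
qed (rule f)

lemma l2_closure_span_add:
  assumes b: "\<And>i. i \<in> I \<Longrightarrow> b i \<in> L2"
    and "f \<in> l2_closure (l2_span I b)" "g \<in> l2_closure (l2_span I b)"
  shows "(\<lambda>x. f x + g x) \<in> l2_closure (l2_span I b)"
proof -
  have V: "l2_span I b \<subseteq> L2" by (rule l2_span_subset_L2) (rule b)
  have fg: "f \<in> L2" "g \<in> L2" using assms l2_closure_subset_L2 by blast+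
  show ?thesis unfolding l2_closure_iff[OF V]
  proof safe
    fix e :: real assume "0 < e"
    then obtain f' g' where f': "f' \<in> l2_span I b" "l2_norm (\<lambda>x. f x - f' x) < e / 2"
      and g': "g' \<in> l2_span I b" "l2_norm (\<lambda>x. g x - g' x) < e / 2"
      using assms(2,3) unfolding l2_closure_iff[OF V] by (meson half_gt_zero)
    have "l2_norm (\<lambda>x. (f x + g x) - (f' x + g' x)) \<le> l2_norm (\<lambda>x. f x - f' x) + l2_norm (\<lambda>x. g x - g' x)"
      using l2_norm_triangle[of "\<lambda>x. f x - f' x" "\<lambda>x. g x - g' x"] fg f'(1) g'(1) V
      by (auto simp: algebra_simps L2_diff)
    then have "l2_norm (\<lambda>x. (f x + g x) - (f' x + g' x)) < e" using f' g' by linarith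
    then show "\<exists>h\<in>l2_span I b. l2_norm (\<lambda>x. (f x + g x) - h x) < e"
      using l2_span_add[OF f'(1) g'(1)] by (intro bexI[of _ "\<lambda>x. f' x + g' x"])
  qed (use fg in auto)
qed

section \<open>Functions vanishing almost everywhere outside a set\<close>

lemma L2_on_subset_L2: "L2_on K \<subseteq> L2"
  by (auto simp: L2_on_def)

lemma L2_on_mult_indicator:
  "f \<in> L2 \<Longrightarrow> K \<in> sets lebesgue \<Longrightarrow> (\<lambda>x. f x * indicator K x) \<in> L2_on K"
  by (auto simp: L2_on_def L2_mult_indicator)

text \<open>Off \<open>K\<close> the approximants vanish, so there \<open>f\<close> is pointwise
  dominated by the error of approximation, which is arbitrarily small in norm.\<close>

lemma L2_on_closed:
  assumes K: "K \<in> sets lebesgue" and f: "f \<in> L2"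
    and e: "\<And>e. 0 < e \<Longrightarrow> \<exists>g\<in>L2_on K. l2_norm (\<lambda>x. f x - g x) < e"
  shows "f \<in> L2_on K"
proof -
  let ?h = "\<lambda>x. f x * indicator (- K) x"
  have h: "?h \<in> L2" using K f by (intro L2_mult_indicator) (auto simp: Compl_in_sets_lebesgue)
  have "l2_norm ?h \<le> e" if "0 < e" for e
  proof -
    obtain g where g: "g \<in> L2_on K" "l2_norm (\<lambda>x. f x - g x) < e" using e \<open>0 < e\<close> by blast
    have "AE x in lebesgue. cmod (?h x) \<le> cmod (f x - g x)"
      using g(1) by (auto simp: L2_on_def elim!: eventually_mono split: split_indicator)
    then have "l2_norm ?h \<le> l2_norm (\<lambda>x. f x - g x)"
      using g(1) f h by (intro l2_norm_mono_AE) (auto simp: L2_on_def L2_measurable)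
    then show ?thesis using g(2) by linarith
  qed
  then have "l2_norm ?h = 0" by (meson dense_ge l2_norm_nonneg order_antisym)
  then have "AE x in lebesgue. ?h x = 0" using h by (simp add: l2_norm_eq_0_iff)
  then show ?thesis using f by (auto simp: L2_on_def elim!: eventually_mono split: split_indicator_asm)
qed

lemma l2_closure_subset_L2_on:
  assumes "K \<in> sets lebesgue" "V \<subseteq> L2_on K" shows "l2_closure V \<subseteq> L2_on K"
proof
  fix f assume "f \<in> l2_closure V"
  moreover have "V \<subseteq> L2" using assms L2_on_subset_L2 by blast
  ultimately show "f \<in> L2_on K" using assms by (intro L2_on_closed) (auto simp: l2_closure_iff, blast)
qed

lemma L2_on_add: "f \<in> L2_on K \<Longrightarrow> g \<in> L2_on K \<Longrightarrow> (\<lambda>x. f x + g x) \<in> L2_on K"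
  by (auto simp: L2_on_def elim: eventually_elim2)

lemma L2_on_cmult: "f \<in> L2_on K \<Longrightarrow> (\<lambda>x. c * f x) \<in> L2_on K"
  by (auto simp: L2_on_def elim: eventually_mono)

lemma L2_on_sum: "(\<And>i. i \<in> F \<Longrightarrow> f i \<in> L2_on K) \<Longrightarrow> (\<lambda>x. \<Sum>i\<in>F. f i x) \<in> L2_on K"
  by (induction F rule: infinite_finite_induct) (auto simp: L2_on_add, simp_all add: L2_on_def)

lemma l2_span_subset_L2_on: "(\<And>i. i \<in> I \<Longrightarrow> b i \<in> L2_on K) \<Longrightarrow> l2_span I b \<subseteq> L2_on K"
  by (auto simp: l2_span_def intro!: L2_on_sum L2_on_cmult)

lemma L2_on_mono: "AE x in lebesgue. x \<in> K \<longrightarrow> x \<in> K' \<Longrightarrow> L2_on K \<subseteq> L2_on K'"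
  by (auto simp: L2_on_def elim: eventually_elim2)

lemma L2_on_cong: "AE x in lebesgue. x \<in> K \<longleftrightarrow> x \<in> K' \<Longrightarrow> L2_on K = L2_on K'"
  by (intro equalityI L2_on_mono) (auto elim: eventually_mono)

lemma L2_on_UNIV: "L2_on UNIV = L2"
  by (auto simp: L2_on_def)

section \<open>The Fourier integral\<close>

definition wave :: "real^'n \<Rightarrow> real^'n \<Rightarrow> complex" where
  "wave t x = exp (2 * of_real pi * \<i> * of_real (x \<bullet> t))"

lemma norm_wave [simp]: "cmod (wave t x) = 1"
  by (simp add: wave_def)

lemma wave_commute: "wave t x = wave x t"
  by (simp add: wave_def inner_commute)

lemma wave_add: "wave (s + t) x = wave s x * wave t x"
  by (simp add: wave_def inner_add_right ring_distribs exp_add)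

lemma wave_add_right: "wave t (x + y) = wave t x * wave t y"
  by (simp add: wave_def inner_add_left ring_distribs exp_add)

lemma wave_0 [simp]: "wave 0 x = 1"
  by (simp add: wave_def)

lemma wave_minus: "wave (- t) x = cnj (wave t x)"
  by (simp add: wave_def exp_cnj)

lemma wave_diff: "wave (s - t) x = wave s x * cnj (wave t x)"
  using wave_add[of s "- t" x] by (simp add: wave_minus)

lemma wave_int: "x \<bullet> t \<in> \<int> \<Longrightarrow> wave t x = 1"
  using exp_integer_2pi[of "of_real (x \<bullet> t)"] by (auto elim!: Ints_cases simp: wave_def mult_ac)

lemma borel_measurable_wave [measurable (raw)]:
  "f \<in> borel_measurable M \<Longrightarrow> g \<in> borel_measurable M \<Longrightarrow> (\<lambda>x. wave (f x) (g x)) \<in> borel_measurable M"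
  unfolding wave_def by measurable

lemma fourier_integral_wave: "fourier_integral f l = (LINT x|lebesgue. f x * cnj (wave l x))"
  by (simp add: fourier_integral_def wave_def exp_cnj)

lemma borel_measurable_if_lebesgue: "f \<in> measurable M lebesgue \<Longrightarrow> f \<in> borel_measurable M"
  for f :: "'a \<Rightarrow> 'b::euclidean_space"
  using measurable_compose[of f M lebesgue "\<lambda>x. x" borel] by (simp add: measurable_completion)

lemma measurable_fst_borel_lebesgue [measurable]:
  "fst \<in> borel_measurable ((lebesgue :: 'a::euclidean_space measure) \<Otimes>\<^sub>M M)"
  "snd \<in> borel_measurable (M \<Otimes>\<^sub>M (lebesgue :: 'a::euclidean_space measure))"
  by (auto intro: borel_measurable_if_lebesgue)

text \<open>Makes Tonelli and Fubini available for products of \<open>lebesgue\<close>, on which all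
  double integrals with the Fourier kernel rest.\<close>

lemma sigma_finite_lebesgue: "sigma_finite_measure (lebesgue :: 'a::euclidean_space measure)"
proof
  have "emeasure lborel (ball (0::'a) (real n)) \<noteq> \<infinity>" for n
    using emeasure_lborel_ball_finite[of "0::'a" "real n"] by (simp add: less_top)
  moreover have "(\<Union>n. ball (0::'a) (real n)) = UNIV"
    using reals_Archimedean2 by (auto simp: dist_norm)
  ultimately show "\<exists>A. countable A \<and> A \<subseteq> sets lebesgue \<and> \<Union> A = space (lebesgue :: 'a measure) \<and> (\<forall>a\<in>A. emeasure lebesgue a \<noteq> \<infinity>)"
    by (intro exI[of _ "range (\<lambda>n. ball (0::'a) (real n))"]) (auto simp: emeasure_completion)
qed

interpretation lebesgue: sigma_finite_measure lebesgue
  by (rule sigma_finite_lebesgue)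

interpretation lebesgue_pair: pair_sigma_finite lebesgue lebesgue ..

lemma wave_measurable_lebesgue [measurable]: "wave t \<in> borel_measurable lebesgue"
  by (rule measurable_completion) simp

lemma integrable_mult_wave [intro]:
  assumes "integrable lebesgue f" shows "integrable lebesgue (\<lambda>x. f x * wave t x)"
    "integrable lebesgue (\<lambda>x. f x * cnj (wave t x))"
proof -
  have [measurable]: "f \<in> borel_measurable lebesgue" using assms by auto
  show "integrable lebesgue (\<lambda>x. f x * wave t x)" "integrable lebesgue (\<lambda>x. f x * cnj (wave t x))"
    by (rule Bochner_Integration.integrable_bound[OF assms]; auto simp: norm_mult)+
qed

lemma fourier_integral_measurable:
  assumes [measurable]: "f \<in> borel_measurable lebesgue"
  shows "fourier_integral f \<in> borel_measurable lebesgue"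
proof -
  have "fourier_integral f = (\<lambda>l. LINT x|lebesgue. f x * cnj (wave l x))"
    by (simp add: fourier_integral_wave fun_eq_iff)
  also have "\<dots> \<in> borel_measurable lebesgue" by measurable
  finally show ?thesis .
qed

lemma fourier_integral_bound:
  "cmod (fourier_integral f l) \<le> (LINT x|lebesgue. cmod (f x))"
  unfolding fourier_integral_wave using integral_norm_bound[of lebesgue "\<lambda>x. f x * cnj (wave l x)"]
  by (simp add: norm_mult)

lemma fourier_integral_add:
  "integrable lebesgue f \<Longrightarrow> integrable lebesgue g \<Longrightarrow>
    fourier_integral (\<lambda>x. f x + g x) l = fourier_integral f l + fourier_integral g l"
  by (simp add: fourier_integral_wave distrib_right integrable_mult_wave)

lemma fourier_integral_diff:
  "integrable lebesgue f \<Longrightarrow> integrable lebesgue g \<Longrightarrow>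
    fourier_integral (\<lambda>x. f x - g x) l = fourier_integral f l - fourier_integral g l"
  by (simp add: fourier_integral_wave left_diff_distrib integrable_mult_wave)

lemma fourier_integral_cmult: "fourier_integral (\<lambda>x. c * f x) l = c * fourier_integral f l"
  by (simp add: fourier_integral_wave mult.assoc)

lemma fourier_integral_cnj: "fourier_integral (\<lambda>x. cnj (f x)) l = cnj (fourier_integral f (- l))"
  by (simp add: fourier_integral_wave wave_minus flip: Bochner_Integration.integral_cnj)

lemma fourier_integral_wave_shift:
  "fourier_integral (\<lambda>x. f x * wave t x) l = fourier_integral f (l - t)"
  by (simp add: fourier_integral_wave wave_diff mult_ac)

lemma integrable_bounded_mult:
  fixes f g :: "'a::euclidean_space \<Rightarrow> complex"
  assumes f: "integrable lebesgue f" and g: "g \<in> borel_measurable lebesgue" "\<And>x. cmod (g x) \<le> C"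
  shows "integrable lebesgue (\<lambda>x. f x * g x)"
proof (rule Bochner_Integration.integrable_bound)
  show "integrable lebesgue (\<lambda>x. of_real C * f x)" using f by simp
  have "cmod (f x * g x) \<le> cmod (f x) * \<bar>C\<bar>" for x
    unfolding norm_mult using g(2)[of x] by (intro mult_left_mono) auto
  then show "AE x in lebesgue. norm (f x * g x) \<le> norm (of_real C * f x)"
    by (simp add: norm_mult mult.commute)
qed (use f g in auto)

text \<open>Fubini applies because the kernel has modulus 1, and the symmetry
  \<open>wave_commute\<close> of the kernel lets the transform change sides.\<close>

lemma fourier_multiplication_formula:
  assumes f: "integrable lebesgue f" and g: "integrable lebesgue g"
  shows "(LINT l|lebesgue. fourier_integral f l * g l) = (LINT x|lebesgue. f x * fourier_integral g x)"
proof -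
  have [measurable]: "f \<in> borel_measurable lebesgue" "g \<in> borel_measurable lebesgue" using f g by auto
  let ?h = "\<lambda>x l. f x * g l * cnj (wave l x)"
  have int: "integrable (lebesgue \<Otimes>\<^sub>M lebesgue) (case_prod ?h)"
  proof (rule lebesgue_pair.Fubini_integrable)
    show "integrable lebesgue (\<lambda>x. LINT y|lebesgue. norm (case (x, y) of (x, l) \<Rightarrow> ?h x l))"
      using f by (simp add: norm_mult)
    show "AE x in lebesgue. integrable lebesgue (\<lambda>y. case (x, y) of (x, l) \<Rightarrow> ?h x l)"
    proof (rule AE_I2)
      fix x
      have "integrable lebesgue (\<lambda>l. f x * (g l * cnj (wave x l)))"
        using g by (intro integrable_mult_right integrable_mult_wave)
      then show "integrable lebesgue (\<lambda>y. case (x, y) of (x, l) \<Rightarrow> ?h x l)"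
        by (simp add: mult.assoc wave_commute[of _ x])
    qed
  qed measurable
  have "(LINT l|lebesgue. fourier_integral f l * g l) = (LINT l|lebesgue. LINT x|lebesgue. ?h x l)"
  proof (rule Bochner_Integration.integral_cong)
    fix l
    have "fourier_integral f l * g l = (LINT x|lebesgue. f x * cnj (wave l x) * g l)"
      by (simp add: fourier_integral_wave)
    then show "fourier_integral f l * g l = (LINT x|lebesgue. ?h x l)" by (simp add: mult_ac)
  qed simp
  also have "\<dots> = (LINT x|lebesgue. LINT l|lebesgue. ?h x l)"
    by (rule lebesgue_pair.Fubini_integral[OF int])
  also have "\<dots> = (LINT x|lebesgue. f x * fourier_integral g x)"
    by (simp add: fourier_integral_wave mult.assoc wave_commute)
  finally show ?thesis .
qed

section \<open>Gaussian regularization of the Fourier integral\<close>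

definition gauss :: "real \<Rightarrow> 'a::real_inner \<Rightarrow> real" where
  "gauss e x = exp (- pi * e\<^sup>2 * (x \<bullet> x))"

lemma gauss_pos [simp]: "0 < gauss e x" "0 \<le> gauss e x" "gauss e x \<noteq> 0"
  by (simp_all add: gauss_def)

lemma gauss_le_1: "gauss e x \<le> 1"
  by (simp add: gauss_def)

lemma borel_measurable_gauss [measurable]: "gauss e \<in> borel_measurable (borel :: 'a::euclidean_space measure)"
  unfolding gauss_def by measurable

text \<open>This is the characteristic function of the standard normal distribution after rescaling.
  With this normalization the case \<open>e = 1\<close> is self-dual.\<close>

lemma gauss_fourier_1:
  fixes e s :: real
  assumes e: "0 < e"
  shows "(LINT t|lborel. of_real (gauss e t) * exp (- 2 * of_real pi * \<i> * of_real (t * s)))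
     = complex_of_real (gauss (1/e) s / e)"
proof -
  \<comment> \<open>The scale is chosen so that half of \<open>(c t)^2\<close> is
    \<open>pi e^2 t^2\<close>; the frequency \<open>r\<close> then has to satisfy
    \<open>r c = - 2 pi s\<close>.\<close>
  define c where "c = e * sqrt (2 * pi)"
  have c: "c > 0" using e by (simp add: c_def)
  define r where "r = - 2 * pi * s / c"
  have "complex_of_real (exp (- (r\<^sup>2) / 2)) = char std_normal_distribution r"
    by (simp add: char_std_normal_distribution)
  also have "\<dots> = (LINT x|lborel. std_normal_density x *\<^sub>R iexp (r * x))"
    unfolding char_def by (rule integral_density) auto
  also have "\<dots> = \<bar>c\<bar> *\<^sub>R (LINT t|lborel. std_normal_density (0 + c * t) *\<^sub>R iexp (r * (0 + c * t)))"
    using c by (intro lborel_integral_real_affine) auto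
  also have "\<dots> = (LINT t|lborel. \<bar>c\<bar> *\<^sub>R (std_normal_density (0 + c * t) *\<^sub>R iexp (r * (0 + c * t))))"
    by (rule integral_scaleR_right[symmetric])
  also have "\<dots> = (LINT t|lborel. of_real e * (of_real (gauss e t) * exp (- 2 * of_real pi * \<i> * of_real (t * s))))"
  proof (rule Bochner_Integration.integral_cong)
    fix t :: real
    have "- (0 + c * t)\<^sup>2 / 2 = - pi * e\<^sup>2 * (t \<bullet> t)"
      by (simp add: c_def power_mult_distrib power2_eq_square)
    then have "std_normal_density (0 + c * t) = 1 / sqrt (2 * pi) * gauss e t"
      unfolding std_normal_density_def gauss_def by (simp only:)
    moreover have "\<bar>c\<bar> * (1 / sqrt (2 * pi)) = e" using c e by (simp add: c_def)
    ultimately have 1: "\<bar>c\<bar> * std_normal_density (0 + c * t) = e * gauss e t"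
      by (metis mult.assoc)
    have 2: "r * (0 + c * t) = - 2 * pi * (t * s)" using c by (simp add: r_def)
    have 3: "iexp (r * (0 + c * t)) = exp (- 2 * of_real pi * \<i> * of_real (t * s))"
      unfolding 2 by (simp add: mult_ac)
    show "\<bar>c\<bar> *\<^sub>R (std_normal_density (0 + c * t) *\<^sub>R iexp (r * (0 + c * t)))
        = of_real e * (of_real (gauss e t) * exp (- 2 * of_real pi * \<i> * of_real (t * s)))"
      unfolding scaleR_scaleR 1 3 by (simp add: scaleR_conv_of_real mult.assoc)
  qed simp
  also have "\<dots> = of_real e * (LINT t|lborel. of_real (gauss e t) * exp (- 2 * of_real pi * \<i> * of_real (t * s)))"
    by simp
  finally have "complex_of_real (exp (- (r\<^sup>2) / 2)) = of_real e * (LINT t|lborel. of_real (gauss e t) * exp (- 2 * of_real pi * \<i> * of_real (t * s)))" .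
  moreover have "- (r\<^sup>2) / 2 = - pi * (1/e)\<^sup>2 * (s \<bullet> s)"
    using e by (simp add: r_def c_def power_mult_distrib power_divide power2_eq_square field_simps)
  ultimately have "complex_of_real (gauss (1/e) s) = of_real e * (LINT t|lborel. of_real (gauss e t) * exp (- 2 * of_real pi * \<i> * of_real (t * s)))"
    by (simp add: gauss_def)
  then show ?thesis using e by (simp add: field_simps)
qed

lemma integral_lborel_prod:
  fixes f :: "'a::euclidean_space \<Rightarrow> real \<Rightarrow> complex"
  assumes f: "\<And>b. b \<in> Basis \<Longrightarrow> integrable lborel (f b)"
  shows "(LINT x|lborel. (\<Prod>b\<in>Basis. f b (x \<bullet> b))) = (\<Prod>b\<in>Basis. LINT x|lborel. f b x)"
proof -
  interpret product_sigma_finite "\<lambda>_::'a. lborel :: real measure" ..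
  have [measurable]: "f b \<in> borel_measurable borel" if "b \<in> Basis" for b using f[OF that] by auto
  have "(LINT x|lborel. (\<Prod>b\<in>Basis. f b (x \<bullet> b)))
      = (LINT x|(\<Pi>\<^sub>M b\<in>Basis. lborel). (\<Prod>b\<in>Basis. f b ((\<Sum>a\<in>Basis. x a *\<^sub>R a) \<bullet> b)))"
    by (subst lborel_eq, rule integral_distr) measurable
  also have "\<dots> = (LINT x|(\<Pi>\<^sub>M b\<in>Basis. lborel). (\<Prod>b\<in>Basis. f b (x b)))"
    by (intro Bochner_Integration.integral_cong refl prod.cong)
       (auto simp: inner_sum_left inner_Basis if_distrib cong: if_cong)
  also have "\<dots> = (\<Prod>b\<in>Basis. LINT x|lborel. f b x)"
    by (rule product_integral_prod) (auto intro: f)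
  finally show ?thesis .
qed

lemma gauss_fourier_lborel:
  fixes l :: "real^'n"
  assumes e: "0 < e"
  shows "(LINT x|lborel. of_real (gauss e x) * cnj (wave l x)) = complex_of_real (gauss (1/e) l / e ^ CARD('n))"
proof -
  let ?g = "\<lambda>b t. complex_of_real (gauss e t) * exp (- 2 * of_real pi * \<i> * of_real (t * (l \<bullet> b)))"
  have gauss_prod: "gauss a x = (\<Prod>b\<in>Basis. gauss a (x \<bullet> b))" for a and x :: "real^'n"
  proof -
    have "- pi * a\<^sup>2 * (x \<bullet> x) = (\<Sum>b\<in>Basis. - pi * a\<^sup>2 * ((x \<bullet> b) \<bullet> (x \<bullet> b)))"
      by (subst euclidean_inner) (simp add: sum_distrib_left)
    then show ?thesis unfolding gauss_def by (simp only: exp_sum finite_Basis)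
  qed
  have wave_prod: "cnj (wave l x) = (\<Prod>b\<in>Basis. exp (- 2 * of_real pi * \<i> * of_real ((x \<bullet> b) * (l \<bullet> b))))" for x
  proof -
    have "- 2 * of_real pi * \<i> * complex_of_real (x \<bullet> l)
        = (\<Sum>b\<in>Basis. - 2 * of_real pi * \<i> * of_real ((x \<bullet> b) * (l \<bullet> b)))"
      by (subst euclidean_inner) (simp only: sum_distrib_left of_real_sum)
    moreover have "cnj (wave l x) = exp (- 2 * of_real pi * \<i> * complex_of_real (x \<bullet> l))"
      by (simp add: wave_def exp_cnj)
    ultimately show ?thesis by (simp only: exp_sum finite_Basis)
  qed
  have "of_real (gauss e x) * cnj (wave l x) = (\<Prod>b\<in>Basis. ?g b (x \<bullet> b))" for x :: "real^'n"
    unfolding wave_prod gauss_prod[of e x] by (simp only: of_real_prod prod.distrib)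
  then have "(LINT x|lborel. of_real (gauss e x) * cnj (wave l x)) = (LINT x|lborel. (\<Prod>b\<in>Basis. ?g b (x \<bullet> b)))"
    by (simp only:)
  also have "\<dots> = (\<Prod>b\<in>Basis. LINT t|lborel. ?g b t)"
  proof (rule integral_lborel_prod)
    \<comment> \<open>The Bochner integral of a nonintegrable function is 0, so the positive value
      computed for the integral already implies integrability.\<close>
    show "integrable lborel (?g b)" for b
      using gauss_fourier_1[OF e, of "l \<bullet> b"] e not_integrable_integral_eq[of lborel "?g b"] by fastforce
  qed
  also have "\<dots> = (\<Prod>b\<in>Basis. complex_of_real (gauss (1/e) (l \<bullet> b) / e))"
    using gauss_fourier_1[OF e] by simp
  also have "\<dots> = complex_of_real ((\<Prod>b\<in>Basis. gauss (1/e) (l \<bullet> b)) / e ^ CARD('n))"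
    by (simp add: prod_dividef)
  also have "(\<Prod>b\<in>Basis. gauss (1/e) (l \<bullet> b)) = gauss (1/e) l"
    by (rule gauss_prod[symmetric])
  finally show ?thesis .
qed

lemma
  fixes l :: "real^'n"
  assumes e: "0 < e"
  shows integrable_gauss: "integrable lebesgue (gauss e :: real^'n \<Rightarrow> real)"
    and gauss_fourier: "fourier_integral (\<lambda>x. of_real (gauss e x)) l = complex_of_real (gauss (1/e) l / e ^ CARD('n))"
proof -
  \<comment> \<open>Again a nonzero integral serves as the proof of integrability; it is evaluated
    as the transform at frequency 0.\<close>
  have "(LINT x|lborel. complex_of_real (gauss e (x::real^'n))) \<noteq> 0"
  proof -
    have "complex_of_real (LINT x|lborel. gauss e (x::real^'n)) = complex_of_real (gauss (1/e) (0::real^'n) / e ^ CARD('n))"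
      using gauss_fourier_lborel[OF e, of "0::real^'n"] by simp
    then have "(LINT x|lborel. gauss e (x::real^'n)) = gauss (1/e) (0::real^'n) / e ^ CARD('n)"
      unfolding of_real_eq_iff .
    then show ?thesis using e by simp
  qed
  then have "integrable lborel (\<lambda>x::real^'n. complex_of_real (gauss e x))"
    using not_integrable_integral_eq by blast
  then have "integrable lborel (\<lambda>x::real^'n. Re (complex_of_real (gauss e x)))" by (rule integrable_Re)
  then show "integrable lebesgue (gauss e :: real^'n \<Rightarrow> real)"
    by (simp add: integrable_completion)
  show "fourier_integral (\<lambda>x. of_real (gauss e x)) l = complex_of_real (gauss (1/e) l / e ^ CARD('n))"
    unfolding fourier_integral_wave gauss_fourier_lborel[OF e, symmetric]
    by (rule integral_completion) measurable
qed

text \<open>The Fourier transform of \<open>gauss e\<close>, which is the heat kernel at time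
  \<open>e^2 / (4 pi)\<close>: a probability density concentrating at the origin as \<open>e\<close>
  tends to 0.\<close>

definition heat :: "real \<Rightarrow> real^'n \<Rightarrow> real" where
  "heat e x = gauss (1/e) x / e ^ CARD('n)"

lemma heat_nonneg: "0 < e \<Longrightarrow> 0 \<le> heat e x"
  by (simp add: heat_def)

lemma heat_minus: "heat e (x - y) = heat e (y - x)"
  by (simp add: heat_def gauss_def inner_commute algebra_simps)

lemma borel_measurable_heat [measurable]: "heat e \<in> borel_measurable borel"
  unfolding heat_def by measurable

lemma heat_measurable_lebesgue [measurable]: "heat e \<in> borel_measurable lebesgue"
  by (rule measurable_completion) simp

lemma nn_integral_heat:
  assumes e: "0 < e" shows "(\<integral>\<^sup>+x. ennreal (heat e (x::real^'n)) \<partial>lebesgue) = 1"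
proof -
  have 1: "integrable lebesgue (heat e :: real^'n \<Rightarrow> real)"
    unfolding heat_def using integrable_gauss[of "1/e"] e by (intro integrable_divide) simp
  have "complex_of_real (LINT x|lebesgue. heat e (x::real^'n)) = fourier_integral (\<lambda>x. of_real (gauss (1/e) x)) (0::real^'n) / of_real (e ^ CARD('n))"
    unfolding fourier_integral_wave heat_def by simp
  also have "\<dots> = 1"
    using e by (subst gauss_fourier) (auto simp: gauss_def power_one_over)
  finally have "(LINT x|lebesgue. heat e (x::real^'n)) = 1" using of_real_eq_1_iff by blast
  then show ?thesis using 1 e by (subst nn_integral_eq_integral) (auto simp: heat_nonneg)
qed

lemma heat_shift_measurable [measurable]:
  "(\<lambda>y. heat e (y - x)) \<in> borel_measurable lebesgue" "(\<lambda>y. heat e (x - y)) \<in> borel_measurable lebesgue"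
  by (rule measurable_completion; measurable)+

text \<open>Integrability is not assumed, since the integral of a nonintegrable function is 0 by
  convention. This spares integrability checks in the estimates below.\<close>

lemma norm_integral_le_nn_integral:
  fixes f :: "'a \<Rightarrow> complex"
  shows "ennreal (cmod (integral\<^sup>L M f)) \<le> (\<integral>\<^sup>+x. ennreal (cmod (f x)) \<partial>M)"
  using integral_norm_bound_ennreal[of M f] by (cases "integrable M f") (auto simp: not_integrable_integral_eq)

lemma integrable_complex_indicator:
  assumes "E \<in> fmeasurable M" shows "complex_integrable M (indicator E)"
proof -
  have "integrable M (indicator E :: 'a \<Rightarrow> real)" using assms by (auto simp: fmeasurable_def)
  then have "complex_integrable M (\<lambda>x. of_real (indicator E x))" by (rule integrable_of_real)
  moreover have "(\<lambda>x. complex_of_real (indicator E x)) = indicator E" by (auto simp: indicator_def)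
  ultimately show ?thesis by simp
qed

text \<open>The transform of an integrable function is merely bounded, so its square need not be
  known to be integrable; the Gaussian weight repairs this. Two uses of the multiplication formula
  turn the weighted energy into the pairing of \<open>f\<close> with its own heat smoothing.\<close>

lemma fourier_integral_gauss_pairing:
  fixes f :: "real^'n \<Rightarrow> complex"
  assumes f: "integrable lebesgue f" and e: "0 < e"
  shows "complex_integrable lebesgue (\<lambda>l. of_real ((cmod (fourier_integral f l))\<^sup>2 * gauss e l))"
    and "(LINT l|lebesgue. complex_of_real ((cmod (fourier_integral f l))\<^sup>2 * gauss e l))
      = (LINT x|lebesgue. f x * cnj (LINT y|lebesgue. f y * of_real (heat e (y - x))))"
proof -
  let ?u = "fourier_integral f"
  let ?C = "LINT x|lebesgue. cmod (f x)"
  have [measurable]: "f \<in> borel_measurable lebesgue" "?u \<in> borel_measurable lebesgue"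
    using f by (auto intro: fourier_integral_measurable)
  have g: "complex_integrable lebesgue (\<lambda>l::real^'n. of_real (gauss e l))"
    using integrable_gauss[OF e] by (rule integrable_of_real)
  \<comment> \<open>Absorbing one factor of the squared modulus together with the weight gives an
    integrable partner for the multiplication formula.\<close>
  define w where "w l = of_real (gauss e l) * cnj (?u l)" for l
  have w: "integrable lebesgue w"
    unfolding w_def by (rule integrable_bounded_mult[OF g, where C = ?C]) (auto simp: fourier_integral_bound)
  have eq: "?u l * w l = of_real ((cmod (?u l))\<^sup>2 * gauss e l)" for l
    by (simp add: w_def complex_norm_square del: of_real_power)
  have "integrable lebesgue (\<lambda>l. w l * ?u l)"
    by (rule integrable_bounded_mult[OF w, where C = ?C]) (auto simp: fourier_integral_bound)
  then show "complex_integrable lebesgue (\<lambda>l. of_real ((cmod (?u l))\<^sup>2 * gauss e l))"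
    unfolding eq[symmetric] by (simp only: mult.commute)
  have "fourier_integral w x = cnj (LINT y|lebesgue. f y * of_real (heat e (y - x)))" for x
  proof -
    let ?k = "\<lambda>l. of_real (gauss e l) * wave x l"
    have "fourier_integral w x = (LINT l|lebesgue. cnj (?u l * ?k l))"
      by (simp add: fourier_integral_wave w_def mult_ac)
    also have "\<dots> = cnj (LINT l|lebesgue. ?u l * ?k l)"
      by (rule Bochner_Integration.integral_cnj)
    \<comment> \<open>Second use of the formula: modulating the Gaussian by \<open>wave x\<close>
      shifts its transform, the heat kernel, by \<open>x\<close>.\<close>
    also have "(LINT l|lebesgue. ?u l * ?k l) = (LINT y|lebesgue. f y * fourier_integral ?k y)"
      by (rule fourier_multiplication_formula[OF f]) (rule integrable_mult_wave[OF g])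
    also have "\<dots> = (LINT y|lebesgue. f y * of_real (heat e (y - x)))"
      using e by (simp add: fourier_integral_wave_shift gauss_fourier heat_def)
    finally show ?thesis .
  qed
  then show "(LINT l|lebesgue. complex_of_real ((cmod (?u l))\<^sup>2 * gauss e l))
      = (LINT x|lebesgue. f x * cnj (LINT y|lebesgue. f y * of_real (heat e (y - x))))"
    using fourier_multiplication_formula[OF f w] unfolding eq by simp
qed

lemma nn_integral_heat_shift:
  assumes "0 < e" shows "(\<integral>\<^sup>+y. ennreal (heat e (y - x)) \<partial>lebesgue) = 1"
  using nn_integral_translation[of "\<lambda>y. ennreal (heat e y)" "- x"] nn_integral_heat[OF assms] by simp

lemma nn_integral_gauss_eq_integral:
  assumes f: "integrable lebesgue f" and e: "0 < e"
  shows "(\<integral>\<^sup>+l. ennreal ((cmod (fourier_integral f l))\<^sup>2 * gauss e l) \<partial>lebesgue)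
    = ennreal (LINT l|lebesgue. (cmod (fourier_integral f l))\<^sup>2 * gauss e l)"
proof (rule nn_integral_eq_integral)
  have "integrable lebesgue (\<lambda>l. Re (of_real ((cmod (fourier_integral f l))\<^sup>2 * gauss e l)))"
    by (rule integrable_Re[OF fourier_integral_gauss_pairing(1)[OF f e]])
  then show "integrable lebesgue (\<lambda>l. (cmod (fourier_integral f l))\<^sup>2 * gauss e l)" by (simp only: Re_complex_of_real)
qed auto

text \<open>Schur's test: the product of the two values of \<open>f\<close> is at most half the sum
  of their squares, and the heat kernel has mass 1 in each variable separately.\<close>

lemma fourier_integral_gauss_bound:
  fixes f :: "real^'n \<Rightarrow> complex"
  assumes f: "integrable lebesgue f" and e: "0 < e"
  shows "(\<integral>\<^sup>+l. ennreal ((cmod (fourier_integral f l))\<^sup>2 * gauss e l) \<partial>lebesgue)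
    \<le> (\<integral>\<^sup>+x. ennreal ((cmod (f x))\<^sup>2) \<partial>lebesgue)"
proof -
  have [measurable]: "f \<in> borel_measurable lebesgue" using f by auto
  have split: "ennreal (a\<^sup>2 / 2 + b\<^sup>2 / 2) = ennreal (a\<^sup>2 / 2) + ennreal (b\<^sup>2 / 2)" for a b :: real
    by (rule ennreal_plus) auto
  let ?Q = "LINT l|lebesgue. (cmod (fourier_integral f l))\<^sup>2 * gauss e l"
  let ?h = "\<lambda>x. ennreal ((cmod (f x))\<^sup>2 / 2)"
  have "0 \<le> ?Q" by (rule Bochner_Integration.integral_nonneg) auto
  then have "?Q = cmod (LINT l|lebesgue. complex_of_real ((cmod (fourier_integral f l))\<^sup>2 * gauss e l))"
    by (simp del: of_real_mult of_real_power)
  then have "ennreal ?Q = ennreal (cmod (LINT x|lebesgue. f x * cnj (LINT y|lebesgue. f y * of_real (heat e (y - x)))))"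
    by (simp only: fourier_integral_gauss_pairing(2)[OF f e])
  also have "\<dots> \<le> (\<integral>\<^sup>+x. ennreal (cmod (f x * cnj (LINT y|lebesgue. f y * of_real (heat e (y - x))))) \<partial>lebesgue)"
    by (rule norm_integral_le_nn_integral)
  also have "\<dots> \<le> (\<integral>\<^sup>+x. (\<integral>\<^sup>+y. ?h x * ennreal (heat e (y - x)) + ?h y * ennreal (heat e (y - x)) \<partial>lebesgue) \<partial>lebesgue)"
  proof (rule nn_integral_mono)
    fix x
    have "ennreal (cmod (f x * cnj (LINT y|lebesgue. f y * of_real (heat e (y - x)))))
        = ennreal (cmod (LINT y|lebesgue. f x * (f y * of_real (heat e (y - x)))))"
      by (simp add: norm_mult)
    also have "\<dots> \<le> (\<integral>\<^sup>+y. ennreal (cmod (f x * (f y * of_real (heat e (y - x))))) \<partial>lebesgue)"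
      by (rule norm_integral_le_nn_integral)
    also have "\<dots> \<le> (\<integral>\<^sup>+y. ?h x * ennreal (heat e (y - x)) + ?h y * ennreal (heat e (y - x)) \<partial>lebesgue)"
    proof (rule nn_integral_mono)
      fix y
      have h: "0 \<le> heat e (y - x)" using e by (rule heat_nonneg)
      have "cmod (f x) * cmod (f y) \<le> (cmod (f x))\<^sup>2 / 2 + (cmod (f y))\<^sup>2 / 2"
        using sum_squares_bound[of "cmod (f x)" "cmod (f y)"] by simp
      from mult_right_mono[OF this h]
      have "cmod (f x * (f y * of_real (heat e (y - x)))) \<le> ((cmod (f x))\<^sup>2 / 2 + (cmod (f y))\<^sup>2 / 2) * heat e (y - x)"
        using h by (simp add: norm_mult mult.assoc)
      then have "ennreal (cmod (f x * (f y * of_real (heat e (y - x)))))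
          \<le> ennreal (((cmod (f x))\<^sup>2 / 2 + (cmod (f y))\<^sup>2 / 2) * heat e (y - x))" by (rule ennreal_leI)
      also have "\<dots> = ?h x * ennreal (heat e (y - x)) + ?h y * ennreal (heat e (y - x))"
          unfolding ennreal_mult''[OF h] split by (rule distrib_right)
      finally show "ennreal (cmod (f x * (f y * of_real (heat e (y - x)))))
          \<le> ?h x * ennreal (heat e (y - x)) + ?h y * ennreal (heat e (y - x))" .
    qed
    finally show "ennreal (cmod (f x * cnj (LINT y|lebesgue. f y * of_real (heat e (y - x)))))
        \<le> (\<integral>\<^sup>+y. ?h x * ennreal (heat e (y - x)) + ?h y * ennreal (heat e (y - x)) \<partial>lebesgue)" .
  qed
  also have "\<dots> = (\<integral>\<^sup>+x. (\<integral>\<^sup>+y. ?h x * ennreal (heat e (y - x)) \<partial>lebesgue) + (\<integral>\<^sup>+y. ?h y * ennreal (heat e (y - x)) \<partial>lebesgue) \<partial>lebesgue)"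
    by (intro nn_integral_cong nn_integral_add) measurable
  also have "\<dots> = (\<integral>\<^sup>+x. (\<integral>\<^sup>+y. ?h x * ennreal (heat e (y - x)) \<partial>lebesgue) \<partial>lebesgue)
      + (\<integral>\<^sup>+x. (\<integral>\<^sup>+y. ?h y * ennreal (heat e (y - x)) \<partial>lebesgue) \<partial>lebesgue)"
    by (rule nn_integral_add) measurable
  also have "(\<integral>\<^sup>+x. (\<integral>\<^sup>+y. ?h x * ennreal (heat e (y - x)) \<partial>lebesgue) \<partial>lebesgue) = (\<integral>\<^sup>+x. ?h x \<partial>lebesgue)"
  proof (rule nn_integral_cong)
    fix x
    have "(\<integral>\<^sup>+y. ?h x * ennreal (heat e (y - x)) \<partial>lebesgue) = ?h x * (\<integral>\<^sup>+y. ennreal (heat e (y - x)) \<partial>lebesgue)"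
      by (rule nn_integral_cmult) measurable
    then show "(\<integral>\<^sup>+y. ?h x * ennreal (heat e (y - x)) \<partial>lebesgue) = ?h x" using e by (simp add: nn_integral_heat_shift)
  qed
  also have "(\<integral>\<^sup>+x. (\<integral>\<^sup>+y. ?h y * ennreal (heat e (y - x)) \<partial>lebesgue) \<partial>lebesgue)
      = (\<integral>\<^sup>+y. (\<integral>\<^sup>+x. ?h y * ennreal (heat e (y - x)) \<partial>lebesgue) \<partial>lebesgue)"
    by (rule lebesgue_pair.Fubini') measurable
  also have "\<dots> = (\<integral>\<^sup>+y. ?h y \<partial>lebesgue)"
  proof (rule nn_integral_cong)
    fix y
    have "(\<integral>\<^sup>+x. ?h y * ennreal (heat e (y - x)) \<partial>lebesgue) = ?h y * (\<integral>\<^sup>+x. ennreal (heat e (y - x)) \<partial>lebesgue)"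
      by (rule nn_integral_cmult) measurable
    then show "(\<integral>\<^sup>+x. ?h y * ennreal (heat e (y - x)) \<partial>lebesgue) = ?h y"
      unfolding heat_minus[of e y] using e by (simp add: nn_integral_heat_shift)
  qed
  also have "(\<integral>\<^sup>+x. ?h x \<partial>lebesgue) + (\<integral>\<^sup>+x. ?h x \<partial>lebesgue) = (\<integral>\<^sup>+x. ?h x + ?h x \<partial>lebesgue)"
    by (rule nn_integral_add[symmetric]) measurable
  also have "\<dots> = (\<integral>\<^sup>+x. ennreal ((cmod (f x))\<^sup>2) \<partial>lebesgue)"
    by (intro nn_integral_cong) (simp flip: ennreal_plus)
  finally show ?thesis unfolding nn_integral_gauss_eq_integral[OF f e] .
qed

lemma gauss_tendsto_1: "(\<lambda>k. gauss (1 / Suc k) x) \<longlonglongrightarrow> 1"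
proof -
  have "(\<lambda>k. 1 / real (Suc k)) \<longlonglongrightarrow> 0"
    using LIMSEQ_inverse_real_of_nat by (simp add: inverse_eq_divide)
  then have "(\<lambda>k. exp (- pi * (1 / real (Suc k))\<^sup>2 * (x \<bullet> x))) \<longlonglongrightarrow> exp (- pi * 0\<^sup>2 * (x \<bullet> x))"
    by (intro tendsto_intros)
  then show ?thesis by (simp add: gauss_def)
qed

text \<open>The bound with Gaussian weight is uniform in the width, so Fatou's lemma removes the
  weight as it tends to 1 pointwise.\<close>

lemma fourier_integral_contraction:
  fixes f :: "real^'n \<Rightarrow> complex"
  assumes f: "integrable lebesgue f"
  shows "(\<integral>\<^sup>+l. ennreal ((cmod (fourier_integral f l))\<^sup>2) \<partial>lebesgue) \<le> (\<integral>\<^sup>+x. ennreal ((cmod (f x))\<^sup>2) \<partial>lebesgue)"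
proof -
  let ?u = "fourier_integral f"
  have [measurable]: "?u \<in> borel_measurable lebesgue" using f by (auto intro: fourier_integral_measurable)
  have [measurable]: "gauss e \<in> borel_measurable (lebesgue :: (real^'n) measure)" for e
    by (rule measurable_completion) simp
  have "(\<integral>\<^sup>+l. ennreal ((cmod (?u l))\<^sup>2) \<partial>lebesgue)
      = (\<integral>\<^sup>+l. liminf (\<lambda>k. ennreal ((cmod (?u l))\<^sup>2 * gauss (1 / Suc k) l)) \<partial>lebesgue)"
  proof (rule nn_integral_cong)
    fix l
    have "(\<lambda>k. ennreal ((cmod (?u l))\<^sup>2 * gauss (1 / Suc k) l)) \<longlonglongrightarrow> ennreal ((cmod (?u l))\<^sup>2 * 1)"
      by (intro tendsto_ennrealI tendsto_mult tendsto_const gauss_tendsto_1)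
    from lim_imp_Liminf[OF trivial_limit_sequentially this]
    show "ennreal ((cmod (?u l))\<^sup>2) = liminf (\<lambda>k. ennreal ((cmod (?u l))\<^sup>2 * gauss (1 / Suc k) l))" by simp
  qed
  also have "\<dots> \<le> liminf (\<lambda>k. \<integral>\<^sup>+l. ennreal ((cmod (?u l))\<^sup>2 * gauss (1 / Suc k) l) \<partial>lebesgue)"
    by (rule nn_integral_liminf) measurable
  also have "\<dots> \<le> (\<integral>\<^sup>+x. ennreal ((cmod (f x))\<^sup>2) \<partial>lebesgue)"
    by (intro Liminf_le always_eventually allI fourier_integral_gauss_bound f) auto
  finally show ?thesis .
qed

lemma
  assumes f: "integrable lebesgue f" "f \<in> L2"
  shows fourier_integral_L2: "fourier_integral f \<in> L2"
    and l2_norm_fourier_integral_le: "l2_norm (fourier_integral f) \<le> l2_norm f"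
proof -
  have le: "(\<integral>\<^sup>+l. ennreal ((cmod (fourier_integral f l))\<^sup>2) \<partial>lebesgue) \<le> ennreal ((l2_norm f)\<^sup>2)"
    using fourier_integral_contraction[OF f(1)] f(2) by (simp only: nn_integral_l2_norm)
  then show L: "fourier_integral f \<in> L2"
    unfolding L2_iff_nn_integral using f by (auto intro: fourier_integral_measurable L2_measurable le_less_trans)
  have "(l2_norm (fourier_integral f))\<^sup>2 \<le> (l2_norm f)\<^sup>2"
    using le unfolding nn_integral_l2_norm[OF L] by (subst (asm) ennreal_le_iff) auto
  then show "l2_norm (fourier_integral f) \<le> l2_norm f" by (rule power2_le_imp_le) simp
qed

lemma nn_integral_scale:
  fixes f :: "real^'n \<Rightarrow> ennreal"
  assumes f: "f \<in> borel_measurable lebesgue" and e: "0 < e"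
  shows "(\<integral>\<^sup>+x. f x \<partial>lebesgue) = ennreal (e ^ CARD('n)) * (\<integral>\<^sup>+x. f (e *\<^sub>R x) \<partial>lebesgue)"
proof -
  have T: "(\<lambda>x::real^'n. 0 + (\<Sum>j\<in>Basis. (e * (x \<bullet> j)) *\<^sub>R j)) = (\<lambda>x. e *\<^sub>R x)"
    by (simp add: fun_eq_iff euclidean_representation flip: scaleR_scaleR scaleR_sum_right)
  have m: "(\<lambda>x::real^'n. e *\<^sub>R x) \<in> lebesgue \<rightarrow>\<^sub>M lebesgue"
    using lebesgue_affine_measurable[of "\<lambda>_. e" "0::real^'n"] e unfolding T by simp
  have "lebesgue = density (distr lebesgue lebesgue (\<lambda>x::real^'n. e *\<^sub>R x)) (\<lambda>_. ennreal (e ^ CARD('n)))"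
    using lebesgue_affine_euclidean[of "\<lambda>_. e" "0::real^'n"] e unfolding T by simp
  then have "(\<integral>\<^sup>+x. f x \<partial>lebesgue) = (\<integral>\<^sup>+x. f x \<partial>density (distr lebesgue lebesgue (\<lambda>x::real^'n. e *\<^sub>R x)) (\<lambda>_. ennreal (e ^ CARD('n))))"
    by (rule arg_cong)
  also have "\<dots> = (\<integral>\<^sup>+x. ennreal (e ^ CARD('n)) * f x \<partial>distr lebesgue lebesgue (\<lambda>x::real^'n. e *\<^sub>R x))"
    using f by (intro nn_integral_density) auto
  also have "\<dots> = (\<integral>\<^sup>+x. ennreal (e ^ CARD('n)) * f (e *\<^sub>R x) \<partial>lebesgue)"
    using f by (intro nn_integral_distr m) auto
  also have "\<dots> = ennreal (e ^ CARD('n)) * (\<integral>\<^sup>+x. f (e *\<^sub>R x) \<partial>lebesgue)"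
    using f m by (intro nn_integral_cmult) auto
  finally show ?thesis .
qed

text \<open>The left side is the heat pairing of the indicator after the substitution
  \<open>y = x + e z\<close>. Now \<open>e\<close> occurs only inside the set and the weight
  \<open>heat 1\<close> is fixed, the form in which Fatou's lemma can be applied.\<close>

lemma fourier_integral_indicator_gauss:
  fixes U :: "(real^'n) set"
  assumes U: "open U" "emeasure lebesgue U < \<infinity>" and e: "0 < e"
  shows "(\<integral>\<^sup>+x. \<integral>\<^sup>+z. indicator U x * (indicator U (x + e *\<^sub>R z) * ennreal (heat 1 z)) \<partial>lebesgue \<partial>lebesgue)
    \<le> (\<integral>\<^sup>+l. ennreal ((cmod (fourier_integral (indicator U) l))\<^sup>2) \<partial>lebesgue)"
proof -
  have [measurable]: "U \<in> sets borel" using U by simp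
  then have [measurable]: "U \<in> sets lebesgue" by simp
  let ?u = "fourier_integral (indicator U)"
  have int: "integrable lebesgue (indicator U :: real^'n \<Rightarrow> complex)" "integrable lebesgue (indicator U :: real^'n \<Rightarrow> real)"
    using U by (auto intro!: integrable_complex_indicator simp: fmeasurable_def)
  have heat_meas [measurable]: "(\<lambda>y. heat e (y - x)) \<in> borel_measurable lebesgue" for x :: "real^'n"
    by (rule measurable_completion) measurable
  have heat_int: "integrable lebesgue (\<lambda>y. heat e (y - x))" for x :: "real^'n"
    by (rule integrableI_nonneg) (use e in \<open>auto simp: nn_integral_heat_shift heat_nonneg intro: measurable_completion\<close>)
  have ind_int: "integrable lebesgue (\<lambda>y. indicator U y * heat e (y - x))" for x :: "real^'n"
  proof (rule Bochner_Integration.integrable_bound[OF heat_int[of x]])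
    show "(\<lambda>y. indicator U y * heat e (y - x)) \<in> borel_measurable lebesgue" by measurable
  qed (auto simp: indicator_def)
  let ?I = "\<lambda>x. LINT y|lebesgue. indicator U y * heat e (y - x)"
  have I_nn: "ennreal (?I x) = (\<integral>\<^sup>+y. indicator U y * ennreal (heat e (y - x)) \<partial>lebesgue)" for x
    using nn_integral_eq_integral[OF ind_int[of x]] e
    by (simp add: heat_nonneg ennreal_mult' ennreal_indicator)
  have I_nonneg: "0 \<le> ?I x" for x
    using e by (intro Bochner_Integration.integral_nonneg) (simp add: heat_nonneg)
  have "ennreal (?I x) \<le> 1" for x
  proof -
    have "ennreal (?I x) \<le> (\<integral>\<^sup>+y. ennreal (heat e (y - x)) \<partial>lebesgue)"
      unfolding I_nn by (intro nn_integral_mono) (auto simp: indicator_def)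
    then show ?thesis using e by (simp add: nn_integral_heat_shift)
  qed
  then have I_le: "?I x \<le> 1" for x by (simp add: ennreal_le_1)
  have I_meas [measurable]: "?I \<in> borel_measurable lebesgue" by measurable
  have hint: "integrable lebesgue (\<lambda>x. indicator U x * ?I x)"
  proof (rule Bochner_Integration.integrable_bound[OF int(2)])
    show "(\<lambda>x. indicator U x * ?I x) \<in> borel_measurable lebesgue" by measurable
    show "AE x in lebesgue. norm (indicator U x * ?I x) \<le> norm (indicator U x :: real)"
      using I_nonneg I_le by (intro AE_I2) (simp split: split_indicator)
  qed
  have "(LINT l|lebesgue. complex_of_real ((cmod (?u l))\<^sup>2 * gauss e l))
      = (LINT x|lebesgue. indicator U x * cnj (LINT y|lebesgue. indicator U y * of_real (heat e (y - x))))"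
    by (rule fourier_integral_gauss_pairing(2)[OF int(1) e])
  also have "\<dots> = (LINT x|lebesgue. complex_of_real (indicator U x * ?I x))"
  proof (rule Bochner_Integration.integral_cong[OF refl])
    fix x
    have "(LINT y|lebesgue. indicator U y * complex_of_real (heat e (y - x))) = (LINT y|lebesgue. complex_of_real (indicator U y * heat e (y - x)))"
      by (rule Bochner_Integration.integral_cong[OF refl]) (simp add: indicator_def)
    also have "\<dots> = of_real (?I x)" by (rule integral_complex_of_real)
    finally show "indicator U x * cnj (LINT y|lebesgue. indicator U y * of_real (heat e (y - x))) = complex_of_real (indicator U x * ?I x)"
      by (simp add: indicator_def)
  qed
  finally have eq: "(LINT l|lebesgue. (cmod (?u l))\<^sup>2 * gauss e l) = (LINT x|lebesgue. indicator U x * ?I x)"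
    unfolding integral_complex_of_real of_real_eq_iff .
  have "(\<integral>\<^sup>+x. \<integral>\<^sup>+z. indicator U x * (indicator U (x + e *\<^sub>R z) * ennreal (heat 1 z)) \<partial>lebesgue \<partial>lebesgue)
      = (\<integral>\<^sup>+x. ennreal (indicator U x * ?I x) \<partial>lebesgue)"
  proof (rule nn_integral_cong)
    fix x :: "real^'n"
    have [measurable]: "(\<lambda>z. indicator U (x + e *\<^sub>R z) :: ennreal) \<in> borel_measurable lebesgue"
      "(\<lambda>z. indicator U (z + x) :: ennreal) \<in> borel_measurable lebesgue"
      by (rule measurable_completion; measurable)+
    have "(\<integral>\<^sup>+z. indicator U x * (indicator U (x + e *\<^sub>R z) * ennreal (heat 1 z)) \<partial>lebesgue)
        = indicator U x * (\<integral>\<^sup>+z. indicator U (x + e *\<^sub>R z) * ennreal (heat 1 z) \<partial>lebesgue)"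
      by (rule nn_integral_cmult) measurable
    also have "(\<integral>\<^sup>+z. indicator U (x + e *\<^sub>R z) * ennreal (heat 1 z) \<partial>lebesgue)
        = (\<integral>\<^sup>+z. ennreal (e ^ CARD('n)) * (indicator U (e *\<^sub>R z + x) * ennreal (heat e (e *\<^sub>R z))) \<partial>lebesgue)"
    proof (rule nn_integral_cong)
      fix z :: "real^'n"
      \<comment> \<open>Heat kernels of different widths are dilates of each other, and the power of
        \<open>e\<close> is the Jacobian of the scaling.\<close>
      have "heat 1 z = e ^ CARD('n) * heat e (e *\<^sub>R z)"
        using e by (simp add: heat_def gauss_def power2_eq_square)
      then have "ennreal (heat 1 z) = ennreal (e ^ CARD('n)) * ennreal (heat e (e *\<^sub>R z))"
        using e by (simp add: ennreal_mult' heat_nonneg)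
      then show "indicator U (x + e *\<^sub>R z) * ennreal (heat 1 z) = ennreal (e ^ CARD('n)) * (indicator U (e *\<^sub>R z + x) * ennreal (heat e (e *\<^sub>R z)))"
        by (simp add: mult_ac add.commute)
    qed
    also have "\<dots> = ennreal (e ^ CARD('n)) * (\<integral>\<^sup>+z. indicator U (e *\<^sub>R z + x) * ennreal (heat e (e *\<^sub>R z)) \<partial>lebesgue)"
    proof (rule nn_integral_cmult)
      show "(\<lambda>z. indicator U (e *\<^sub>R z + x) * ennreal (heat e (e *\<^sub>R z))) \<in> borel_measurable lebesgue"
        by (rule measurable_completion) measurable
    qed
    also have "\<dots> = (\<integral>\<^sup>+z. indicator U (z + x) * ennreal (heat e z) \<partial>lebesgue)"
      using e by (intro nn_integral_scale[symmetric]) measurable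
    also have "\<dots> = (\<integral>\<^sup>+y. indicator U y * ennreal (heat e (y - x)) \<partial>lebesgue)"
      using nn_integral_translation[of "\<lambda>y. indicator U y * ennreal (heat e (y - x))" x] by simp
    finally show "(\<integral>\<^sup>+z. indicator U x * (indicator U (x + e *\<^sub>R z) * ennreal (heat 1 z)) \<partial>lebesgue) = ennreal (indicator U x * ?I x)"
      unfolding I_nn[symmetric] by (simp add: ennreal_mult' I_nonneg ennreal_indicator)
  qed
  also have "\<dots> = ennreal (LINT x|lebesgue. indicator U x * ?I x)"
    by (rule nn_integral_eq_integral[OF hint]) (simp add: I_nonneg)
  also have "\<dots> = (\<integral>\<^sup>+l. ennreal ((cmod (?u l))\<^sup>2 * gauss e l) \<partial>lebesgue)"
    unfolding eq[symmetric] by (rule nn_integral_gauss_eq_integral[OF int(1) e, symmetric])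
  \<comment> \<open>For a lower bound on the full energy the weight can simply be dropped, as it is
    at most 1.\<close>
  also have "\<dots> \<le> (\<integral>\<^sup>+l. ennreal ((cmod (?u l))\<^sup>2) \<partial>lebesgue)"
    by (intro nn_integral_mono ennreal_leI) (simp add: mult_left_le gauss_le_1)
  finally show ?thesis .
qed

text \<open>For \<open>x\<close> in an open \<open>U\<close> and any fixed \<open>z\<close>, the
  point \<open>x + e z\<close> lies in \<open>U\<close> once \<open>e\<close> is small. Hence the
  inner integrand is eventually the full weight, and Fatou's lemma, in \<open>z\<close> and then in
  \<open>x\<close>, yields the measure of \<open>U\<close>.\<close>

lemma fourier_integral_indicator_open:
  fixes U :: "(real^'n) set"
  assumes U: "open U" "emeasure lebesgue U < \<infinity>"
  shows "emeasure lebesgue U \<le> (\<integral>\<^sup>+l. ennreal ((cmod (fourier_integral (indicator U) l))\<^sup>2) \<partial>lebesgue)"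
proof -
  have [measurable]: "U \<in> sets borel" using U by simp
  then have UL [measurable]: "U \<in> sets lebesgue" by simp
  let ?g = "\<lambda>k x z. indicator U x * (indicator U (x + (1 / real (Suc k)) *\<^sub>R z) * ennreal (heat 1 z))"
  have meas: "?g k x \<in> borel_measurable lebesgue" for k x
  proof -
    have "(\<lambda>z. indicator U (x + (1 / real (Suc k)) *\<^sub>R z) :: ennreal) \<in> borel_measurable lebesgue"
      by (rule measurable_completion) measurable
    then show ?thesis by measurable
  qed
  have conv: "(\<lambda>k. x + (1 / real (Suc k)) *\<^sub>R z) \<longlonglongrightarrow> x" for x z :: "real^'n"
  proof -
    have "(\<lambda>k. x + (1 / real (Suc k)) *\<^sub>R z) \<longlonglongrightarrow> x + 0 *\<^sub>R z"
      using LIMSEQ_inverse_real_of_nat unfolding inverse_eq_divide by (intro tendsto_intros)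
    then show ?thesis by simp
  qed
  have "emeasure lebesgue U = (\<integral>\<^sup>+x. indicator U x \<partial>lebesgue)" by simp
  also have "\<dots> \<le> (\<integral>\<^sup>+x. liminf (\<lambda>k. \<integral>\<^sup>+z. ?g k x z \<partial>lebesgue) \<partial>lebesgue)"
  proof (rule nn_integral_mono)
    fix x
    have "(indicator U x :: ennreal) = (\<integral>\<^sup>+z. indicator U x * ennreal (heat 1 (z::real^'n)) \<partial>lebesgue)"
      by (subst nn_integral_cmult) (auto simp: nn_integral_heat)
    also have "\<dots> \<le> (\<integral>\<^sup>+z. liminf (\<lambda>k. ?g k x z) \<partial>lebesgue)"
    proof (rule nn_integral_mono)
      fix z :: "real^'n"
      show "indicator U x * ennreal (heat 1 z) \<le> liminf (\<lambda>k. ?g k x z)"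
      proof (cases "x \<in> U")
        case True
        have "\<forall>\<^sub>F k in sequentially. x + (1 / real (Suc k)) *\<^sub>R z \<in> U"
          using topological_tendstoD[OF conv U(1) True] .
        then have "\<forall>\<^sub>F k in sequentially. indicator U x * ennreal (heat 1 z) \<le> ?g k x z"
          by eventually_elim simp
        then show ?thesis by (rule Liminf_bounded)
      qed simp
    qed
    also have "\<dots> \<le> liminf (\<lambda>k. \<integral>\<^sup>+z. ?g k x z \<partial>lebesgue)"
      by (rule nn_integral_liminf) (rule meas)
    finally show "indicator U x \<le> liminf (\<lambda>k. \<integral>\<^sup>+z. ?g k x z \<partial>lebesgue)" .
  qed
  also have "\<dots> \<le> liminf (\<lambda>k. \<integral>\<^sup>+x. \<integral>\<^sup>+z. ?g k x z \<partial>lebesgue \<partial>lebesgue)"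
    by (rule nn_integral_liminf) measurable
  also have "\<dots> \<le> (\<integral>\<^sup>+l. ennreal ((cmod (fourier_integral (indicator U) l))\<^sup>2) \<partial>lebesgue)"
    by (intro Liminf_le always_eventually allI fourier_integral_indicator_gauss U) auto
  finally show ?thesis .
qed

section \<open>Plancherel's theorem\<close>

definition isometric_at :: "(real^'n \<Rightarrow> complex) \<Rightarrow> bool" where
  "isometric_at f \<longleftrightarrow> integrable lebesgue f \<and> f \<in> L2 \<and> l2_norm (fourier_integral f) = l2_norm f"

lemma isometric_at_cmult: "isometric_at f \<Longrightarrow> isometric_at (\<lambda>x. c * f x)"
proof -
  assume f: "isometric_at f"
  have "l2_norm (fourier_integral (\<lambda>x. c * f x)) = l2_norm (\<lambda>l. c * fourier_integral f l)"
    by (intro arg_cong[of _ _ l2_norm] ext fourier_integral_cmult)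
  with f show ?thesis by (auto simp: isometric_at_def l2_norm_cmult)
qed

text \<open>Since the Fourier integral is a contraction, the parallelogram law forces equality on sums.\<close>

lemma isometric_at_add:
  fixes f g :: "real^'n \<Rightarrow> complex"
  assumes f: "isometric_at f" and g: "isometric_at g" shows "isometric_at (\<lambda>x. f x + g x)"
proof -
  have L: "f \<in> L2" "g \<in> L2" "integrable lebesgue f" "integrable lebesgue g"
    using f g by (auto simp: isometric_at_def)
  have F: "fourier_integral f \<in> L2" "fourier_integral g \<in> L2" using L by (auto intro: fourier_integral_L2)
  have par: "(l2_norm (\<lambda>x. a x + b x))\<^sup>2 + (l2_norm (\<lambda>x. a x - b x))\<^sup>2 = 2 * (l2_norm a)\<^sup>2 + 2 * (l2_norm b)\<^sup>2"
    if "a \<in> L2" "b \<in> L2" for a b :: "real^'n \<Rightarrow> complex"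
    using that by (simp add: l2_norm_add_squared l2_norm_diff_squared)
  have eq: "fourier_integral (\<lambda>x. f x + g x) = (\<lambda>l. fourier_integral f l + fourier_integral g l)"
      "fourier_integral (\<lambda>x. f x - g x) = (\<lambda>l. fourier_integral f l - fourier_integral g l)"
    using L by (simp_all add: fun_eq_iff fourier_integral_add fourier_integral_diff)
  have add: "l2_norm (\<lambda>l. fourier_integral f l + fourier_integral g l) \<le> l2_norm (\<lambda>x. f x + g x)"
    unfolding eq[symmetric] using L by (intro l2_norm_fourier_integral_le) auto
  have diff: "l2_norm (\<lambda>l. fourier_integral f l - fourier_integral g l) \<le> l2_norm (\<lambda>x. f x - g x)"
    unfolding eq[symmetric] using L by (intro l2_norm_fourier_integral_le) auto
  have "(l2_norm (\<lambda>l. fourier_integral f l + fourier_integral g l))\<^sup>2 + (l2_norm (\<lambda>l. fourier_integral f l - fourier_integral g l))\<^sup>2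
      = (l2_norm (\<lambda>x. f x + g x))\<^sup>2 + (l2_norm (\<lambda>x. f x - g x))\<^sup>2"
    using par[OF L(1,2)] par[OF F] f g by (simp add: isometric_at_def)
  moreover have "(l2_norm (\<lambda>l. fourier_integral f l - fourier_integral g l))\<^sup>2 \<le> (l2_norm (\<lambda>x. f x - g x))\<^sup>2"
    using diff by (rule power_mono) simp
  ultimately have "(l2_norm (\<lambda>x. f x + g x))\<^sup>2 \<le> (l2_norm (\<lambda>l. fourier_integral f l + fourier_integral g l))\<^sup>2"
    by linarith
  then have "l2_norm (\<lambda>x. f x + g x) \<le> l2_norm (\<lambda>l. fourier_integral f l + fourier_integral g l)"
    by (rule power2_le_imp_le) simp
  then show ?thesis using add L by (auto simp: isometric_at_def eq(1))
qed

lemma isometric_at_sum: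
  fixes f :: "'i \<Rightarrow> real^'n \<Rightarrow> complex"
  shows
  "finite F \<Longrightarrow> (\<And>i. i \<in> F \<Longrightarrow> isometric_at (f i)) \<Longrightarrow> isometric_at (\<lambda>x. \<Sum>i\<in>F. f i x)"
proof (induction F rule: finite_induct)
  case empty
  have "fourier_integral (\<lambda>x::real^'n. 0 :: complex) = (\<lambda>l. 0)" by (simp add: fourier_integral_def fun_eq_iff)
  then show ?case by (simp add: isometric_at_def)
qed (simp add: isometric_at_add)

text \<open>The contraction property carries the convergence over to the transforms, so the two
  norms have the same limit.\<close>

lemma isometric_at_limit:
  assumes s: "\<And>k. isometric_at (s k)" and f: "integrable lebesgue f" "f \<in> L2"
    and lim: "(\<lambda>k. l2_norm (\<lambda>x. s k x - f x)) \<longlonglongrightarrow> 0"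
  shows "isometric_at f"
proof -
  have L: "\<And>k. s k \<in> L2" "\<And>k. integrable lebesgue (s k)" using s by (auto simp: isometric_at_def)
  have le: "l2_norm (\<lambda>l. fourier_integral (s k) l - fourier_integral f l) \<le> l2_norm (\<lambda>x. s k x - f x)" for k
  proof -
    have "l2_norm (\<lambda>l. fourier_integral (s k) l - fourier_integral f l) = l2_norm (fourier_integral (\<lambda>x. s k x - f x))"
      using L f by (intro arg_cong[of _ _ l2_norm] ext fourier_integral_diff[symmetric])
    also have "\<dots> \<le> l2_norm (\<lambda>x. s k x - f x)" using L f by (intro l2_norm_fourier_integral_le) auto
    finally show ?thesis .
  qed
  have "(\<lambda>k. l2_norm (\<lambda>l. fourier_integral (s k) l - fourier_integral f l)) \<longlonglongrightarrow> 0"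
    by (rule tendsto_sandwich[OF _ _ tendsto_const lim]) (auto intro: always_eventually le)
  then have "(\<lambda>k. l2_norm (fourier_integral (s k))) \<longlonglongrightarrow> l2_norm (fourier_integral f)"
    using L f by (intro l2_norm_tendsto fourier_integral_L2)
  moreover have "(\<lambda>k. l2_norm (fourier_integral (s k))) \<longlonglongrightarrow> l2_norm f"
    using l2_norm_tendsto[OF L(1) f(2) lim] s by (simp add: isometric_at_def)
  ultimately show ?thesis using LIMSEQ_unique f by (auto simp: isometric_at_def)
qed

lemma l2_norm_indicator:
  assumes "E \<in> lmeasurable" shows "(l2_norm (indicator E))\<^sup>2 = measure lebesgue E"
proof -
  have "(\<lambda>x. (cmod (indicator E x))\<^sup>2) = (indicator E :: real^'a \<Rightarrow> real)" by (auto simp: indicator_def)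
  then show ?thesis using assms unfolding l2_norm_squared by (simp add: fmeasurable_def)
qed

lemma isometric_at_indicator_open:
  fixes U :: "(real^'n) set"
  assumes U: "open U" "U \<in> lmeasurable"
  shows "isometric_at (indicator U)"
proof -
  have int: "integrable lebesgue (indicator U :: real^'n \<Rightarrow> complex)" "(indicator U :: real^'n \<Rightarrow> complex) \<in> L2"
    using U by (auto intro: integrable_complex_indicator L2_indicator)
  have fin: "emeasure lebesgue U < \<infinity>" using fmeasurableD2[OF U(2)] by (simp only: less_top infinity_ennreal_def)
  have "ennreal ((l2_norm (indicator U :: real^'n \<Rightarrow> complex))\<^sup>2) = emeasure lebesgue U"
    using l2_norm_indicator[OF U(2)] U(2) by (simp add: emeasure_eq_measure2)
  also have "\<dots> \<le> ennreal ((l2_norm (fourier_integral (indicator U)))\<^sup>2)"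
    using fourier_integral_indicator_open[OF U(1) fin] nn_integral_l2_norm[OF fourier_integral_L2[OF int]] by simp
  finally have "(l2_norm (indicator U :: real^'n \<Rightarrow> complex))\<^sup>2 \<le> (l2_norm (fourier_integral (indicator U)))\<^sup>2"
    by (subst (asm) ennreal_le_iff) auto
  then have "l2_norm (indicator U :: real^'n \<Rightarrow> complex) \<le> l2_norm (fourier_integral (indicator U))"
    by (rule power2_le_imp_le) simp
  then show ?thesis using l2_norm_fourier_integral_le[OF int] int by (simp add: isometric_at_def)
qed

text \<open>Outer regularity: the squared distance between the indicators of \<open>E\<close> and of
  an open superset is the measure of the difference.\<close>

lemma isometric_at_indicator:
  fixes E :: "(real^'n) set"
  assumes E: "E \<in> lmeasurable"
  shows "isometric_at (indicator E)"
proof -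
  have "\<exists>U. open U \<and> E \<subseteq> U \<and> U - E \<in> lmeasurable \<and> emeasure lebesgue (U - E) < ennreal (inverse (real (Suc k)))" for k
    using sets_lebesgue_outer_open[of E "inverse (real (Suc k))"] E by (metis fmeasurableD inverse_positive_iff_positive of_nat_0_less_iff zero_less_Suc)
  then obtain U where U: "\<And>k. open (U k)" "\<And>k. E \<subseteq> U k" "\<And>k. U k - E \<in> lmeasurable"
    "\<And>k. emeasure lebesgue (U k - E) < ennreal (inverse (real (Suc k)))" by metis
  have Um: "U k \<in> lmeasurable" for k
    using fmeasurable.Un[OF E U(3)[of k]] U(2)[of k] by (simp add: Un_absorb1)
  show ?thesis
  proof (rule isometric_at_limit)
    show "isometric_at (indicator (U k))" for k by (rule isometric_at_indicator_open[OF U(1) Um])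
    show "integrable lebesgue (indicator E :: real^'n \<Rightarrow> complex)" "(indicator E :: real^'n \<Rightarrow> complex) \<in> L2"
      using E by (auto intro: integrable_complex_indicator L2_indicator)
    have "(\<lambda>k. (l2_norm (\<lambda>x. indicator (U k) x - indicator E x))\<^sup>2) \<longlonglongrightarrow> 0"
    proof (rule tendsto_sandwich[OF _ _ tendsto_const LIMSEQ_inverse_real_of_nat])
      have "(l2_norm (\<lambda>x. indicator (U k) x - indicator E x))\<^sup>2 \<le> inverse (real (Suc k))" for k
      proof -
        have "(\<lambda>x. indicator (U k) x - indicator E x) = (indicator (U k - E) :: real^'n \<Rightarrow> complex)"
          using U(2)[of k] by (auto simp: indicator_def fun_eq_iff)
        then have "(l2_norm (\<lambda>x. indicator (U k) x - indicator E x))\<^sup>2 = measure lebesgue (U k - E)"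
          using l2_norm_indicator[OF U(3)[of k]] by simp
        also have "ennreal \<dots> < ennreal (inverse (real (Suc k)))"
          using U(4)[of k] emeasure_eq_measure2[OF U(3)[of k]] by simp
        then have "measure lebesgue (U k - E) \<le> inverse (real (Suc k))"
          by (subst (asm) ennreal_less_iff) auto
        finally show ?thesis .
      qed
      then show "\<forall>\<^sub>F k in sequentially. (l2_norm (\<lambda>x. indicator (U k) x - indicator E x))\<^sup>2 \<le> inverse (real (Suc k))" by simp
    qed simp
    from tendsto_real_sqrt[OF this]
    show "(\<lambda>k. l2_norm (\<lambda>x. indicator (U k) x - indicator E x)) \<longlonglongrightarrow> 0" by simp
  qed
qed

text \<open>A level set of a nonzero value \<open>y\<close> has finite measure by Chebyshev's
  inequality; the value 0 contributes nothing and is left out of the sum. In particular such a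
  function is integrable.\<close>

lemma isometric_at_simple:
  fixes g :: "real^'n \<Rightarrow> complex"
  assumes g: "simple_function lebesgue g" "g \<in> L2"
  shows "isometric_at g"
proof -
  have fin: "finite (range g)" using g(1) by (simp add: simple_function_def)
  let ?E = "\<lambda>y. g -` {y}"
  have E: "?E y \<in> lmeasurable" if "y \<noteq> 0" for y
  proof -
    have m: "?E y \<in> sets lebesgue" using simple_functionD(2)[OF g(1), of "{y}"] by simp
    have "ennreal ((cmod y)\<^sup>2) * emeasure lebesgue (?E y) = (\<integral>\<^sup>+x. ennreal ((cmod y)\<^sup>2) * indicator (?E y) x \<partial>lebesgue)"
      using m by (simp add: nn_integral_cmult)
    also have "\<dots> \<le> (\<integral>\<^sup>+x. ennreal ((cmod (g x))\<^sup>2) \<partial>lebesgue)"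
      by (intro nn_integral_mono) (auto simp: indicator_def)
    also have "\<dots> < \<infinity>" using g(2) by (simp add: L2_iff_nn_integral)
    finally have "emeasure lebesgue (?E y) < \<infinity>"
      using that by (auto simp: ennreal_mult_less_top)
    with m show ?thesis by (simp add: fmeasurable_def)
  qed
  have "g = (\<lambda>x. \<Sum>y\<in>range g - {0}. y * indicator (?E y) x)"
  proof
    fix x
    have "(\<Sum>y\<in>range g - {0}. y * indicator (?E y) x) = (\<Sum>y\<in>range g - {0}. if y = g x then y else 0)"
      by (intro sum.cong) (auto simp: indicator_def)
    also have "\<dots> = g x" using fin by (simp add: sum.delta')
    finally show "g x = (\<Sum>y\<in>range g - {0}. y * indicator (?E y) x)" by simp
  qed
  moreover have "isometric_at (\<lambda>x. \<Sum>y\<in>range g - {0}. y * indicator (?E y) x)"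
    using fin by (intro isometric_at_sum isometric_at_cmult isometric_at_indicator E) auto
  ultimately show ?thesis by simp
qed

lemma fourier_integral_isometric:
  fixes f :: "real^'n \<Rightarrow> complex"
  assumes f: "integrable lebesgue f" "f \<in> L2"
  shows "l2_norm (fourier_integral f) = l2_norm f"
proof -
  obtain F where F: "\<And>i. simple_function lebesgue (F i)" "\<And>x. (\<lambda>i. F i x) \<longlonglongrightarrow> f x"
    "\<And>i x. dist (F i x) 0 \<le> 2 * dist (f x) 0"
    using borel_measurable_implies_sequence_metric[OF L2_measurable[OF f(2)], of 0] by auto
  \<comment> \<open>The approximating simple functions are bounded by twice the modulus of
    \<open>f\<close>, so their distance to \<open>f\<close> is bounded by three times it.\<close>
  have F2: "(\<lambda>x. 2 * f x) \<in> L2" "(\<lambda>x. 3 * f x) \<in> L2" using f by auto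
  have FL: "F i \<in> L2" for i
    by (rule L2_dominated[OF F2(1)]) (use F in \<open>auto intro: borel_measurable_simple_function simp: norm_mult\<close>)
  have "isometric_at f"
  proof (rule isometric_at_limit[OF isometric_at_simple[OF F(1) FL] f])
    show "(\<lambda>k. l2_norm (\<lambda>x. F k x - f x)) \<longlonglongrightarrow> 0"
    proof (rule l2_norm_dominated_convergence[OF F2(2) f(2) FL F(2)])
      fix k x
      have "cmod (F k x - f x) \<le> cmod (F k x) + cmod (f x)" by (rule norm_triangle_ineq4)
      then show "cmod (F k x - f x) \<le> cmod (3 * f x)" using F(3)[of k x] by (simp add: norm_mult)
    qed
  qed
  then show ?thesis by (simp add: isometric_at_def)
qed

section \<open>The Fourier transform as a unitary relation on square integrable functions\<close>

lemma has_fourier_L2: "has_fourier f g \<Longrightarrow> f \<in> L2" "has_fourier f g \<Longrightarrow> g \<in> L2"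
  by (simp_all add: has_fourier_def)

lemma has_fourier_iff:
  "has_fourier f g \<longleftrightarrow> f \<in> L2 \<and> g \<in> L2 \<and> (\<exists>s. (\<forall>k. s k \<in> L2 \<and> integrable lebesgue (s k))
    \<and> (\<lambda>k. l2_norm (\<lambda>x. s k x - f x)) \<longlonglongrightarrow> 0
    \<and> (\<lambda>k. l2_norm (\<lambda>x. fourier_integral (s k) x - g x)) \<longlonglongrightarrow> 0)"
  unfolding has_fourier_def
  by (intro conj_cong refl ex_cong1) (auto simp: l2_tendsto_iff fourier_integral_L2)

lemma has_fourierI:
  assumes "f \<in> L2" "g \<in> L2" "\<And>k. s k \<in> L2" "\<And>k. integrable lebesgue (s k)"
    "(\<lambda>k. l2_norm (\<lambda>x. s k x - f x)) \<longlonglongrightarrow> 0" "(\<lambda>k. l2_norm (\<lambda>x. fourier_integral (s k) x - g x)) \<longlonglongrightarrow> 0"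
  shows "has_fourier f g"
  unfolding has_fourier_iff using assms by blast

lemma has_fourierE:
  assumes "has_fourier f g"
  obtains s where "\<And>k. s k \<in> L2" "\<And>k. integrable lebesgue (s k)" "\<And>k. fourier_integral (s k) \<in> L2"
    "(\<lambda>k. l2_norm (\<lambda>x. s k x - f x)) \<longlonglongrightarrow> 0" "(\<lambda>k. l2_norm (\<lambda>x. fourier_integral (s k) x - g x)) \<longlonglongrightarrow> 0"
proof -
  obtain s where "\<forall>k. s k \<in> L2 \<and> integrable lebesgue (s k)"
    "(\<lambda>k. l2_norm (\<lambda>x. s k x - f x)) \<longlonglongrightarrow> 0" "(\<lambda>k. l2_norm (\<lambda>x. fourier_integral (s k) x - g x)) \<longlonglongrightarrow> 0"
    using assms unfolding has_fourier_iff by blast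
  then show ?thesis using that fourier_integral_L2 by blast
qed

lemma has_fourier_norm:
  assumes "has_fourier f g" shows "l2_norm g = l2_norm f"
proof -
  obtain s where s: "\<And>k. s k \<in> L2" "\<And>k. integrable lebesgue (s k)" "\<And>k. fourier_integral (s k) \<in> L2"
    "(\<lambda>k. l2_norm (\<lambda>x. s k x - f x)) \<longlonglongrightarrow> 0" "(\<lambda>k. l2_norm (\<lambda>x. fourier_integral (s k) x - g x)) \<longlonglongrightarrow> 0"
    using assms by (rule has_fourierE) blast
  have "(\<lambda>k. l2_norm (s k)) \<longlonglongrightarrow> l2_norm g"
    using l2_norm_tendsto[OF s(3) has_fourier_L2(2)[OF assms] s(5)] by (simp add: fourier_integral_isometric s(1,2))
  then show ?thesis
    using l2_norm_tendsto[OF s(1) has_fourier_L2(1)[OF assms] s(4)] by (rule LIMSEQ_unique)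
qed

lemma has_fourier_add:
  assumes f: "has_fourier f g" and f': "has_fourier f' g'"
  shows "has_fourier (\<lambda>x. f x + f' x) (\<lambda>x. g x + g' x)"
proof -
  obtain s where s: "\<And>k. s k \<in> L2" "\<And>k. integrable lebesgue (s k)" "\<And>k. fourier_integral (s k) \<in> L2"
    "(\<lambda>k. l2_norm (\<lambda>x. s k x - f x)) \<longlonglongrightarrow> 0" "(\<lambda>k. l2_norm (\<lambda>x. fourier_integral (s k) x - g x)) \<longlonglongrightarrow> 0"
    using f by (rule has_fourierE) blast
  obtain r where r: "\<And>k. r k \<in> L2" "\<And>k. integrable lebesgue (r k)" "\<And>k. fourier_integral (r k) \<in> L2"
    "(\<lambda>k. l2_norm (\<lambda>x. r k x - f' x)) \<longlonglongrightarrow> 0" "(\<lambda>k. l2_norm (\<lambda>x. fourier_integral (r k) x - g' x)) \<longlonglongrightarrow> 0"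
    using f' by (rule has_fourierE) blast
  note L = has_fourier_L2[OF f] has_fourier_L2[OF f']
  have lim: "(\<lambda>k. l2_norm (\<lambda>x. (a k x + b k x) - (c x + d x))) \<longlonglongrightarrow> 0"
    if "\<And>k. a k \<in> L2" "\<And>k. b k \<in> L2" "c \<in> L2" "d \<in> L2"
      "(\<lambda>k. l2_norm (\<lambda>x. a k x - c x)) \<longlonglongrightarrow> 0" "(\<lambda>k. l2_norm (\<lambda>x. b k x - d x)) \<longlonglongrightarrow> 0"
    for a b and c d :: "real^'a \<Rightarrow> complex"
  proof (rule tendsto_sandwich[OF _ _ tendsto_const tendsto_add_zero[OF that(5,6)]])
    have "l2_norm (\<lambda>x. (a k x + b k x) - (c x + d x)) \<le> l2_norm (\<lambda>x. a k x - c x) + l2_norm (\<lambda>x. b k x - d x)" for k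
      using l2_norm_triangle[of "\<lambda>x. a k x - c x" "\<lambda>x. b k x - d x"] that(1-4) by (simp add: L2_diff add_diff_add)
    then show "\<forall>\<^sub>F k in sequentially. l2_norm (\<lambda>x. (a k x + b k x) - (c x + d x)) \<le> l2_norm (\<lambda>x. a k x - c x) + l2_norm (\<lambda>x. b k x - d x)"
      by simp
  qed simp
  show ?thesis
  proof (rule has_fourierI[where s = "\<lambda>k x. s k x + r k x"])
    show "(\<lambda>k. l2_norm (\<lambda>x. s k x + r k x - (f x + f' x))) \<longlonglongrightarrow> 0"
      by (rule lim) (fact s r L)+
    have "(\<lambda>k. l2_norm (\<lambda>x. (fourier_integral (s k) x + fourier_integral (r k) x) - (g x + g' x))) \<longlonglongrightarrow> 0"
      by (rule lim) (fact s r L)+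
    then show "(\<lambda>k. l2_norm (\<lambda>x. fourier_integral (\<lambda>x. s k x + r k x) x - (g x + g' x))) \<longlonglongrightarrow> 0"
      by (simp add: fourier_integral_add s(2) r(2))
  qed (use L s r in auto)
qed

lemma has_fourier_cmult:
  assumes f: "has_fourier f g" shows "has_fourier (\<lambda>x. c * f x) (\<lambda>x. c * g x)"
proof -
  obtain s where s: "\<And>k. s k \<in> L2" "\<And>k. integrable lebesgue (s k)" "\<And>k. fourier_integral (s k) \<in> L2"
    "(\<lambda>k. l2_norm (\<lambda>x. s k x - f x)) \<longlonglongrightarrow> 0" "(\<lambda>k. l2_norm (\<lambda>x. fourier_integral (s k) x - g x)) \<longlonglongrightarrow> 0"
    using f by (rule has_fourierE) blast
  have eq: "l2_norm (\<lambda>x. c * a x - c * b x) = cmod c * l2_norm (\<lambda>x. a x - b x)" for a b :: "real^'a \<Rightarrow> complex"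
    using l2_norm_cmult[of c "\<lambda>x. a x - b x"] by (simp add: right_diff_distrib)
  show ?thesis
    by (rule has_fourierI[where s = "\<lambda>k x. c * s k x"])
      (use has_fourier_L2[OF f] s in \<open>auto simp: fourier_integral_cmult eq intro!: tendsto_mult_right_zero\<close>)
qed

text \<open>Truncations to balls are integrable, being products of two square integrable functions.
  They converge in the mean, and by the isometry their transforms form a Cauchy sequence.\<close>

lemma has_fourier_exists:
  fixes f :: "real^'n \<Rightarrow> complex"
  assumes f: "f \<in> L2" shows "\<exists>g. has_fourier f g"
proof -
  define s :: "nat \<Rightarrow> real^'n \<Rightarrow> complex" where "s k x = f x * indicator (cball 0 (real k)) x" for k x
  have sL: "s k \<in> L2" for k
    unfolding s_def using f by (intro L2_mult_indicator) auto
  have sint: "integrable lebesgue (s k)" for k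
  proof -
    have "integrable lebesgue (\<lambda>x. f x * cnj (indicator (cball 0 (real k)) x))"
      using f by (intro L2_inner_integrable L2_indicator) auto
    moreover have "(\<lambda>x. f x * cnj (indicator (cball 0 (real k)) x)) = s k"
      by (simp add: fun_eq_iff s_def indicator_def)
    ultimately show ?thesis by simp
  qed
  have lim: "(\<lambda>k. l2_norm (\<lambda>x. s k x - f x)) \<longlonglongrightarrow> 0"
  proof (rule l2_norm_dominated_convergence[OF f f sL])
    fix x :: "real^'n"
    obtain N where N: "norm x \<le> real N" using real_arch_simple by blast
    have "\<forall>\<^sub>F k in sequentially. s k x = f x"
      unfolding eventually_sequentially s_def using N by (intro exI[of _ N]) (auto simp: indicator_def)
    then show "(\<lambda>k. s k x) \<longlonglongrightarrow> f x" by (rule tendsto_eventually)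
  qed (auto simp: s_def indicator_def)
  have "\<exists>g\<in>L2. (\<lambda>k. l2_norm (\<lambda>x. fourier_integral (s k) x - g x)) \<longlonglongrightarrow> 0"
  proof (rule L2_complete)
    show "fourier_integral (s k) \<in> L2" for k by (rule fourier_integral_L2[OF sint sL])
    fix e :: real assume "0 < e"
    then obtain N where N: "\<And>k. N \<le> k \<Longrightarrow> l2_norm (\<lambda>x. s k x - f x) < e / 2"
      using LIMSEQ_D[OF lim, of "e / 2"] by auto
    have "l2_norm (\<lambda>x. fourier_integral (s m) x - fourier_integral (s n) x) < e" if "N \<le> m" "N \<le> n" for m n
    proof -
      have "l2_norm (\<lambda>x. fourier_integral (s m) x - fourier_integral (s n) x) = l2_norm (fourier_integral (\<lambda>x. s m x - s n x))"
        by (intro arg_cong[of _ _ l2_norm] ext fourier_integral_diff[symmetric] sint)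
      also have "\<dots> = l2_norm (\<lambda>x. s m x - s n x)"
        using sint sL by (intro fourier_integral_isometric) auto
      also have "\<dots> \<le> l2_norm (\<lambda>x. s m x - f x) + l2_norm (\<lambda>x. f x - s n x)"
        by (rule l2_norm_triangle_diff[OF sL f sL])
      finally show ?thesis using N[OF that(1)] N[OF that(2)] l2_norm_diff_commute[of f "s n"] by linarith
    qed
    then show "\<exists>N. \<forall>m\<ge>N. \<forall>n\<ge>N. l2_norm (\<lambda>x. fourier_integral (s m) x - fourier_integral (s n) x) < e" by blast
  qed
  then obtain g where "g \<in> L2" "(\<lambda>k. l2_norm (\<lambda>x. fourier_integral (s k) x - g x)) \<longlonglongrightarrow> 0" by blast
  then have "has_fourier f g" using f sL sint lim by (intro has_fourierI)
  then show ?thesis by blast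
qed

text \<open>The explicit conjugates cancel the one inside \<open>l2_inner\<close>, so this is the
  bilinear multiplication formula extended by continuity.\<close>

lemma has_fourier_multiplication:
  assumes f: "has_fourier f g" and f': "has_fourier f' g'"
  shows "l2_inner g (\<lambda>x. cnj (f' x)) = l2_inner f (\<lambda>x. cnj (g' x))"
proof -
  obtain s where s: "\<And>k. s k \<in> L2" "\<And>k. integrable lebesgue (s k)" "\<And>k. fourier_integral (s k) \<in> L2"
    "(\<lambda>k. l2_norm (\<lambda>x. s k x - f x)) \<longlonglongrightarrow> 0" "(\<lambda>k. l2_norm (\<lambda>x. fourier_integral (s k) x - g x)) \<longlonglongrightarrow> 0"
    using f by (rule has_fourierE) blast
  obtain r where r: "\<And>k. r k \<in> L2" "\<And>k. integrable lebesgue (r k)" "\<And>k. fourier_integral (r k) \<in> L2"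
    "(\<lambda>k. l2_norm (\<lambda>x. r k x - f' x)) \<longlonglongrightarrow> 0" "(\<lambda>k. l2_norm (\<lambda>x. fourier_integral (r k) x - g' x)) \<longlonglongrightarrow> 0"
    using f' by (rule has_fourierE) blast
  note L = has_fourier_L2[OF f] has_fourier_L2[OF f']
  have cnj: "(\<lambda>k. l2_norm (\<lambda>x. cnj (a k x) - cnj (b x))) \<longlonglongrightarrow> 0" if "(\<lambda>k. l2_norm (\<lambda>x. a k x - b x)) \<longlonglongrightarrow> 0"
    for a and b :: "real^'a \<Rightarrow> complex"
  proof -
    have "l2_norm (\<lambda>x. cnj (a k x) - cnj (b x)) = l2_norm (\<lambda>x. a k x - b x)" for k
      unfolding l2_norm_def by (simp only: complex_mod_cnj flip: complex_cnj_diff)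
    then show ?thesis using that by simp
  qed
  have "(\<lambda>k. l2_inner (fourier_integral (s k)) (\<lambda>x. cnj (r k x))) \<longlonglongrightarrow> l2_inner g (\<lambda>x. cnj (f' x))"
    using s r L by (intro l2_inner_tendsto cnj L2_cnj) auto
  moreover have "l2_inner (fourier_integral (s k)) (\<lambda>x. cnj (r k x)) = l2_inner (s k) (\<lambda>x. cnj (fourier_integral (r k) x))" for k
    unfolding l2_inner_def using fourier_multiplication_formula[OF s(2) r(2)] by simp
  moreover have "(\<lambda>k. l2_inner (s k) (\<lambda>x. cnj (fourier_integral (r k) x))) \<longlonglongrightarrow> l2_inner f (\<lambda>x. cnj (g' x))"
    using s r L by (intro l2_inner_tendsto cnj L2_cnj) auto
  ultimately show ?thesis using LIMSEQ_unique by auto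
qed

lemma has_fourier_cong_AE:
  assumes h: "has_fourier f g" and f': "f' \<in> L2" "AE x in lebesgue. f x = f' x"
    and g': "g' \<in> L2" "AE x in lebesgue. g x = g' x"
  shows "has_fourier f' g'"
proof -
  obtain s where s: "\<And>k. s k \<in> L2" "\<And>k. integrable lebesgue (s k)" "\<And>k. fourier_integral (s k) \<in> L2"
    "(\<lambda>k. l2_norm (\<lambda>x. s k x - f x)) \<longlonglongrightarrow> 0" "(\<lambda>k. l2_norm (\<lambda>x. fourier_integral (s k) x - g x)) \<longlonglongrightarrow> 0"
    using h by (rule has_fourierE) blast
  have eq: "l2_norm (\<lambda>x. a x - b x) = l2_norm (\<lambda>x. a x - c x)"
    if "a \<in> L2" "b \<in> L2" "c \<in> L2" "AE x in lebesgue. b x = c x" for a b c :: "real^'a \<Rightarrow> complex"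
    by (rule l2_norm_cong_AE) (use that in \<open>auto intro!: L2_measurable elim: eventually_mono\<close>)
  note L = has_fourier_L2[OF h]
  show ?thesis
  proof (rule has_fourierI[where s = s])
    show "(\<lambda>k. l2_norm (\<lambda>x. s k x - f' x)) \<longlonglongrightarrow> 0" using s(4) eq[OF s(1) L(1) f'] by simp
    show "(\<lambda>k. l2_norm (\<lambda>x. fourier_integral (s k) x - g' x)) \<longlonglongrightarrow> 0" using s(5) eq[OF s(3) L(2) g'] by simp
  qed (use s f' g' in auto)
qed

lemma has_fourier_diff:
  "has_fourier f g \<Longrightarrow> has_fourier f' g' \<Longrightarrow> has_fourier (\<lambda>x. f x - f' x) (\<lambda>x. g x - g' x)"
  using has_fourier_add[OF _ has_fourier_cmult[of f' g' "-1"], of f g] by simp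

text \<open>The difference of two transforms of \<open>f\<close> is a transform of 0, and transforms
  preserve the norm.\<close>

lemma has_fourier_unique:
  assumes "has_fourier f g" "has_fourier f g'" shows "AE x in lebesgue. g x = g' x"
proof -
  have "l2_norm (\<lambda>x. g x - g' x) = l2_norm (\<lambda>x. f x - f x)"
    by (rule has_fourier_norm) (rule has_fourier_diff[OF assms])
  also have "\<dots> = 0" by (simp add: l2_norm_def)
  finally show ?thesis
    unfolding l2_norm_diff_eq_0_iff[OF has_fourier_L2(2)[OF assms(1)] has_fourier_L2(2)[OF assms(2)]] .
qed

lemma
  fixes M :: "real^'n^'n"
  assumes M: "invertible M" and f: "f \<in> L2"
  shows L2_matrix: "(\<lambda>x. f (M *v x)) \<in> L2"
    and l2_norm_matrix: "l2_norm (\<lambda>x. f (M *v x)) = l2_norm f / sqrt \<bar>det M\<bar>"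
proof -
  have [measurable]: "f \<in> borel_measurable lebesgue" using f by (rule L2_measurable)
  have m: "(\<lambda>x. (cmod (f x))\<^sup>2) \<in> borel_measurable lebesgue" by measurable
  show "(\<lambda>x. f (M *v x)) \<in> L2"
    unfolding L2_def using integrable_matrix[OF M m L2_integrable[OF f]]
      measurable_compose[OF measurable_matrix_lebesgue[OF M], of f borel] by simp
  show "l2_norm (\<lambda>x. f (M *v x)) = l2_norm f / sqrt \<bar>det M\<bar>"
    unfolding l2_norm_def integral_matrix[OF M m] by (simp add: real_sqrt_divide)
qed

text \<open>Treats reflection as a linear change of variables. Only the absolute value of the
  determinant matters, and the square of the matrix being the identity gives it without regard to
  the parity of the dimension.\<close>

lemma minus_mat_1: "invertible (- mat 1 :: real^'n^'n)" "\<bar>det (- mat 1 :: real^'n^'n)\<bar> = 1"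
  "(- mat 1 :: real^'n^'n) *v x = - x"
proof -
  show v: "(- mat 1 :: real^'n^'n) *v x = - x" for x
    using matrix_vector_mult_diff_rdistrib[of 0 "mat 1" x] by simp
  have 1: "(- mat 1 :: real^'n^'n) ** (- mat 1) = mat 1"
    unfolding matrix_eq matrix_vector_mul_assoc[symmetric] v by simp
  then show "invertible (- mat 1 :: real^'n^'n)" unfolding invertible_def by blast
  have "det (- mat 1 :: real^'n^'n) * det (- mat 1 :: real^'n^'n) = 1"
    unfolding det_mul[symmetric] 1 by simp
  then have "det (- mat 1 :: real^'n^'n) = 1 \<or> det (- mat 1 :: real^'n^'n) = - 1" by (simp only: square_eq_1_iff)
  then show "\<bar>det (- mat 1 :: real^'n^'n)\<bar> = 1" by linarith
qed

lemma
  assumes "f \<in> L2"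
  shows L2_reflect: "(\<lambda>x. f (- x)) \<in> L2" and l2_norm_reflect: "l2_norm (\<lambda>x. f (- x)) = l2_norm f"
  using L2_matrix[OF minus_mat_1(1) assms] l2_norm_matrix[OF minus_mat_1(1) assms]
  by (simp_all add: minus_mat_1)

lemma l2_norm_cnj: "l2_norm (\<lambda>x. cnj (f x)) = l2_norm f"
  by (simp add: l2_norm_def)

lemma has_fourier_cnj:
  assumes h: "has_fourier f g" shows "has_fourier (\<lambda>x. cnj (f x)) (\<lambda>l. cnj (g (- l)))"
proof -
  obtain s where s: "\<And>k. s k \<in> L2" "\<And>k. integrable lebesgue (s k)" "\<And>k. fourier_integral (s k) \<in> L2"
    "(\<lambda>k. l2_norm (\<lambda>x. s k x - f x)) \<longlonglongrightarrow> 0" "(\<lambda>k. l2_norm (\<lambda>x. fourier_integral (s k) x - g x)) \<longlonglongrightarrow> 0"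
    using h by (rule has_fourierE) blast
  note L = has_fourier_L2[OF h]
  show ?thesis
  proof (rule has_fourierI[where s = "\<lambda>k x. cnj (s k x)"])
    show "(\<lambda>k. l2_norm (\<lambda>x. cnj (s k x) - cnj (f x))) \<longlonglongrightarrow> 0"
      using s(4) by (simp add: l2_norm_cnj flip: complex_cnj_diff)
    have "l2_norm (\<lambda>x. fourier_integral (\<lambda>x. cnj (s k x)) x - cnj (g (- x))) = l2_norm (\<lambda>x. fourier_integral (s k) x - g x)" for k
      using l2_norm_reflect[OF L2_diff[OF s(3) L(2)], of k]
      by (simp add: fourier_integral_cnj l2_norm_cnj flip: complex_cnj_diff)
    then show "(\<lambda>k. l2_norm (\<lambda>x. fourier_integral (\<lambda>x. cnj (s k x)) x - cnj (g (- x)))) \<longlonglongrightarrow> 0"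
      using s(5) by simp
    show "integrable lebesgue (\<lambda>x. cnj (s k x))" for k using s(2) by simp
  qed (use L s in \<open>auto intro: L2_reflect\<close>)
qed

text \<open>The adjoint of the isometry is itself an isometry, hence the isometry is onto.\<close>

lemma has_fourier_inverse_exists:
  assumes g: "g \<in> L2" shows "\<exists>f. has_fourier f g"
proof -
  obtain h where h: "has_fourier g h" using has_fourier_exists[OF g] by blast
  note hL = has_fourier_L2(2)[OF h]
  \<comment> \<open>The candidate preimage is the reflected transform, as the inverse transform
    should differ from the transform only by a reflection.\<close>
  define f where "f x = h (- x)" for x
  have fL: "f \<in> L2" unfolding f_def by (rule L2_reflect[OF hL])
  have norm: "l2_norm f = l2_norm g"
    unfolding f_def using l2_norm_reflect[OF hL] has_fourier_norm[OF h] by simp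
  obtain g' where g': "has_fourier f g'" using has_fourier_exists[OF fL] by blast
  note g'L = has_fourier_L2(2)[OF g']
  have "has_fourier (\<lambda>x. cnj (g x)) (\<lambda>x. cnj (f x))"
    using has_fourier_cnj[OF h] by (simp add: f_def)
  \<comment> \<open>The inner product of \<open>g'\<close> with \<open>g\<close> becomes the squared
    norm of \<open>f\<close>. As \<open>f\<close>, \<open>g\<close> and \<open>g'\<close> have equal
    norms, this is equality in Cauchy-Schwarz, and \<open>g'\<close> agrees with
    \<open>g\<close>.\<close>
  from has_fourier_multiplication[OF g' this]
  have "l2_inner g' g = of_real ((l2_norm f)\<^sup>2)" by (simp add: l2_inner_self)
  then have "(l2_norm (\<lambda>x. g' x - g x))\<^sup>2 = 0"
    using l2_norm_diff_squared[OF g'L g] has_fourier_norm[OF g'] norm by simp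
  then have "AE x in lebesgue. g' x = g x" using g'L g by (simp add: l2_norm_diff_eq_0_iff)
  then have "has_fourier f g" by (intro has_fourier_cong_AE[OF g'] fL g) auto
  then show ?thesis by blast
qed

lemma has_fourier_inv_fourier: "g \<in> L2 \<Longrightarrow> has_fourier (inv_fourier g) g"
  unfolding inv_fourier_def by (rule someI_ex[OF has_fourier_inverse_exists])

section \<open>Translations and dilations under the Fourier transform\<close>

lemma L2_translation: "f \<in> L2 \<Longrightarrow> (\<lambda>x. f (x + a)) \<in> L2"
proof -
  assume f: "f \<in> L2"
  then have [measurable]: "f \<in> borel_measurable lebesgue" by (rule L2_measurable)
  have m: "(\<lambda>x. (cmod (f x))\<^sup>2) \<in> borel_measurable lebesgue" by measurable
  have "(\<lambda>x. f (a + x)) \<in> borel_measurable lebesgue"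
    using measurable_compose[OF measurable_translation_lebesgue L2_measurable[OF f]] .
  then show ?thesis unfolding L2_def using integrable_translation[OF m L2_integrable[OF f], of a]
    by (simp add: add.commute)
qed

lemma l2_norm_translation: "f \<in> L2 \<Longrightarrow> l2_norm (\<lambda>x. f (x + a)) = l2_norm f"
  unfolding l2_norm_def
  by (subst integral_translation[of "\<lambda>x. (cmod (f x))\<^sup>2"]) (auto dest: L2_integrable)

lemma
  assumes "f \<in> L2"
  shows L2_wave: "(\<lambda>x. wave t x * f x) \<in> L2" and l2_norm_wave: "l2_norm (\<lambda>x. wave t x * f x) = l2_norm f"
proof -
  have [measurable]: "f \<in> borel_measurable lebesgue" using assms by (rule L2_measurable)
  show "(\<lambda>x. wave t x * f x) \<in> L2"
    by (rule L2_dominated[OF assms]) (auto simp: norm_mult)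
  show "l2_norm (\<lambda>x. wave t x * f x) = l2_norm f" by (simp add: l2_norm_def norm_mult)
qed

lemma fourier_integral_translation:
  assumes "integrable lebesgue f"
  shows "fourier_integral (\<lambda>x. f (x + t)) l = wave t l * fourier_integral f l"
proof -
  have w: "wave t l * cnj (wave l (x + t)) = cnj (wave l x)" for x
  proof -
    have "wave t l * cnj (wave t l) = 1" by (simp add: complex_norm_square[symmetric])
    then show ?thesis by (simp add: wave_add_right wave_commute[of l t] mult_ac)
  qed
  have "fourier_integral (\<lambda>x. f (x + t)) l = (LINT x|lebesgue. wave t l * (f (x + t) * cnj (wave l (x + t))))"
    unfolding fourier_integral_wave by (intro Bochner_Integration.integral_cong refl) (simp add: w mult.left_commute)
  also have "\<dots> = wave t l * (LINT x|lebesgue. f (x + t) * cnj (wave l (x + t)))" by simp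
  also have "(LINT x|lebesgue. f (x + t) * cnj (wave l (x + t))) = fourier_integral f l"
    unfolding fourier_integral_wave using assms
    by (intro integral_translation[of "\<lambda>x. f x * cnj (wave l x)"]) auto
  finally show ?thesis .
qed

lemma has_fourier_translation:
  assumes h: "has_fourier f g" shows "has_fourier (\<lambda>x. f (x + t)) (\<lambda>l. wave t l * g l)"
proof -
  obtain s where s: "\<And>k. s k \<in> L2" "\<And>k. integrable lebesgue (s k)" "\<And>k. fourier_integral (s k) \<in> L2"
    "(\<lambda>k. l2_norm (\<lambda>x. s k x - f x)) \<longlonglongrightarrow> 0" "(\<lambda>k. l2_norm (\<lambda>x. fourier_integral (s k) x - g x)) \<longlonglongrightarrow> 0"
    using h by (rule has_fourierE) blast
  note L = has_fourier_L2[OF h]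
  show ?thesis
  proof (rule has_fourierI[where s = "\<lambda>k x. s k (x + t)"])
    show "(\<lambda>k. l2_norm (\<lambda>x. s k (x + t) - f (x + t))) \<longlonglongrightarrow> 0"
      using s(4) l2_norm_translation[OF L2_diff[OF s(1) L(1)], of _ t] by simp
    have "l2_norm (\<lambda>x. fourier_integral (\<lambda>x. s k (x + t)) x - wave t x * g x) = l2_norm (\<lambda>x. fourier_integral (s k) x - g x)" for k
      using l2_norm_wave[OF L2_diff[OF s(3) L(2)], of t k]
      by (simp add: fourier_integral_translation s(2) right_diff_distrib)
    then show "(\<lambda>k. l2_norm (\<lambda>x. fourier_integral (\<lambda>x. s k (x + t)) x - wave t x * g x)) \<longlonglongrightarrow> 0"
      using s(5) by simp
  qed (use L s in \<open>auto intro: L2_translation L2_wave integrable_translation\<close>)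
qed

lemma inner_transpose: "(transpose M *v y) \<bullet> x = y \<bullet> (M *v x)" for M :: "real^'n^'m"
  by (simp add: transpose_matrix_vector dot_lmul_matrix)

lemma invertible_transpose: "invertible M \<Longrightarrow> invertible (transpose M)" for M :: "real^'n^'n"
  by (simp add: invertible_det_nz det_transpose)

text \<open>The determinant is the Jacobian of \<open>M\<close>; the inverse transpose arises when
  \<open>M\<close> is moved across the inner product in the kernel.\<close>

lemma fourier_integral_matrix:
  fixes M :: "real^'n^'n"
  assumes M: "invertible M" and f: "integrable lebesgue f"
  shows "fourier_integral (\<lambda>x. f (M *v x)) l
    = of_real (1 / \<bar>det M\<bar>) * fourier_integral f (matrix_inv (transpose M) *v l)"
proof -
  let ?l = "matrix_inv (transpose M) *v l"
  have w: "wave l x = wave ?l (M *v x)" for x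
  proof -
    have "x \<bullet> l = (M *v x) \<bullet> ?l"
      using inner_transpose[of M ?l x] unfolding matrix_inv_vec(2)[OF invertible_transpose[OF M]]
      by (simp only: inner_commute)
    then show ?thesis by (simp add: wave_def)
  qed
  have "fourier_integral (\<lambda>x. f (M *v x)) l = (LINT x|lebesgue. f (M *v x) * cnj (wave ?l (M *v x)))"
    by (simp add: fourier_integral_wave w[symmetric])
  also have "\<dots> = (1 / \<bar>det M\<bar>) *\<^sub>R (LINT x|lebesgue. f x * cnj (wave ?l x))"
    using f by (intro integral_matrix[OF M, of "\<lambda>x. f x * cnj (wave ?l x)"]) auto
  finally show ?thesis by (simp add: fourier_integral_wave scaleR_conv_of_real)
qed

lemma has_fourier_matrix:
  fixes M :: "real^'n^'n"
  assumes M: "invertible M" and h: "has_fourier f g"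
  shows "has_fourier (\<lambda>x. f (M *v x)) (\<lambda>l. of_real (1 / \<bar>det M\<bar>) * g (matrix_inv (transpose M) *v l))"
proof -
  obtain s where s: "\<And>k. s k \<in> L2" "\<And>k. integrable lebesgue (s k)" "\<And>k. fourier_integral (s k) \<in> L2"
    "(\<lambda>k. l2_norm (\<lambda>x. s k x - f x)) \<longlonglongrightarrow> 0" "(\<lambda>k. l2_norm (\<lambda>x. fourier_integral (s k) x - g x)) \<longlonglongrightarrow> 0"
    using h by (rule has_fourierE) blast
  note L = has_fourier_L2[OF h]
  let ?N = "matrix_inv (transpose M)" and ?c = "complex_of_real (1 / \<bar>det M\<bar>)"
  have N: "invertible ?N" by (intro invertible_matrix_inv invertible_transpose M)
  show ?thesis
  proof (rule has_fourierI[where s = "\<lambda>k x. s k (M *v x)"])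
    show "(\<lambda>k. l2_norm (\<lambda>x. s k (M *v x) - f (M *v x))) \<longlonglongrightarrow> 0"
      using tendsto_divide[OF s(4) tendsto_const, of "sqrt \<bar>det M\<bar>"] M
      by (simp add: l2_norm_matrix[OF M L2_diff[OF s(1) L(1)], symmetric] invertible_det_nz)
    have "l2_norm (\<lambda>x. fourier_integral (\<lambda>x. s k (M *v x)) x - ?c * g (?N *v x))
        = cmod ?c * (l2_norm (\<lambda>x. fourier_integral (s k) x - g x) / sqrt \<bar>det ?N\<bar>)" for k
    proof -
      have "(\<lambda>x. fourier_integral (\<lambda>x. s k (M *v x)) x - ?c * g (?N *v x))
          = (\<lambda>x. ?c * (fourier_integral (s k) (?N *v x) - g (?N *v x)))"
        by (simp only: fourier_integral_matrix[OF M s(2)] right_diff_distrib)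
      then show ?thesis
        by (simp only: l2_norm_cmult l2_norm_matrix[OF N L2_diff[OF s(3) L(2)]])
    qed
    then show "(\<lambda>k. l2_norm (\<lambda>x. fourier_integral (\<lambda>x. s k (M *v x)) x - ?c * g (?N *v x))) \<longlonglongrightarrow> 0"
      using tendsto_mult[OF tendsto_const tendsto_divide[OF s(5) tendsto_const, of "sqrt \<bar>det ?N\<bar>"], of "cmod ?c"] N
      by (simp add: invertible_det_nz)
    show "integrable lebesgue (\<lambda>x. s k (M *v x))" for k using s(2) by (intro integrable_matrix M) auto
    show "(\<lambda>l. ?c * g (?N *v l)) \<in> L2" using L N by (intro L2_cmult L2_matrix)
  qed (use L s M in \<open>auto intro: L2_matrix\<close>)
qed

section \<open>Unitary relations\<close>

text \<open>A relation instead of a map, because the transform fixes its values only up to null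
  sets. The conditions are symmetric in the two arguments, so every transport result can also be
  read backwards.\<close>

definition l2_unitary :: "((real^'n \<Rightarrow> complex) \<Rightarrow> (real^'n \<Rightarrow> complex) \<Rightarrow> bool) \<Rightarrow> bool" where
  "l2_unitary R \<longleftrightarrow> (\<forall>f g. R f g \<longrightarrow> f \<in> L2 \<and> g \<in> L2 \<and> l2_norm g = l2_norm f)
     \<and> (\<forall>f g f' g'. R f g \<longrightarrow> R f' g' \<longrightarrow> R (\<lambda>x. f x + f' x) (\<lambda>x. g x + g' x))
     \<and> (\<forall>c f g. R f g \<longrightarrow> R (\<lambda>x. c * f x) (\<lambda>x. c * g x))
     \<and> (\<forall>f\<in>L2. \<exists>g. R f g) \<and> (\<forall>g\<in>L2. \<exists>f. R f g)"

lemma l2_unitaryD: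
  assumes "l2_unitary R"
  shows "R f g \<Longrightarrow> f \<in> L2" "R f g \<Longrightarrow> g \<in> L2" "R f g \<Longrightarrow> l2_norm g = l2_norm f"
    "R f g \<Longrightarrow> R f' g' \<Longrightarrow> R (\<lambda>x. f x + f' x) (\<lambda>x. g x + g' x)"
    "R f g \<Longrightarrow> R (\<lambda>x. c * f x) (\<lambda>x. c * g x)"
    "f \<in> L2 \<Longrightarrow> \<exists>g. R f g" "g \<in> L2 \<Longrightarrow> \<exists>f. R f g"
  using assms unfolding l2_unitary_def by blast+

lemma l2_unitary_conversep: "l2_unitary R \<Longrightarrow> l2_unitary (\<lambda>g f. R f g)"
  unfolding l2_unitary_def by simp

lemma l2_unitary_fourier: "l2_unitary has_fourier"
  unfolding l2_unitary_def
  by (intro conjI allI impI ballI;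
    (erule has_fourier_L2 has_fourier_norm has_fourier_cmult has_fourier_exists has_fourier_inverse_exists
      | erule (1) has_fourier_add))

lemma l2_unitary_inner:
  assumes R: "l2_unitary R" and "R f f'" "R g g'" shows "l2_inner f g = l2_inner f' g'"
proof (rule polarization[OF l2_unitaryD(1)[OF R assms(2)] l2_unitaryD(1)[OF R assms(3)]
      l2_unitaryD(2)[OF R assms(2)] l2_unitaryD(2)[OF R assms(3)]])
  fix c
  have "R (\<lambda>x. f x + c * g x) (\<lambda>x. f' x + c * g' x)"
    by (intro l2_unitaryD(4)[OF R] l2_unitaryD(5)[OF R] assms)
  from l2_unitaryD(3)[OF R this]
  show "l2_norm (\<lambda>x. f x + c * g x) = l2_norm (\<lambda>x. f' x + c * g' x)" by simp
qed

lemma l2_unitary_sum: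
  assumes R: "l2_unitary R" and F: "finite F" "\<And>i. i \<in> F \<Longrightarrow> R (f i) (g i)"
  shows "R (\<lambda>x. \<Sum>i\<in>F. f i x) (\<lambda>x. \<Sum>i\<in>F. g i x)"
  using F
proof (induction F rule: finite_induct)
  case empty
  \<comment> \<open>That 0 is related to 0 follows from totality and homogeneity: some value exists,
    and scaling by 0 makes it vanish.\<close>
  obtain g where "R (\<lambda>x. 0) g" using l2_unitaryD(6)[OF R L2_zero] by blast
  from l2_unitaryD(5)[OF R this, of 0] show ?case by simp
next
  case (insert i F)
  then show ?case by (simp add: l2_unitaryD(4)[OF R])
qed

lemma l2_unitary_closure_span:
  assumes R: "l2_unitary R" and b: "\<And>i. i \<in> I \<Longrightarrow> R (b i) (b' i)"
    and f: "f \<in> l2_closure (l2_span I b)" and g: "R f g"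
  shows "g \<in> l2_closure (l2_span I b')"
proof -
  have V: "l2_span I b \<subseteq> L2" "l2_span I b' \<subseteq> L2"
    by (rule l2_span_subset_L2; erule b[THEN l2_unitaryD(1)[OF R]] b[THEN l2_unitaryD(2)[OF R]])+
  show ?thesis unfolding l2_closure_iff[OF V(2)]
  proof safe
    show "g \<in> L2" using l2_unitaryD(2)[OF R g] .
    fix e :: real assume "0 < e"
    then obtain p where p: "p \<in> l2_span I b" "l2_norm (\<lambda>x. f x - p x) < e"
      using f unfolding l2_closure_iff[OF V(1)] by blast
    then obtain F c where F: "finite F" "F \<subseteq> I" "p = (\<lambda>x. \<Sum>i\<in>F. c i * b i x)"
      unfolding l2_span_def by blast
    define p' where "p' = (\<lambda>x. \<Sum>i\<in>F. c i * b' i x)"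
    have "R p p'" unfolding F(3) p'_def
      by (intro l2_unitary_sum[OF R F(1)] l2_unitaryD(5)[OF R] b) (use F(2) in auto)
    from l2_unitaryD(4)[OF R g l2_unitaryD(5)[OF R this, of "-1"]]
    have "R (\<lambda>x. f x - p x) (\<lambda>x. g x - p' x)" by simp
    from l2_unitaryD(3)[OF R this] p(2) have "l2_norm (\<lambda>x. g x - p' x) < e" by simp
    moreover have "p' \<in> l2_span I b'" unfolding l2_span_def p'_def using F by blast
    ultimately show "\<exists>h\<in>l2_span I b'. l2_norm (\<lambda>x. g x - h x) < e" by blast
  qed
qed

text \<open>Surjectivity serves the reverse inclusion: a limit of combinations on the image side has
  a preimage, and the converse relation puts that preimage back into \<open>V\<close>.\<close>

lemma l2_unitary_orthonormal_basis:
  assumes R: "l2_unitary R" and b: "\<And>i. i \<in> I \<Longrightarrow> R (b i) (b' i)" and V: "l2_orthonormal_basis I b V"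
  shows "l2_orthonormal_basis I b' {g. \<exists>f\<in>V. R f g}"
  unfolding l2_orthonormal_basis_def
proof (intro conjI ballI)
  show "b' i \<in> L2" if "i \<in> I" for i by (rule l2_unitaryD(2)[OF R b[OF that]])
  show "l2_inner (b' i) (b' j) = (if i = j then 1 else 0)" if "i \<in> I" "j \<in> I" for i j
    using V that l2_unitary_inner[OF R b[OF that(1)] b[OF that(2)]]
    by (simp add: l2_orthonormal_basis_def)
  have Veq: "V = l2_closure (l2_span I b)" using V by (simp add: l2_orthonormal_basis_def)
  show "{g. \<exists>f\<in>V. R f g} = l2_closure (l2_span I b')"
  proof safe
    fix f g assume f: "f \<in> V" and g: "R f g"
    show "g \<in> l2_closure (l2_span I b')" by (rule l2_unitary_closure_span[OF R b f[unfolded Veq] g])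
  next
    fix g assume g: "g \<in> l2_closure (l2_span I b')"
    then have "g \<in> L2" using l2_closure_subset_L2 by blast
    then obtain f where f: "R f g" using l2_unitaryD(7)[OF R] by blast
    have "f \<in> V" unfolding Veq
      by (rule l2_unitary_closure_span[OF l2_unitary_conversep[OF R] b g f])
    with f show "\<exists>f\<in>V. R f g" by blast
  qed
qed

text \<open>The square root of the determinant is the factor that makes the dilation an
  isometry.\<close>

definition dilate :: "real^'n^'n \<Rightarrow> (real^'n \<Rightarrow> complex) \<Rightarrow> real^'n \<Rightarrow> complex" where
  "dilate M f x = of_real (sqrt \<bar>det M\<bar>) * f (M *v x)"

lemma l2_unitary_dilate:
  fixes M :: "real^'n^'n"
  assumes M: "invertible M" shows "l2_unitary (\<lambda>f g. f \<in> L2 \<and> g = dilate M f)"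
  unfolding l2_unitary_def
proof (intro conjI allI impI ballI)
  have d: "det M \<noteq> 0" using M by (simp add: invertible_det_nz)
  fix f g
  assume fg: "f \<in> L2 \<and> g = dilate M f"
  then have g: "g = (\<lambda>x. of_real (sqrt \<bar>det M\<bar>) * f (M *v x))" by (simp add: dilate_def fun_eq_iff)
  show "f \<in> L2" using fg by simp
  show "g \<in> L2" unfolding g using fg by (intro L2_cmult L2_matrix M) simp
  show "l2_norm g = l2_norm f" unfolding g l2_norm_cmult using fg d by (simp add: l2_norm_matrix[OF M])
next
  fix g :: "real^'n \<Rightarrow> complex" assume g: "g \<in> L2"
  have d: "det M \<noteq> 0" using M by (simp add: invertible_det_nz)
  let ?f = "\<lambda>x. of_real (1 / sqrt \<bar>det M\<bar>) * g (matrix_inv M *v x)"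
  have "?f \<in> L2" using g by (intro L2_cmult L2_matrix invertible_matrix_inv M)
  moreover have "g = dilate M ?f" using d M by (simp add: dilate_def fun_eq_iff flip: of_real_mult)
  ultimately show "\<exists>f. f \<in> L2 \<and> g = dilate M f" by blast
qed (auto simp: dilate_def fun_eq_iff algebra_simps)

section \<open>Tilings by translates\<close>

definition additive_subgroup :: "'a::ab_group_add set \<Rightarrow> bool" where
  "additive_subgroup T \<longleftrightarrow> 0 \<in> T \<and> (\<forall>s\<in>T. \<forall>t\<in>T. s - t \<in> T)"

lemma additive_subgroupD:
  assumes "additive_subgroup T"
  shows "0 \<in> T" "s \<in> T \<Longrightarrow> - s \<in> T" "s \<in> T \<Longrightarrow> t \<in> T \<Longrightarrow> s + t \<in> T" "s \<in> T \<Longrightarrow> t \<in> T \<Longrightarrow> s - t \<in> T"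
proof -
  show 0: "0 \<in> T" and d: "s \<in> T \<Longrightarrow> t \<in> T \<Longrightarrow> s - t \<in> T" for s t
    using assms by (auto simp: additive_subgroup_def)
  show m: "s \<in> T \<Longrightarrow> - s \<in> T" for s using d[OF 0, of s] by simp
  show "s \<in> T \<Longrightarrow> t \<in> T \<Longrightarrow> s + t \<in> T" using d[of s "- t"] m[of t] by simp
qed

definition tiles :: "'a::euclidean_space set \<Rightarrow> 'a set \<Rightarrow> bool" where
  "tiles T K \<longleftrightarrow> (AE x in lebesgue. \<exists>!s. s \<in> T \<and> x + s \<in> K)"

lemma AE_all_translates:
  assumes "countable T" "AE x in lebesgue. P (x :: 'a::euclidean_space)"
  shows "AE x in lebesgue. \<forall>s\<in>T. P (x + s)"
  unfolding AE_ball_countable[OF assms(1)] using AE_translation[OF assms(2)] by blast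

text \<open>Sums over a lattice are written as integrals over counting measure so that Tonelli
  applies. Monotone convergence along an enumeration of \<open>T\<close> reduces them to finite
  sums.\<close>

lemma nn_integral_count_space_bound:
  fixes f :: "'i \<Rightarrow> ennreal"
  assumes T: "countable T" and le: "\<And>F. finite F \<Longrightarrow> F \<subseteq> T \<Longrightarrow> sum f F \<le> C"
  shows "(\<integral>\<^sup>+t. f t \<partial>count_space T) \<le> C"
proof -
  let ?F = "\<lambda>n. {t\<in>T. to_nat_on T t < n}"
  have fin: "finite (?F n)" for n
    by (rule finite_imageD[of "to_nat_on T"])
      (auto intro: finite_subset[of _ "{..<n}"] inj_on_subset[OF inj_on_to_nat_on[OF T]])
  have "(\<integral>\<^sup>+t. f t \<partial>count_space T) = (\<integral>\<^sup>+t. (SUP n. f t * indicator (?F n) t) \<partial>count_space T)"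
  proof (rule nn_integral_cong)
    fix t assume "t \<in> space (count_space T)"
    then have "t \<in> ?F (Suc (to_nat_on T t))" by simp
    then show "f t = (SUP n. f t * indicator (?F n) t)"
      by (intro antisym SUP_upper2[of "Suc (to_nat_on T t)"] SUP_least) (auto simp: indicator_def)
  qed
  also have "\<dots> = (SUP n. \<integral>\<^sup>+t. f t * indicator (?F n) t \<partial>count_space T)"
    by (rule nn_integral_monotone_convergence_SUP) (auto simp: incseq_def le_fun_def indicator_def)
  also have "\<dots> \<le> C"
  proof (rule SUP_least)
    fix n
    have "(\<integral>\<^sup>+t. f t * indicator (?F n) t \<partial>count_space T) = (\<Sum>t\<in>?F n. f t * indicator (?F n) t)"
      by (rule nn_integral_count_space'[OF fin]) auto
    also have "\<dots> = sum f (?F n)" by (intro sum.cong) auto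
    also have "\<dots> \<le> C" by (rule le[OF fin]) auto
    finally show "(\<integral>\<^sup>+t. f t * indicator (?F n) t \<partial>count_space T) \<le> C" .
  qed
  finally show ?thesis .
qed

lemma nn_integral_count_space_Ex1:
  assumes "\<exists>!s. s \<in> T \<and> P s"
  shows "(\<integral>\<^sup>+s. (if P s then 1 else 0) \<partial>count_space T) = (1::ennreal)"
proof -
  obtain s where s: "s \<in> T" "P s" "\<And>u. u \<in> T \<Longrightarrow> P u \<Longrightarrow> u = s" using assms by blast
  have "(\<integral>\<^sup>+s. (if P s then 1 else 0) \<partial>count_space T) = (\<Sum>s\<in>{s}. (if P s then 1 else 0) :: ennreal)"
  proof (rule nn_integral_count_space')
    show "(if P u then 1 else 0) = (0::ennreal)" if "u \<in> T" "u \<notin> {s}" for u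
      using s(3)[of u] that by auto
  qed (use s(1) in auto)
  then show ?thesis using s(2) by simp
qed

lemma measurable_translation_compose:
  fixes f :: "'a::euclidean_space \<Rightarrow> 'b"
  assumes "f \<in> measurable lebesgue M"
  shows "(\<lambda>x. f (x + a)) \<in> measurable lebesgue M" "(\<lambda>x. f (x - a)) \<in> measurable lebesgue M"
  using measurable_compose[OF measurable_translation_lebesgue assms, of a]
    measurable_compose[OF measurable_translation_lebesgue assms, of "- a"] by (simp_all add: add.commute)

text \<open>Since \<open>K\<close> tiles, the number of \<open>s\<close> in \<open>T\<close> with
  \<open>x + s\<close> in \<open>K\<close> is almost everywhere 1. Inserting this count,
  interchanging sum and integral and translating by \<open>s\<close> folds the whole space onto
  \<open>K\<close>.\<close>

lemma nn_integral_periodize: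
  fixes g :: "'a::euclidean_space \<Rightarrow> ennreal"
  assumes T: "countable T" and tiles: "tiles T K" and [measurable]: "K \<in> sets lebesgue" "g \<in> borel_measurable lebesgue"
  shows "(\<integral>\<^sup>+x. g x \<partial>lebesgue) = (\<integral>\<^sup>+x. indicator K x * (\<integral>\<^sup>+s. g (x - s) \<partial>count_space T) \<partial>lebesgue)"
proof -
  have Km: "(indicator K :: 'a \<Rightarrow> ennreal) \<in> borel_measurable lebesgue" by measurable
  note [measurable] = measurable_translation_compose[OF Km] measurable_translation_compose[OF assms(4)]
  have "(\<integral>\<^sup>+x. g x \<partial>lebesgue) = (\<integral>\<^sup>+x. (\<integral>\<^sup>+s. g x * indicator K (x + s) \<partial>count_space T) \<partial>lebesgue)"
  proof (rule nn_integral_cong_AE)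
    show "AE x in lebesgue. g x = (\<integral>\<^sup>+s. g x * indicator K (x + s) \<partial>count_space T)"
      using tiles unfolding tiles_def
    proof eventually_elim
      case (elim x)
      have "(\<integral>\<^sup>+s. g x * indicator K (x + s) \<partial>count_space T) = g x * (\<integral>\<^sup>+s. indicator K (x + s) \<partial>count_space T)"
        by (rule nn_integral_cmult) simp
      also have "(\<integral>\<^sup>+s. indicator K (x + s) \<partial>count_space T) = (\<integral>\<^sup>+s. (if x + s \<in> K then 1 else 0) \<partial>count_space T)"
        by (intro nn_integral_cong) (auto simp: indicator_def)
      also have "\<dots> = 1" by (rule nn_integral_count_space_Ex1[OF elim])
      finally show ?case by simp
    qed
  qed
  also have "\<dots> = (\<integral>\<^sup>+s. (\<integral>\<^sup>+x. g x * indicator K (x + s) \<partial>lebesgue) \<partial>count_space T)"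
    by (rule nn_integral_count_space_nn_integral[OF T]) measurable
  also have "\<dots> = (\<integral>\<^sup>+s. (\<integral>\<^sup>+x. g (x - s) * indicator K x \<partial>lebesgue) \<partial>count_space T)"
  proof (rule nn_integral_cong)
    fix s
    have "(\<lambda>x. g (x - s) * indicator K x) \<in> borel_measurable lebesgue" by measurable
    from nn_integral_translation[OF this, of s]
    show "(\<integral>\<^sup>+x. g x * indicator K (x + s) \<partial>lebesgue) = (\<integral>\<^sup>+x. g (x - s) * indicator K x \<partial>lebesgue)" by simp
  qed
  also have "\<dots> = (\<integral>\<^sup>+x. (\<integral>\<^sup>+s. g (x - s) * indicator K x \<partial>count_space T) \<partial>lebesgue)"
    by (rule nn_integral_count_space_nn_integral[OF T, symmetric]) measurable
  also have "\<dots> = (\<integral>\<^sup>+x. indicator K x * (\<integral>\<^sup>+s. g (x - s) \<partial>count_space T) \<partial>lebesgue)"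
  proof (rule nn_integral_cong)
    fix x
    have "(\<integral>\<^sup>+s. g (x - s) * indicator K x \<partial>count_space T) = (\<integral>\<^sup>+s. g (x - s) \<partial>count_space T) * indicator K x"
      by (rule nn_integral_multc) simp
    then show "(\<integral>\<^sup>+s. g (x - s) * indicator K x \<partial>count_space T) = indicator K x * (\<integral>\<^sup>+s. g (x - s) \<partial>count_space T)"
      by (simp only: mult.commute)
  qed
  finally show ?thesis .
qed

text \<open>Reconciles signs: \<open>tiles\<close> adds the lattice vector, whereas folding
  subtracts it.\<close>

lemma Ex1_subgroup_minus:
  assumes "additive_subgroup T" "\<exists>!s. s \<in> T \<and> P s" shows "\<exists>!s. s \<in> T \<and> P (- s)"
proof -
  obtain s where s: "s \<in> T" "P s" "\<And>u. u \<in> T \<Longrightarrow> P u \<Longrightarrow> u = s" using assms(2) by blast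
  show ?thesis
  proof (rule ex1I[of _ "- s"])
    show "- s \<in> T \<and> P (- (- s))" using s(1,2) additive_subgroupD(2)[OF assms(1)] by simp
    show "u = - s" if "u \<in> T \<and> P (- u)" for u
    proof -
      have "- u = s" using that additive_subgroupD(2)[OF assms(1), of u] by (intro s(3)) auto
      then show ?thesis by auto
    qed
  qed
qed

text \<open>Folding onto \<open>K'\<close> leaves \<open>h\<close> unchanged by periodicity, and the
  folded indicator of \<open>K\<close> is 1 because \<open>K\<close> tiles.\<close>

lemma nn_integral_periodic_tiles:
  fixes h :: "'a::euclidean_space \<Rightarrow> ennreal"
  assumes T: "countable T" "additive_subgroup T"
    and K: "tiles T K" "K \<in> sets lebesgue" and K': "tiles T K'" "K' \<in> sets lebesgue"
    and h: "h \<in> borel_measurable lebesgue" "\<And>s x. s \<in> T \<Longrightarrow> h (x + s) = h x"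
  shows "(\<integral>\<^sup>+x. h x * indicator K x \<partial>lebesgue) = (\<integral>\<^sup>+x. h x * indicator K' x \<partial>lebesgue)"
proof -
  note [measurable] = h(1) K(2) K'(2)
  have "(\<integral>\<^sup>+x. h x * indicator K x \<partial>lebesgue)
      = (\<integral>\<^sup>+x. indicator K' x * (\<integral>\<^sup>+s. h (x - s) * indicator K (x - s) \<partial>count_space T) \<partial>lebesgue)"
    by (rule nn_integral_periodize[OF T(1) K'(1,2)]) measurable
  also have "\<dots> = (\<integral>\<^sup>+x. h x * indicator K' x \<partial>lebesgue)"
  proof (rule nn_integral_cong_AE, use K(1)[unfolded tiles_def] in eventually_elim)
    case (elim x)
    have "(\<integral>\<^sup>+s. h (x - s) * indicator K (x - s) \<partial>count_space T)
        = (\<integral>\<^sup>+s. h x * (if x + - s \<in> K then 1 else 0) \<partial>count_space T)"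
    proof (rule nn_integral_cong)
      fix s assume "s \<in> space (count_space T)"
      then have "h (x + - s) = h x" by (intro h(2) additive_subgroupD(2)[OF T(2)]) simp
      then show "h (x - s) * indicator K (x - s) = h x * (if x + - s \<in> K then 1 else 0)" by simp
    qed
    also have "\<dots> = h x * (\<integral>\<^sup>+s. (if x + - s \<in> K then 1 else 0) \<partial>count_space T)"
      by (rule nn_integral_cmult) simp
    also have "(\<integral>\<^sup>+s. (if x + - s \<in> K then 1 else 0) \<partial>count_space T) = (1 :: ennreal)"
      by (rule nn_integral_count_space_Ex1, rule Ex1_subgroup_minus[OF T(2) elim])
    finally show ?case by (simp add: mult.commute)
  qed
  finally show ?thesis .
qed

lemma emeasure_tiles_eq:
  fixes K K' :: "'a::euclidean_space set"
  assumes "countable T" "additive_subgroup T" "tiles T K" "K \<in> sets lebesgue" "tiles T K'" "K' \<in> sets lebesgue"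
  shows "emeasure lebesgue K = emeasure lebesgue K'"
  using nn_integral_periodic_tiles[OF assms, of "\<lambda>_. 1"] assms by simp

lemma
  fixes p :: "real^'n \<Rightarrow> complex"
  assumes T: "countable T" "additive_subgroup T"
    and K: "tiles T K" "K \<in> sets lebesgue" and K': "tiles T K'" "K' \<in> sets lebesgue"
    and p: "p \<in> borel_measurable lebesgue" "\<And>s x. s \<in> T \<Longrightarrow> p (x + s) = p x"
    and L: "(\<lambda>x. p x * indicator K x) \<in> L2"
  shows L2_periodic_tiles: "(\<lambda>x. p x * indicator K' x) \<in> L2"
    and l2_norm_periodic_tiles: "l2_norm (\<lambda>x. p x * indicator K' x) = l2_norm (\<lambda>x. p x * indicator K x)"
proof -
  note [measurable] = p(1) K(2) K'(2)
  have eq: "ennreal ((cmod (p x * indicator S x))\<^sup>2) = ennreal ((cmod (p x))\<^sup>2) * indicator S x" for S x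
    by (auto simp: indicator_def)
  have nn: "(\<integral>\<^sup>+x. ennreal ((cmod (p x * indicator K x))\<^sup>2) \<partial>lebesgue)
      = (\<integral>\<^sup>+x. ennreal ((cmod (p x * indicator K' x))\<^sup>2) \<partial>lebesgue)"
    unfolding eq by (rule nn_integral_periodic_tiles[OF T K K']) (auto simp: p(2))
  show L': "(\<lambda>x. p x * indicator K' x) \<in> L2"
    using L nn unfolding L2_iff_nn_integral by simp
  have "(l2_norm (\<lambda>x. p x * indicator K x))\<^sup>2 = (l2_norm (\<lambda>x. p x * indicator K' x))\<^sup>2"
    using nn unfolding nn_integral_l2_norm[OF L] nn_integral_l2_norm[OF L'] by simp
  then show "l2_norm (\<lambda>x. p x * indicator K' x) = l2_norm (\<lambda>x. p x * indicator K x)" by simp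
qed

section \<open>Exponential bases on tiles\<close>

lemma wave_periodic: "s \<bullet> t \<in> \<int> \<Longrightarrow> wave t (x + s) = wave t x"
  by (simp add: wave_add_right wave_int)

text \<open>The value at \<open>x\<close> is that of \<open>g\<close> at the representative of
  \<open>x\<close> in \<open>K\<close>. Measurability holds because the translation vector leading
  there takes countably many values, each on a measurable set.\<close>

lemma periodic_extension:
  fixes g :: "real^'n \<Rightarrow> complex"
  assumes T: "countable T" "additive_subgroup T" and K: "tiles T K" "K \<in> sets lebesgue"
    and g: "g \<in> L2_on K"
  obtains p where "p \<in> borel_measurable lebesgue" "\<And>s x. s \<in> T \<Longrightarrow> p (x + s) = p x"
    "AE x in lebesgue. p x * indicator K x = g x"
proof -
  define E where "E = {x. \<exists>!s. s \<in> T \<and> x + s \<in> K}"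
  \<comment> \<open>The default 0 belongs to \<open>T\<close>, so \<open>\<sigma>\<close> is
    everywhere a map into the countable set \<open>T\<close>.\<close>
  define \<sigma> where "\<sigma> x = (if x \<in> E then THE s. s \<in> T \<and> x + s \<in> K else 0)" for x
  define p where "p x = (if x \<in> E then g (x + \<sigma> x) else 0)" for x
  have \<sigma>: "\<sigma> x \<in> T \<and> x + \<sigma> x \<in> K" if "x \<in> E" for x
    using theI'[of "\<lambda>s. s \<in> T \<and> x + s \<in> K"] that by (auto simp: \<sigma>_def E_def)
  have \<sigma>_eq: "\<sigma> x = s" if "x \<in> E" "s \<in> T" "x + s \<in> K" for x s
    using \<sigma>[OF that(1)] that by (auto simp: E_def)
  have Km: "{x. x + s \<in> K} \<in> sets lebesgue" for s
    using measurable_sets[OF measurable_translation_lebesgue K(2), of s] by (simp add: vimage_def add.commute)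
  have E_eq: "E = (\<Union>s\<in>T. {x. x + s \<in> K} - (\<Union>u\<in>T - {s}. {x. x + u \<in> K}))"
    by (auto simp: E_def)
  have E: "E \<in> sets lebesgue"
    unfolding E_eq using T(1) Km by (intro sets.countable_UN' sets.Diff) auto
  have "\<sigma> \<in> measurable lebesgue (count_space T)"
    unfolding measurable_count_space_eq_countable[OF T(1)]
  proof (intro conjI ballI)
    show "\<sigma> \<in> space lebesgue \<rightarrow> T"
      using \<sigma> additive_subgroupD(1)[OF T(2)] by (auto simp: \<sigma>_def)
    fix a assume "a \<in> T"
    have "\<sigma> -` {a} = (E \<inter> {x. x + a \<in> K}) \<union> (if a = 0 then - E else {})"
    proof (rule set_eqI)
      fix x
      show "x \<in> \<sigma> -` {a} \<longleftrightarrow> x \<in> (E \<inter> {x. x + a \<in> K}) \<union> (if a = 0 then - E else {})"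
      proof (cases "x \<in> E")
        case True
        have "\<sigma> x = a \<longleftrightarrow> x + a \<in> K" using \<sigma>[OF True] \<sigma>_eq[OF True \<open>a \<in> T\<close>] by blast
        with True show ?thesis by simp
      next
        case False
        then show ?thesis by (auto simp: \<sigma>_def)
      qed
    qed
    then show "\<sigma> -` {a} \<inter> space lebesgue \<in> sets lebesgue"
      using E Km K(2) by (auto simp: Compl_in_sets_lebesgue)
  qed
  moreover have "(\<lambda>x. g (x + s)) \<in> borel_measurable lebesgue" for s
    using g by (intro measurable_translation_compose L2_measurable) (simp add: L2_on_def)
  ultimately have "(\<lambda>x. g (x + \<sigma> x)) \<in> borel_measurable lebesgue"
    by (intro measurable_compose_countable'[where f = "\<lambda>s x. g (x + s)" and g = \<sigma>, OF _ _ T(1)])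
  then have "p \<in> borel_measurable lebesgue"
    unfolding p_def using E by measurable
  moreover have "p (x + s) = p x" if s: "s \<in> T" for s x
  proof -
    \<comment> \<open>Invariance of \<open>E\<close> under \<open>T\<close>, together with the value
      0 of \<open>p\<close> outside \<open>E\<close>, makes the periodicity hold at every point and
      not just almost everywhere.\<close>
    have E_shift: "x + s \<in> E" if "x \<in> E" "s \<in> T" for x s
    proof -
      have "\<exists>!u. u \<in> T \<and> x + s + u \<in> K"
      proof (rule ex1I[of _ "\<sigma> x - s"])
        show "\<sigma> x - s \<in> T \<and> x + s + (\<sigma> x - s) \<in> K"
          using \<sigma>[OF that(1)] that(2) additive_subgroupD(4)[OF T(2)] by simp
        show "u = \<sigma> x - s" if u: "u \<in> T \<and> x + s + u \<in> K" for u
          using \<sigma>_eq[OF \<open>x \<in> E\<close>, of "s + u"] u additive_subgroupD(3)[OF T(2) \<open>s \<in> T\<close>] by (simp add: add.assoc)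
      qed
      then show ?thesis by (simp add: E_def)
    qed
    show ?thesis
    proof (cases "x \<in> E")
      case True
      have "\<sigma> (x + s) = \<sigma> x - s"
        using \<sigma>[OF True] additive_subgroupD(4)[OF T(2), of "\<sigma> x" s] s
        by (intro \<sigma>_eq[OF E_shift[OF True s]]) auto
      then show ?thesis using True E_shift[OF True s] by (simp add: p_def)
    next
      case False
      then have "x + s \<notin> E" using E_shift[of "x + s" "- s"] additive_subgroupD(2)[OF T(2) s] by auto
      then show ?thesis using False by (simp add: p_def)
    qed
  qed
  moreover have "AE x in lebesgue. p x * indicator K x = g x"
  proof -
    have "AE x in lebesgue. x \<notin> K \<longrightarrow> g x = 0" using g by (simp add: L2_on_def)
    moreover have "AE x in lebesgue. x \<in> E" using K(1) by (simp add: tiles_def E_def)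
    ultimately show ?thesis
    proof eventually_elim
      case (elim x)
      then show ?case using \<sigma>_eq[of x 0] additive_subgroupD(1)[OF T(2)]
        by (cases "x \<in> K") (auto simp: p_def)
    qed
  qed
  ultimately show ?thesis by (rule that)
qed

lemma sum_mult_indicator: "(\<Sum>i\<in>F. c i * (w i x * indicator K x)) = (\<Sum>i\<in>F. c i * w i x) * (indicator K x :: complex)"
  by (simp add: sum_distrib_right mult.assoc)

lemma wave_indicator_L2_on:
  fixes K :: "(real^'n) set"
  assumes "K \<in> lmeasurable" shows "(\<lambda>x. wave t x * indicator K x) \<in> L2_on K"
  using L2_wave[OF L2_indicator[OF assms], of t] by (auto simp: L2_on_def)

lemma wave_indicator_L2:
  fixes K :: "(real^'n) set"
  assumes "K \<in> lmeasurable" shows "(\<lambda>x. wave t x * indicator K x) \<in> L2"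
  using wave_indicator_L2_on[OF assms] by (auto simp: L2_on_def)

text \<open>Any combination of the exponentials is \<open>T\<close>-periodic and so has the same
  norm over either tile. Polarization transports orthonormality. For completeness, the coefficients
  that approximate on \<open>K\<close> approximate equally well on \<open>K'\<close>.\<close>

lemma orthonormal_waves_tiles:
  fixes K K' :: "(real^'n) set"
  assumes T: "countable T" "additive_subgroup T"
    and K: "tiles T K" "K \<in> lmeasurable" and K': "tiles T K'" "K' \<in> sets lebesgue"
    and D: "\<And>s t. s \<in> T \<Longrightarrow> t \<in> D \<Longrightarrow> s \<bullet> t \<in> \<int>"
    and onb: "l2_orthonormal_basis D (\<lambda>t x. wave t x * indicator K x) (L2_on K)"
  shows "l2_orthonormal_basis D (\<lambda>t x. wave t x * indicator K' x) (L2_on K')"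
proof -
  have Ks: "K \<in> sets lebesgue" using K(2) by auto
  have "emeasure lebesgue K' = emeasure lebesgue K" by (rule emeasure_tiles_eq[OF T K' K(1) Ks])
  then have K'm: "K' \<in> lmeasurable" using K(2) K'(2) by (auto simp: fmeasurable_def)
  have per: "(\<Sum>t\<in>F. c t * wave t (x + s)) = (\<Sum>t\<in>F. c t * wave t x)" if "F \<subseteq> D" "s \<in> T" for F c s x
    using that D by (intro sum.cong refl) (auto simp: wave_periodic)
  have wm: "(\<lambda>x. \<Sum>t\<in>F. c t * wave t x) \<in> borel_measurable lebesgue" for F c by measurable
  have span_L2: "(\<lambda>x. (\<Sum>t\<in>F. c t * wave t x) * indicator S x) \<in> L2" if "S \<in> lmeasurable" for F c and S :: "(real^'n) set"
  proof -
    have "(\<lambda>x. \<Sum>t\<in>F. c t * (wave t x * indicator S x)) \<in> L2"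
      by (intro L2_sum L2_cmult wave_indicator_L2 that)
    then show ?thesis by (simp only: sum_mult_indicator)
  qed
  show ?thesis
    unfolding l2_orthonormal_basis_def
  proof (intro conjI ballI)
    fix t assume t: "t \<in> D"
    show "(\<lambda>x. wave t x * indicator K' x) \<in> L2" by (rule wave_indicator_L2[OF K'm])
    fix u assume u: "u \<in> D"
    have "l2_inner (\<lambda>x. wave t x * indicator K' x) (\<lambda>x. wave u x * indicator K' x)
        = l2_inner (\<lambda>x. wave t x * indicator K x) (\<lambda>x. wave u x * indicator K x)"
    proof (rule polarization)
      fix c
      have L: "(\<lambda>x. (wave t x + c * wave u x) * indicator K x) \<in> L2"
        using L2_add[OF wave_indicator_L2[OF K(2)] L2_cmult[OF wave_indicator_L2[OF K(2)]], of t c u]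
        by (simp add: algebra_simps)
      have "l2_norm (\<lambda>x. (wave t x + c * wave u x) * indicator K' x) = l2_norm (\<lambda>x. (wave t x + c * wave u x) * indicator K x)"
        by (rule l2_norm_periodic_tiles[OF T K(1) Ks K' _ _ L]) (auto simp: wave_periodic D t u)
      then show "l2_norm (\<lambda>x. wave t x * indicator K' x + c * (wave u x * indicator K' x))
          = l2_norm (\<lambda>x. wave t x * indicator K x + c * (wave u x * indicator K x))"
        by (simp add: algebra_simps)
    qed (rule wave_indicator_L2[OF K'm] wave_indicator_L2[OF K(2)])+
    then show "l2_inner (\<lambda>x. wave t x * indicator K' x) (\<lambda>x. wave u x * indicator K' x) = (if t = u then 1 else 0)"
      using onb t u by (simp add: l2_orthonormal_basis_def)
  next
    let ?V = "l2_span D (\<lambda>t x. wave t x * indicator K x)" and ?V' = "l2_span D (\<lambda>t x. wave t x * indicator K' x)"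
    have V: "?V \<subseteq> L2" by (intro l2_span_subset_L2 wave_indicator_L2 K(2))
    have V': "?V' \<subseteq> L2" by (intro l2_span_subset_L2 wave_indicator_L2 K'm)
    show "L2_on K' = l2_closure ?V'"
    proof
      show "l2_closure ?V' \<subseteq> L2_on K'"
        by (intro l2_closure_subset_L2_on K' l2_span_subset_L2_on wave_indicator_L2_on K'm)
      show "L2_on K' \<subseteq> l2_closure ?V'"
      proof
        fix g assume g: "g \<in> L2_on K'"
        \<comment> \<open>The periodic extension provides the counterpart on \<open>K\<close> of the
          given function on \<open>K'\<close>.\<close>
        obtain p where p: "p \<in> borel_measurable lebesgue" "\<And>s x. s \<in> T \<Longrightarrow> p (x + s) = p x"
          "AE x in lebesgue. p x * indicator K' x = g x"
          using periodic_extension[OF T K' g] by blast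
        have gL: "g \<in> L2" using g by (simp add: L2_on_def)
        note [measurable] = p(1) K'(2) Ks
        have pK'm: "(\<lambda>x. p x * indicator K' x) \<in> borel_measurable lebesgue" by measurable
        have pK': "(\<lambda>x. p x * indicator K' x) \<in> L2"
          by (rule L2_dominated[OF gL pK'm]) (use p(3) in eventually_elim, simp)
        have pK: "(\<lambda>x. p x * indicator K x) \<in> L2"
          by (rule L2_periodic_tiles[OF T K' K(1) Ks p(1,2) pK'])
        then have "(\<lambda>x. p x * indicator K x) \<in> L2_on K" by (simp add: L2_on_def)
        then have cl: "(\<lambda>x. p x * indicator K x) \<in> l2_closure ?V"
          using onb by (simp add: l2_orthonormal_basis_def)
        show "g \<in> l2_closure ?V'"
          unfolding l2_closure_iff[OF V']
        proof (intro conjI gL allI impI)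
          fix e :: real assume "0 < e"
          then obtain h where "h \<in> ?V" and h: "l2_norm (\<lambda>x. p x * indicator K x - h x) < e"
            using cl unfolding l2_closure_iff[OF V] by blast
          then obtain F c where F: "finite F" "F \<subseteq> D" "h = (\<lambda>x. \<Sum>t\<in>F. c t * (wave t x * indicator K x))"
            unfolding l2_span_def by blast
          define w where "w x = (\<Sum>t\<in>F. c t * wave t x)" for x
          have wm' [measurable]: "w \<in> borel_measurable lebesgue" unfolding w_def by (rule wm)
          have pw: "(p (x + s) - w (x + s)) = p x - w x" if "s \<in> T" for s x
            using that by (simp add: w_def per[OF F(2)] p(2))
          have hL: "(\<lambda>x. w x * indicator K x) \<in> L2" unfolding w_def by (rule span_L2[OF K(2)])
          have L: "(\<lambda>x. (p x - w x) * indicator K x) \<in> L2"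
            using L2_diff[OF pK hL] by (simp add: left_diff_distrib)
          have "l2_norm (\<lambda>x. g x - w x * indicator K' x) = l2_norm (\<lambda>x. (p x - w x) * indicator K' x)"
          proof (rule l2_norm_cong_AE)
            show "AE x in lebesgue. g x - w x * indicator K' x = (p x - w x) * indicator K' x"
              using p(3) by eventually_elim (simp add: left_diff_distrib)
            show "(\<lambda>x. g x - w x * indicator K' x) \<in> borel_measurable lebesgue"
              using L2_measurable[OF gL] by measurable
          qed measurable
          also have "\<dots> = l2_norm (\<lambda>x. (p x - w x) * indicator K x)"
            by (rule l2_norm_periodic_tiles[OF T K(1) Ks K' _ pw L]) measurable
          also have "\<dots> = l2_norm (\<lambda>x. p x * indicator K x - h x)"
            by (simp add: F(3) sum_mult_indicator w_def left_diff_distrib)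
          finally have "l2_norm (\<lambda>x. g x - w x * indicator K' x) < e" using h by simp
          moreover have "(\<lambda>x. w x * indicator K' x) \<in> ?V'"
            unfolding l2_span_def w_def sum_mult_indicator[symmetric] using F by blast
          ultimately show "\<exists>h\<in>?V'. l2_norm (\<lambda>x. g x - h x) < e" by (rule bexI)
        qed
      qed
    qed
  qed
qed

lemma l2_norm_complex_of_real_norm: "l2_norm (\<lambda>x. complex_of_real (cmod (f x))) = l2_norm f"
  by (simp add: l2_norm_def)

lemma L2_norm_function: "f \<in> L2 \<Longrightarrow> (\<lambda>x. complex_of_real (cmod (f x))) \<in> L2"
  by (rule L2_dominated) (auto intro: borel_measurable_of_real borel_measurable_norm L2_measurable)

text \<open>Every function in the closed span of the restricted exponentials is the restriction of an
  \<open>s\<close>-periodic function, but the indicator of \<open>{x. even \<lfloor>(x \<bullet> s) / (s \<bullet> s)\<rfloor>}\<close> changes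
  under translation by \<open>s\<close> at every point.\<close>

lemma AE_disjoint_translate:
  fixes K :: "(real^'n) set"
  assumes K: "K \<in> lmeasurable" and s: "s \<noteq> 0" and D: "\<And>t. t \<in> D \<Longrightarrow> s \<bullet> t \<in> \<int>"
    and onb: "l2_orthonormal_basis D (\<lambda>t x. wave t x * indicator K x) (L2_on K)"
  shows "AE x in lebesgue. \<not> (x \<in> K \<and> x + s \<in> K)"
proof -
  have Ks [measurable]: "K \<in> sets lebesgue" using K by auto
  define H where "H = {x :: real^'n. even \<lfloor>(x \<bullet> s) / (s \<bullet> s)\<rfloor>}"
  have H_shift: "x + s \<in> H \<longleftrightarrow> x \<notin> H" for x
    using s by (simp add: H_def inner_add_left add_divide_distrib)
  have "H \<in> sets borel" unfolding H_def by measurable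
  then have H [measurable]: "H \<in> sets lebesgue" by simp
  define g :: "real^'n \<Rightarrow> complex" where "g x = indicator H x * indicator K x" for x
  have "H \<inter> K \<in> lmeasurable" using fmeasurable_Int_fmeasurable[OF K H] by (simp add: Int_commute)
  moreover have "g = indicator (H \<inter> K)" by (auto simp: g_def indicator_def)
  ultimately have gL: "g \<in> L2" by (simp add: L2_indicator)
  then have g_on: "g \<in> L2_on K" by (simp add: L2_on_def g_def)
  define W where "W = {x. x \<in> K \<and> x + s \<in> K}"
  have "{x. x + s \<in> K} \<in> sets lebesgue"
    using measurable_sets[OF measurable_translation_lebesgue Ks, of s] by (simp add: vimage_def add.commute)
  then have "K \<inter> {x. x + s \<in> K} \<in> lmeasurable" by (rule fmeasurable_Int_fmeasurable[OF K])
  then have W: "W \<in> lmeasurable" by (simp add: W_def Collect_conj_eq)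
  have "l2_norm (indicator W :: real^'n \<Rightarrow> complex) \<le> e" if "0 < e" for e
  proof -
    let ?V = "l2_span D (\<lambda>t x. wave t x * indicator K x)"
    have V: "?V \<subseteq> L2" by (intro l2_span_subset_L2 wave_indicator_L2 K)
    have "g \<in> l2_closure ?V" using onb g_on by (simp add: l2_orthonormal_basis_def)
    then obtain h where hV: "h \<in> ?V" and h: "l2_norm (\<lambda>x. g x - h x) < e / 2"
      using \<open>0 < e\<close> unfolding l2_closure_iff[OF V] by (meson half_gt_zero)
    then obtain F c where F: "F \<subseteq> D" "h = (\<lambda>x. \<Sum>t\<in>F. c t * (wave t x * indicator K x))"
      unfolding l2_span_def by blast
    define w where "w x = (\<Sum>t\<in>F. c t * wave t x)" for x
    have w_shift: "w (x + s) = w x" for x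
      unfolding w_def using F(1) D by (intro sum.cong refl) (auto simp: wave_periodic)
    have h_eq: "h = (\<lambda>x. w x * indicator K x)" by (simp add: F(2) w_def sum_mult_indicator)
    define u where "u x = g x - h x" for x
    have uL: "u \<in> L2" unfolding u_def using gL hV V by auto
    let ?a = "\<lambda>x. complex_of_real (cmod (u x))" and ?b = "\<lambda>x. complex_of_real (cmod (u (x + s)))"
    have aL: "?a \<in> L2" by (rule L2_norm_function[OF uL])
    have bL: "?b \<in> L2" by (rule L2_norm_function[OF L2_translation[OF uL]])
    have "l2_norm (indicator W :: real^'n \<Rightarrow> complex) \<le> l2_norm (\<lambda>x. ?a x + ?b x)"
    proof (rule l2_norm_mono_AE[OF L2_add[OF aL bL] L2_measurable[OF L2_indicator[OF W]]], rule AE_I2)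
      fix x
      \<comment> \<open>On \<open>W\<close> both \<open>x\<close> and \<open>x + s\<close> lie in
        \<open>K\<close>, where the periodic \<open>w\<close> cancels from
        \<open>u x - u (x + s)\<close>. What remains is the jump of the indicator of
        \<open>H\<close>, of modulus 1, so the error cannot be small at both points.\<close>
      have "1 \<le> cmod (u x) + cmod (u (x + s))" if "x \<in> W"
      proof -
        have K: "x \<in> K" "x + s \<in> K" using that by (auto simp: W_def)
        have "1 = cmod (indicator H x - indicator H (x + s))"
          using H_shift[of x] by (auto simp: indicator_def)
        also have "indicator H x - indicator H (x + s) = u x - u (x + s)"
          using K by (simp add: u_def g_def h_eq w_shift)
        also have "cmod (u x - u (x + s)) \<le> cmod (u x) + cmod (u (x + s))" by (rule norm_triangle_ineq4)
        finally show ?thesis .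
      qed
      then show "cmod (indicator W x) \<le> cmod (?a x + ?b x)"
        by (auto simp: indicator_def simp flip: of_real_add)
    qed
    also have "\<dots> \<le> l2_norm ?a + l2_norm ?b" by (rule l2_norm_triangle[OF aL bL])
    also have "\<dots> = l2_norm u + l2_norm u"
      unfolding l2_norm_complex_of_real_norm l2_norm_translation[OF uL] ..
    also have "\<dots> < e" using h by (simp add: u_def[abs_def])
    finally show ?thesis by simp
  qed
  then have "l2_norm (indicator W :: real^'n \<Rightarrow> complex) = 0" by (meson dense_ge l2_norm_nonneg order_antisym)
  then have "AE x in lebesgue. (indicator W x :: complex) = 0" using L2_indicator[OF W] by (simp add: l2_norm_eq_0_iff)
  then show ?thesis by eventually_elim (auto simp: W_def indicator_def split: if_splits)
qed

section \<open>Lattices\<close>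

definition lattice_of :: "real^'n^'n \<Rightarrow> (real^'n) set" where
  "lattice_of P = (\<lambda>k. P *v k) ` {k. \<forall>i. k $ i \<in> \<int>}"

lemma full_rank_latticeE:
  assumes "full_rank_lattice T" obtains P where "invertible P" "T = lattice_of P"
  using assms unfolding full_rank_lattice_def lattice_of_def by blast

lemma countable_lattice_of: "countable (lattice_of P)" for P :: "real^'n^'n"
proof -
  have "{k :: real^'n. \<forall>i. k $ i \<in> \<int>} \<subseteq> range (\<lambda>f :: 'n \<Rightarrow> int. \<chi> i. real_of_int (f i))"
  proof safe
    fix k :: "real^'n" assume "\<forall>i. k $ i \<in> \<int>"
    then have "k = (\<chi> i. real_of_int \<lfloor>k $ i\<rfloor>)" by (simp add: vec_eq_iff)
    then show "k \<in> range (\<lambda>f :: 'n \<Rightarrow> int. \<chi> i. real_of_int (f i))"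
      by (rule range_eqI[where x = "\<lambda>i. \<lfloor>k $ i\<rfloor>"])
  qed
  then have "countable {k :: real^'n. \<forall>i. k $ i \<in> \<int>}"
    by (rule countable_subset) (intro countable_image countableI_type)
  then show ?thesis unfolding lattice_of_def by (rule countable_image)
qed

lemma additive_subgroup_lattice_of: "additive_subgroup (lattice_of P)"
  unfolding additive_subgroup_def
proof (intro conjI ballI)
  show "0 \<in> lattice_of P" unfolding lattice_of_def by (rule image_eqI[of _ _ 0]) auto
  fix s t assume "s \<in> lattice_of P" "t \<in> lattice_of P"
  then obtain k l where "s = P *v k" "\<forall>i. k $ i \<in> \<int>" "t = P *v l" "\<forall>i. l $ i \<in> \<int>"
    unfolding lattice_of_def by blast
  then show "s - t \<in> lattice_of P"
    unfolding lattice_of_def by (intro image_eqI[of _ _ "k - l"]) (auto simp: matrix_vector_mult_diff_distrib)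
qed

lemma inner_int_vectors: "(\<And>i. k $ i \<in> \<int>) \<Longrightarrow> (\<And>i. l $ i \<in> \<int>) \<Longrightarrow> k \<bullet> l \<in> \<int>" for k l :: "real^'n"
  unfolding inner_vec_def by (intro Ints_sum) auto

text \<open>Moving \<open>P\<close> across the inner product turns the duality condition into
  integrality of the coordinates of \<open>transpose P *v l\<close>.\<close>

lemma dual_lattice_lattice_of:
  fixes P :: "real^'n^'n"
  assumes P: "invertible P"
  shows "dual_lattice (lattice_of P) = lattice_of (transpose (matrix_inv P))"
proof -
  let ?Q = "transpose (matrix_inv P)"
  have inv: "?Q *v (transpose P *v l) = l" "transpose P *v (?Q *v l) = l" for l
  proof -
    have "?Q ** transpose P = mat 1" "transpose P ** ?Q = mat 1"
      unfolding matrix_transpose_mul[symmetric] by (simp_all add: P matrix_inv_left matrix_inv_right transpose_mat)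
    then show "?Q *v (transpose P *v l) = l" "transpose P *v (?Q *v l) = l"
      by (simp_all only: matrix_vector_mul_assoc matrix_vector_mul_lid)
  qed
  have inner: "(P *v k) \<bullet> l = k \<bullet> (transpose P *v l)" for k l
    using inner_transpose[of P l k] by (simp only: inner_commute)
  show ?thesis
  proof (intro equalityI subsetI)
    fix l assume l: "l \<in> dual_lattice (lattice_of P)"
    have "(transpose P *v l) $ i \<in> \<int>" for i
    proof -
      \<comment> \<open>Pairing with the columns of \<open>P\<close> reads off the individual
        coordinates.\<close>
      have "P *v axis i 1 \<in> lattice_of P" unfolding lattice_of_def by (intro imageI) (auto simp: axis_def)
      then have "(P *v axis i 1) \<bullet> l \<in> \<int>" using l by (simp add: dual_lattice_def)
      then show ?thesis unfolding inner by (simp add: inner_axis' del: transpose_matrix_vector)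
    qed
    then show "l \<in> lattice_of ?Q"
      unfolding lattice_of_def using inv(1)[of l] by (intro image_eqI[of _ _ "transpose P *v l"]) (auto simp del: transpose_matrix_vector)
  next
    fix l assume "l \<in> lattice_of ?Q"
    then obtain m where m: "l = ?Q *v m" "\<And>i. m $ i \<in> \<int>" unfolding lattice_of_def by blast
    show "l \<in> dual_lattice (lattice_of P)"
      unfolding dual_lattice_def
    proof safe
      fix t assume "t \<in> lattice_of P"
      then obtain k where k: "t = P *v k" "\<And>i. k $ i \<in> \<int>" unfolding lattice_of_def by blast
      show "t \<bullet> l \<in> \<int>" unfolding k(1) inner unfolding m(1) inv by (rule inner_int_vectors[OF k(2) m(2)])
    qed
  qed
qed

text \<open>The cube is half-open so that every point has exactly one integer translate in it; it
  lies between an open and a closed box of measure 1.\<close>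

lemma emeasure_unit_cube: "emeasure lebesgue {y :: real^'n. \<forall>i. 0 \<le> y $ i \<and> y $ i < 1} = 1"
  and unit_cube_sets: "{y :: real^'n. \<forall>i. 0 \<le> y $ i \<and> y $ i < 1} \<in> sets borel"
proof -
  let ?C = "{y :: real^'n. \<forall>i. 0 \<le> y $ i \<and> y $ i < 1}"
  have "?C = (\<Inter>i. {y. 0 \<le> y $ i} \<inter> {y. y $ i < 1})" by auto
  also have "\<dots> \<in> sets borel"
    by (intro sets.countable_INT'' sets.Int borel_closed borel_open closed_halfspace_component_ge_cart[of 0, simplified]
        open_halfspace_component_lt_cart closed_Collect_le open_Collect_less continuous_intros) auto
  finally show C: "?C \<in> sets borel" .
  have b: "box 0 One \<subseteq> ?C" "?C \<subseteq> cbox 0 One"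
  proof -
    have "(\<Sum>Basis :: real^'n) \<bullet> axis i 1 = 1" for i
      by (rule inner_sum_Basis) (auto simp: Basis_vec_def)
    then have one: "(\<Sum>Basis :: real^'n) $ i = 1" for i by (simp only: inner_axis inner_real_def mult_1_right)
    show "box 0 One \<subseteq> ?C"
      using one by (auto simp: mem_box_cart intro: less_imp_le)
    show "?C \<subseteq> cbox 0 One"
    proof
      fix y assume "y \<in> ?C"
      then have "0 \<le> y $ i \<and> y $ i \<le> 1" for i by (simp add: less_imp_le)
      then show "y \<in> cbox 0 One" unfolding mem_box_cart one by simp
    qed
  qed
  have "emeasure lborel (box 0 One :: (real^'n) set) = 1" "emeasure lborel (cbox 0 One :: (real^'n) set) = 1"
    by (auto simp: emeasure_lborel_box_eq emeasure_lborel_cbox_eq)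
  then have "emeasure lborel ?C = 1"
    using emeasure_mono[OF b(1), of lborel] emeasure_mono[OF b(2), of lborel] C by auto
  then show "emeasure lebesgue ?C = 1" using C by simp
qed

text \<open>The domain is the image of the half-open unit cube under \<open>P\<close>, so that
  existence and uniqueness hold at every point without an exceptional null set.\<close>

lemma lattice_fundamental_domain:
  fixes P :: "real^'n^'n"
  assumes P: "invertible P"
  obtains F where "F \<in> sets lebesgue" "emeasure lebesgue F = ennreal \<bar>det P\<bar>"
    "\<And>x. \<exists>!s. s \<in> lattice_of P \<and> x + s \<in> F"
proof -
  let ?C = "{y :: real^'n. \<forall>i. 0 \<le> y $ i \<and> y $ i < 1}"
  define F where "F = {x. matrix_inv P *v x \<in> ?C}"
  have inv: "invertible (matrix_inv P)" using P by (rule invertible_matrix_inv)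
  have C: "?C \<in> sets lebesgue" using unit_cube_sets by simp
  have "det P * det (matrix_inv P) = 1" using P by (simp add: matrix_inv_right flip: det_mul)
  then have det: "1 / \<bar>det (matrix_inv P)\<bar> = \<bar>det P\<bar>"
    by (metis abs_1 abs_mult div_by_1 mult_eq_0_iff nonzero_eq_divide_eq one_neq_zero abs_eq_0)
  have F: "F \<in> sets lebesgue"
    using measurable_sets[OF measurable_matrix_lebesgue[OF inv] C] by (simp add: F_def vimage_def)
  have "emeasure lebesgue F = (\<integral>\<^sup>+x. indicator F x \<partial>lebesgue)" using F by simp
  also have "\<dots> = (\<integral>\<^sup>+x. indicator ?C (matrix_inv P *v x) \<partial>lebesgue)"
    by (intro nn_integral_cong) (auto simp: F_def indicator_def)
  also have "\<dots> = ennreal \<bar>det P\<bar> * emeasure lebesgue ?C"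
    unfolding nn_integral_matrix[OF inv borel_measurable_indicator[OF C]] det nn_integral_indicator[OF C] ..
  finally have "emeasure lebesgue F = ennreal \<bar>det P\<bar>" by (simp add: emeasure_unit_cube)
  moreover have "\<exists>!s. s \<in> lattice_of P \<and> x + s \<in> F" for x
  proof -
    define y where "y = matrix_inv P *v x"
    have iff: "x + P *v k \<in> F \<longleftrightarrow> y + k \<in> ?C" for k
      by (simp add: F_def y_def matrix_vector_right_distrib P)
    \<comment> \<open>Subtracting integer parts is the only integral shift of \<open>y\<close> into
      the half-open cube.\<close>
    define k where "k = (\<chi> i. - real_of_int \<lfloor>y $ i\<rfloor>)"
    show ?thesis
    proof (rule ex1I[of _ "P *v k"])
      have "y + k \<in> ?C" by (auto simp: k_def) linarith
      then show "P *v k \<in> lattice_of P \<and> x + P *v k \<in> F"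
        unfolding iff lattice_of_def by (auto simp: k_def)
      fix s assume s: "s \<in> lattice_of P \<and> x + s \<in> F"
      then obtain l where l: "s = P *v l" "\<And>i. l $ i \<in> \<int>" unfolding lattice_of_def by blast
      have "l $ i = k $ i" for i
      proof -
        obtain z where z: "l $ i = of_int z" using l(2) by (rule Ints_cases)
        have "\<forall>i. 0 \<le> y $ i + l $ i \<and> y $ i + l $ i < 1" using s unfolding l(1) iff by simp
        then have "0 \<le> y $ i + of_int z" "y $ i + of_int z < 1" unfolding z[symmetric] by blast+
        then have "\<lfloor>y $ i\<rfloor> = - z" by linarith
        then show ?thesis using z by (simp add: k_def)
      qed
      then have "l = k" by (simp add: vec_eq_iff)
      then show "s = P *v k" using l(1) by simp
    qed
  qed
  ultimately show ?thesis using F that by blast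
qed

text \<open>Bessel's inequality for the exponentials, applied to all modulations of the indicator of
  \<open>K\<close> and integrated over a fundamental domain, bounds the covolume of the lattice_of of
  frequencies from below by Plancherel's theorem.\<close>

lemma covolume_ge_1:
  fixes K :: "(real^'n) set"
  assumes Q: "invertible Q" and K: "K \<in> sets lebesgue" "emeasure lebesgue K = 1"
    and orth: "\<And>s t. s \<in> lattice_of Q \<Longrightarrow> t \<in> lattice_of Q \<Longrightarrow>
      l2_inner (\<lambda>x. wave s x * indicator K x) (\<lambda>x. wave t x * indicator K x) = (if s = t then 1 else 0)"
  shows "1 \<le> \<bar>det Q\<bar>"
proof -
  have Km: "K \<in> lmeasurable" using K by (auto simp: fmeasurable_def)
  obtain F where F: "F \<in> sets lebesgue" "emeasure lebesgue F = ennreal \<bar>det Q\<bar>"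
    "\<And>x. \<exists>!s. s \<in> lattice_of Q \<and> x + s \<in> F" using lattice_fundamental_domain[OF Q] by blast
  let ?u = "fourier_integral (indicator K)"
  have int: "integrable lebesgue (indicator K :: real^'n \<Rightarrow> complex)" "(indicator K :: real^'n \<Rightarrow> complex) \<in> L2"
    using Km by (auto intro: integrable_complex_indicator L2_indicator)
  have K1: "measure lebesgue K = 1" using K by (simp add: measure_def)
  have norm: "(l2_norm (indicator K :: real^'n \<Rightarrow> complex))\<^sup>2 = 1"
    using l2_norm_indicator[OF Km] K1 by simp
  have [measurable]: "?u \<in> borel_measurable lebesgue" using fourier_integral_L2[OF int] by (rule L2_measurable)
  \<comment> \<open>Here \<open>x\<close> is an arbitrary frequency, not only a lattice point. Up to
    conjugation, the coefficients of a modulated indicator are samples of one transform along a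
    translated lattice.\<close>
  have inner_eq: "cmod (l2_inner (\<lambda>y. wave x y * indicator K y) (\<lambda>y. wave t y * indicator K y)) = cmod (?u (x - t))" for x t
  proof -
    have "cnj (l2_inner (\<lambda>y. wave x y * indicator K y) (\<lambda>y. wave t y * indicator K y)) = ?u (x - t)"
      unfolding l2_inner_def fourier_integral_wave
      by (subst Bochner_Integration.integral_cnj[symmetric], rule Bochner_Integration.integral_cong)
        (auto simp: wave_diff indicator_def)
    then show ?thesis by (metis complex_mod_cnj)
  qed
  have bessel: "(\<integral>\<^sup>+t. ennreal ((cmod (?u (x - t)))\<^sup>2) \<partial>count_space (lattice_of Q)) \<le> 1" for x
  proof (rule nn_integral_count_space_bound[OF countable_lattice_of])
    fix G assume G: "finite G" "G \<subseteq> lattice_of Q"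
    have "(\<Sum>t\<in>G. (cmod (l2_inner (\<lambda>y. wave x y * indicator K y) (\<lambda>y. wave t y * indicator K y)))\<^sup>2)
        \<le> (l2_norm (\<lambda>y. wave x y * indicator K y))\<^sup>2"
      using G by (intro bessel_inequality wave_indicator_L2 Km orth) auto
    also have "\<dots> = 1" unfolding l2_norm_wave[OF int(2)] by (rule norm)
    finally have "(\<Sum>t\<in>G. (cmod (?u (x - t)))\<^sup>2) \<le> 1" unfolding inner_eq .
    then show "(\<Sum>t\<in>G. ennreal ((cmod (?u (x - t)))\<^sup>2)) \<le> 1" by (simp add: sum_ennreal)
  qed
  have "1 = (\<integral>\<^sup>+x. ennreal ((cmod (?u x))\<^sup>2) \<partial>lebesgue)"
    using norm nn_integral_l2_norm[OF fourier_integral_L2[OF int]] fourier_integral_isometric[OF int] by simp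
  also have "\<dots> = (\<integral>\<^sup>+x. indicator F x * (\<integral>\<^sup>+t. ennreal ((cmod (?u (x - t)))\<^sup>2) \<partial>count_space (lattice_of Q)) \<partial>lebesgue)"
    by (rule nn_integral_periodize[OF countable_lattice_of _ F(1)]) (auto simp: tiles_def F(3))
  also have "\<dots> \<le> (\<integral>\<^sup>+x. indicator F x \<partial>lebesgue)"
    using bessel by (intro nn_integral_mono) (auto simp: indicator_def)
  also have "\<dots> = ennreal \<bar>det Q\<bar>" using F by simp
  finally show ?thesis by simp
qed

text \<open>A fundamental domain \<open>F\<close> of \<open>T\<close> has measure at most 1.
  Disjointness makes the folding of \<open>K\<close> into \<open>F\<close> injective up to null
  sets, so the image has measure 1 and exhausts \<open>F\<close>; translation then spreads the
  covering to the whole space.\<close>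

lemma tiles_if_orthonormal_waves:
  fixes K :: "(real^'n) set"
  assumes T: "full_rank_lattice T" and K: "K \<in> sets lebesgue" "emeasure lebesgue K = 1"
    and onb: "l2_orthonormal_basis (dual_lattice T) (\<lambda>t x. wave t x * indicator K x) (L2_on K)"
  shows "tiles T K"
proof -
  obtain P where P: "invertible P" "T = lattice_of P" using T by (rule full_rank_latticeE)
  have Km: "K \<in> lmeasurable" using K by (auto simp: fmeasurable_def)
  have Tc: "countable T" "additive_subgroup T" unfolding P(2) by (rule countable_lattice_of additive_subgroup_lattice_of)+
  let ?Q = "transpose (matrix_inv P)"
  have inv: "invertible ?Q" by (intro invertible_transpose invertible_matrix_inv P)
  have "1 \<le> \<bar>det ?Q\<bar>"
    using onb unfolding P(2) dual_lattice_lattice_of[OF P(1)] l2_orthonormal_basis_def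
    by (intro covolume_ge_1[OF inv K]) auto
  \<comment> \<open>A lattice and its dual have reciprocal covolumes, so the lower bound for the
    dual lattice is an upper bound for \<open>T\<close>.\<close>
  moreover have "\<bar>det P\<bar> * \<bar>det ?Q\<bar> = 1"
    using P(1) by (simp add: det_transpose matrix_inv_right flip: abs_mult det_mul)
  ultimately have "\<bar>det P\<bar> \<le> 1" by (metis abs_ge_zero mult_left_mono mult.right_neutral)
  moreover obtain F where F: "F \<in> sets lebesgue" "emeasure lebesgue F = ennreal \<bar>det P\<bar>"
    "\<And>x. \<exists>!s. s \<in> T \<and> x + s \<in> F" using lattice_fundamental_domain[OF P(1)] P(2) by blast
  ultimately have F_le: "emeasure lebesgue F \<le> 1" by simp
  have disj0: "AE x in lebesgue. \<not> (x \<in> K \<and> x + s \<in> K)" if "s \<in> T" "s \<noteq> 0" for s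
    by (rule AE_disjoint_translate[OF Km that(2) _ onb]) (use that in \<open>auto simp: dual_lattice_def\<close>)
  have "AE x in lebesgue. \<forall>s\<in>T - {0}. \<not> (x \<in> K \<and> x + s \<in> K)"
    using disj0 Tc(1) by (subst AE_ball_countable) auto
  from AE_all_translates[OF Tc(1) this]
  have disj: "AE x in lebesgue. \<forall>s\<in>T. \<forall>u\<in>T. x + s \<in> K \<longrightarrow> x + u \<in> K \<longrightarrow> s = u"
  proof eventually_elim
    case (elim x)
    show ?case
    proof (intro ballI impI)
      fix s u assume "s \<in> T" "u \<in> T" "x + s \<in> K" "x + u \<in> K"
      then show "s = u" using elim[rule_format, of s "u - s"] additive_subgroupD(4)[OF Tc(2), of u s] by auto
    qed
  qed
  define E where "E = {x. \<exists>s\<in>T. x + s \<in> K}"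
  have "E = (\<Union>s\<in>T. {x. x + s \<in> K})" by (auto simp: E_def)
  moreover have "{x. x + s \<in> K} \<in> sets lebesgue" for s
    using measurable_sets[OF measurable_translation_lebesgue K(1), of s] by (simp add: vimage_def add.commute)
  ultimately have E: "E \<in> sets lebesgue" using Tc(1) by (auto intro: sets.countable_UN')
  have "1 = (\<integral>\<^sup>+x. indicator K x \<partial>lebesgue)" using K by simp
  also have "\<dots> = (\<integral>\<^sup>+x. indicator F x * (\<integral>\<^sup>+s. indicator K (x - s) \<partial>count_space T) \<partial>lebesgue)"
    by (rule nn_integral_periodize[OF Tc(1) _ F(1)]) (use F(3) K(1) in \<open>auto simp: tiles_def\<close>)
  \<comment> \<open>By disjointness at most one translate of almost every \<open>x\<close> lies in
    \<open>K\<close>, so the folded indicator is the indicator of \<open>E\<close>, the set of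
    points with such a translate.\<close>
  also have "\<dots> \<le> (\<integral>\<^sup>+x. indicator (F \<inter> E) x \<partial>lebesgue)"
  proof (rule nn_integral_mono_AE, use disj in eventually_elim)
    case (elim x)
    have "(\<integral>\<^sup>+s. indicator K (x - s) \<partial>count_space T) \<le> (indicator E x :: ennreal)"
    proof (cases "x \<in> E")
      case True
      then obtain s where s: "s \<in> T" "x + s \<in> K" by (auto simp: E_def)
      have ex1: "\<exists>!u. u \<in> T \<and> x + u \<in> K"
        using s elim by (intro ex1I[of _ s]) auto
      have "(\<integral>\<^sup>+s. indicator K (x - s) \<partial>count_space T) = (\<integral>\<^sup>+s. (if x + - s \<in> K then 1 else 0 :: ennreal) \<partial>count_space T)"
        by (intro nn_integral_cong) (simp add: indicator_def)
      also have "\<dots> = 1" by (rule nn_integral_count_space_Ex1[OF Ex1_subgroup_minus[OF Tc(2) ex1]])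
      finally show ?thesis using True by simp
    next
      case False
      have "x - s \<notin> K" if "s \<in> T" for s
        using False additive_subgroupD(2)[OF Tc(2) that] by (auto simp: E_def dest!: bspec[of _ _ "- s"])
      then have "(\<integral>\<^sup>+s. indicator K (x - s) \<partial>count_space T) = (\<integral>\<^sup>+s. (0 :: ennreal) \<partial>count_space T)"
        by (intro nn_integral_cong) (simp add: indicator_def)
      then show ?thesis by simp
    qed
    then show "indicator F x * (\<integral>\<^sup>+s. indicator K (x - s) \<partial>count_space T) \<le> (indicator (F \<inter> E) x :: ennreal)"
      by (auto simp: indicator_def split: if_splits)
  qed
  also have "\<dots> = emeasure lebesgue (F \<inter> E)" using F(1) E by simp
  finally have FE: "1 \<le> emeasure lebesgue (F \<inter> E)" .
  have "emeasure lebesgue (F - E) = 0"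
  proof -
    have "emeasure lebesgue F = emeasure lebesgue (F \<inter> E) + emeasure lebesgue (F - E)"
      using F(1) E by (subst plus_emeasure) (auto simp: Int_Diff_Un)
    then have "1 + emeasure lebesgue (F - E) \<le> 1" using F_le FE by (metis add_right_mono order_trans)
    then have "1 + emeasure lebesgue (F - E) \<le> 1 + 0" by simp
    then show ?thesis unfolding ennreal_add_left_cancel_le by simp
  qed
  then have "F - E \<in> null_sets lebesgue" using F(1) E by auto
  \<comment> \<open>Every point has a translate in \<open>F\<close>, and \<open>F\<close> lies
    almost everywhere in \<open>E\<close>; composing the two translations shows that almost every
    point lies in \<open>E\<close>.\<close>
  then have "AE x in lebesgue. x \<in> F \<longrightarrow> x \<in> E" by (rule AE_I') auto
  from AE_all_translates[OF Tc(1) this]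
  have "AE x in lebesgue. x \<in> E"
  proof eventually_elim
    case (elim x)
    obtain s where s: "s \<in> T" "x + s \<in> F" using F(3) by blast
    then obtain u where "u \<in> T" "x + s + u \<in> K" using elim by (auto simp: E_def)
    then show ?case using s additive_subgroupD(3)[OF Tc(2), of s u] by (auto simp: E_def add.assoc intro!: bexI[of _ "s + u"])
  qed
  with disj show ?thesis unfolding tiles_def
  proof eventually_elim
    case (elim x)
    then obtain s where "s \<in> T" "x + s \<in> K" by (auto simp: E_def)
    then show ?case using elim(1) by (intro ex1I[of _ s]) auto
  qed
qed

section \<open>Unions of orthonormal bases\<close>

lemma l2_orthonormal_basis_reindex:
  assumes "bij_betw h I' I" "l2_orthonormal_basis I b V"
  shows "l2_orthonormal_basis I' (\<lambda>i. b (h i)) V"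
proof -
  have inj: "inj_on h I'" and img: "h ` I' = I" using assms(1) by (auto simp: bij_betw_def)
  have "l2_span I' (\<lambda>i. b (h i)) = l2_span I b"
  proof (intro equalityI subsetI)
    fix f assume "f \<in> l2_span I' (\<lambda>i. b (h i))"
    then obtain F c where F: "finite F" "F \<subseteq> I'" "f = (\<lambda>x. \<Sum>i\<in>F. c i * b (h i) x)"
      unfolding l2_span_def by blast
    have injF: "inj_on h F" using inj F(2) by (rule inj_on_subset)
    have "f = (\<lambda>x. \<Sum>i\<in>h ` F. c (inv_into F h i) * b i x)"
      unfolding F(3) by (simp add: sum.reindex[OF injF] injF inv_into_f_f)
    then show "f \<in> l2_span I b" unfolding l2_span_def using F(1,2) img
      by (intro CollectI exI[of _ "h ` F"] exI[of _ "\<lambda>i. c (inv_into F h i)"]) auto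
  next
    fix f assume "f \<in> l2_span I b"
    then obtain F c where F: "finite F" "F \<subseteq> I" "f = (\<lambda>x. \<Sum>i\<in>F. c i * b i x)"
      unfolding l2_span_def by blast
    define G where "G = {i\<in>I'. h i \<in> F}"
    have G: "inj_on h G" "h ` G = F" using inj_on_subset[OF inj, of G] F(2) img by (auto simp: G_def)
    have "f = (\<lambda>x. \<Sum>i\<in>G. c (h i) * b (h i) x)"
      unfolding F(3) G(2)[symmetric] by (simp add: sum.reindex[OF G(1)])
    moreover have "finite G" using F(1) G by (metis finite_image_iff)
    ultimately show "f \<in> l2_span I' (\<lambda>i. b (h i))"
      unfolding l2_span_def by (intro CollectI exI[of _ G] exI[of _ "\<lambda>i. c (h i)"]) (auto simp: G_def)
  qed
  then show ?thesis
    using assms(2) inj img unfolding l2_orthonormal_basis_def by (auto simp: inj_on_eq_iff)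
qed

text \<open>The map \<open>p\<close> assigns to each basis index the piece carrying its function.
  Different pieces are orthogonal by disjointness of supports, and a function on the union is the
  limit of its restrictions to finitely many pieces.\<close>

lemma l2_orthonormal_basis_UN:
  fixes S :: "'k \<Rightarrow> (real^'n) set" and b :: "'i \<Rightarrow> real^'n \<Rightarrow> complex"
  assumes I: "countable I" and S: "\<And>i. i \<in> I \<Longrightarrow> S i \<in> sets lebesgue"
    and disj: "\<And>i j. i \<in> I \<Longrightarrow> j \<in> I \<Longrightarrow> i \<noteq> j \<Longrightarrow> AE x in lebesgue. \<not> (x \<in> S i \<and> x \<in> S j)"
    and p: "\<And>k. k \<in> J \<Longrightarrow> p k \<in> I"
    and onb: "\<And>i. i \<in> I \<Longrightarrow> l2_orthonormal_basis {k\<in>J. p k = i} b (L2_on (S i))"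
  shows "l2_orthonormal_basis J b (L2_on (\<Union>i\<in>I. S i))"
proof -
  let ?U = "\<Union>i\<in>I. S i"
  have U: "?U \<in> sets lebesgue" using I S by (rule sets.countable_UN'')
  have bL: "b k \<in> L2" if "k \<in> J" for k
    using onb[OF p[OF that]] that by (auto simp: l2_orthonormal_basis_def)
  have b_on: "b k \<in> L2_on (S (p k))" if "k \<in> J" for k
  proof -
    let ?J = "{k'\<in>J. p k' = p k}"
    have "b k \<in> l2_span ?J b" using that by (intro l2_span_superset) auto
    then have "b k \<in> l2_closure (l2_span ?J b)"
      using l2_closure_superset[OF l2_span_subset_L2[of ?J b]] bL by auto
    then show ?thesis using onb[OF p[OF that]] by (simp add: l2_orthonormal_basis_def)
  qed
  show ?thesis
    unfolding l2_orthonormal_basis_def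
  proof (intro conjI ballI)
    fix k assume k: "k \<in> J"
    show "b k \<in> L2" by (rule bL[OF k])
    fix l assume l: "l \<in> J"
    show "l2_inner (b k) (b l) = (if k = l then 1 else 0)"
    proof (cases "p k = p l")
      case True
      then show ?thesis using onb[OF p[OF k]] k l by (auto simp: l2_orthonormal_basis_def)
    next
      case False
      have "AE x in lebesgue. x \<notin> S (p k) \<longrightarrow> b k x = 0" "AE x in lebesgue. x \<notin> S (p l) \<longrightarrow> b l x = 0"
        using b_on k l by (auto simp: L2_on_def)
      then have "AE x in lebesgue. b k x * cnj (b l x) = 0"
        using disj[OF p[OF k] p[OF l] False] by eventually_elim auto
      then have "l2_inner (b k) (b l) = 0" unfolding l2_inner_def by (rule integral_eq_zero_AE)
      then show ?thesis using False by auto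
    qed
  next
    let ?V = "l2_span J b"
    have V: "?V \<subseteq> L2" by (rule l2_span_subset_L2) (rule bL)
    show "L2_on ?U = l2_closure ?V"
    proof
      have "b k \<in> L2_on ?U" if "k \<in> J" for k
        using b_on[OF that] L2_on_mono[of "S (p k)" ?U] p[OF that] by auto
      then show "l2_closure ?V \<subseteq> L2_on ?U" by (intro l2_closure_subset_L2_on U l2_span_subset_L2_on)
      show "L2_on ?U \<subseteq> l2_closure ?V"
      proof
        fix g assume g: "g \<in> L2_on ?U"
        then have gL: "g \<in> L2" by (simp add: L2_on_def)
        have piece: "f \<in> l2_closure ?V" if "i \<in> I" "f \<in> L2_on (S i)" for i f
          using onb[OF that(1)] that(2) l2_closure_mono[OF l2_span_mono[of "{k\<in>J. p k = i}" J b]]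
          by (auto simp: l2_orthonormal_basis_def)
        \<comment> \<open>The pieces overlap in null sets. Removing from a new piece what is already
          covered makes the indicators add up exactly.\<close>
        have fin: "(\<lambda>x. g x * indicator (\<Union>i\<in>F. S i) x) \<in> l2_closure ?V" if "finite F" "F \<subseteq> I" for F
          using that
        proof (induction F rule: finite_induct)
          case empty
          show ?case using l2_closure_superset[OF V] l2_span_zero by auto
        next
          case (insert i F)
          let ?W = "\<Union>i\<in>F. S i"
          have W: "S i - ?W \<in> sets lebesgue"
            using insert S by (intro sets.Diff sets.finite_UN) auto
          have "(\<lambda>x. g x * indicator (S i - ?W) x) \<in> L2_on (S i)"
            using L2_on_mult_indicator[OF gL W] L2_on_mono[of "S i - ?W" "S i"] by auto
          then have "(\<lambda>x. g x * indicator (S i - ?W) x) \<in> l2_closure ?V" using piece insert by auto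
          moreover have "(\<lambda>x. g x * indicator ?W x) \<in> l2_closure ?V" using insert by auto
          ultimately have "(\<lambda>x. g x * indicator (S i - ?W) x + g x * indicator ?W x) \<in> l2_closure ?V"
            by (intro l2_closure_span_add bL)
          moreover have "(\<lambda>x. g x * indicator (S i - ?W) x + g x * indicator ?W x) = (\<lambda>x. g x * indicator (\<Union>i\<in>insert i F. S i) x)"
            by (auto simp: indicator_def fun_eq_iff)
          ultimately show ?case by simp
        qed
        \<comment> \<open>Finite index sets increasing to \<open>I\<close> along an enumeration; the
          restrictions to them are dominated by \<open>g\<close>.\<close>
        define F where "F n = {i\<in>I. to_nat_on I i < n}" for n
        have F: "finite (F n)" "F n \<subseteq> I" for n
          unfolding F_def
          by (auto intro!: finite_imageD[of "to_nat_on I"] intro: finite_subset[of _ "{..<n}"] inj_on_subset[OF inj_on_to_nat_on[OF I]])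
        define s where "s n x = g x * indicator (\<Union>i\<in>F n. S i) x" for n x
        have sV: "s n \<in> l2_closure ?V" for n unfolding s_def by (rule fin[OF F])
        have sL: "s n \<in> L2" for n using sV l2_closure_subset_L2 by blast
        define g' where "g' x = g x * indicator ?U x" for x
        have g'L: "g' \<in> L2" unfolding g'_def by (rule L2_mult_indicator[OF gL U])
        have lim: "(\<lambda>n. l2_norm (\<lambda>x. s n x - g' x)) \<longlonglongrightarrow> 0"
        proof (rule l2_norm_dominated_convergence[OF gL g'L sL])
          fix x
          have "\<forall>\<^sub>F n in sequentially. s n x = g' x"
          proof (cases "x \<in> ?U")
            case True
            then obtain i where i: "i \<in> I" "x \<in> S i" by blast
            have "s n x = g' x" if "Suc (to_nat_on I i) \<le> n" for n
            proof -
              have "i \<in> F n" using i that by (simp add: F_def)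
              then show ?thesis using i by (auto simp: s_def g'_def indicator_def)
            qed
            then show ?thesis by (auto simp: eventually_sequentially)
          next
            case False
            then have "s n x = g' x" for n using F(2)[of n] by (auto simp: s_def g'_def indicator_def)
            then show ?thesis by simp
          qed
          then show "(\<lambda>n. s n x) \<longlonglongrightarrow> g' x" by (rule tendsto_eventually)
          show "cmod (s n x - g' x) \<le> cmod (g x)" for n
          proof -
            have "x \<in> ?U" if "x \<in> (\<Union>i\<in>F n. S i)" using F(2)[of n] that by blast
            then show ?thesis unfolding s_def g'_def
              by (cases "x \<in> (\<Union>i\<in>F n. S i)"; cases "x \<in> ?U") (simp_all del: UN_iff)
          qed
        qed
        have "AE x in lebesgue. g x = g' x"
          using g by (auto simp: L2_on_def g'_def indicator_def elim!: eventually_mono)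
        then have eq: "l2_norm (\<lambda>x. g x - s n x) = l2_norm (\<lambda>x. s n x - g' x)" for n
          unfolding l2_norm_diff_commute[of g]
          by (intro l2_norm_cong_AE L2_measurable L2_diff sL gL g'L) (auto elim: eventually_mono)
        show "g \<in> l2_closure ?V"
        proof (rule l2_closure_closed[OF V gL])
          fix e :: real assume "0 < e"
          from order_tendstoD(2)[OF lim this] obtain n where "l2_norm (\<lambda>x. s n x - g' x) < e"
            by (auto simp: eventually_sequentially)
          then show "\<exists>f\<in>l2_closure ?V. l2_norm (\<lambda>x. g x - f x) < e" using sV eq by metis
        qed
      qed
    qed
  qed
qed

section \<open>Spectral subspaces and their dilates\<close>

lemma matrix_zpow_0 [simp]: "matrix_zpow A 0 = mat 1"
  by (simp add: matrix_zpow_def)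

lemma matrix_zpow_add_1:
  fixes A :: "real^'n^'n"
  assumes A: "invertible A" shows "matrix_zpow A (j + 1) = A ** matrix_zpow A j"
proof (cases "0 \<le> j")
  case True
  then show ?thesis by (simp add: matrix_zpow_def nat_add_distrib)
next
  case False
  define n where "n = nat (- j - 1)"
  have n: "nat (- j) = Suc n" "nat (- (j + 1)) = n" using False by (auto simp: n_def)
  have "A ** matrix_zpow A j = (((**) (matrix_inv A)) ^^ n) (mat 1)"
    using False A by (simp add: matrix_zpow_def n matrix_mul_assoc matrix_inv_right)
  \<comment> \<open>At \<open>j = - 1\<close> the successor falls into the other branch of the
    definition, and both branches give the identity there.\<close>
  moreover have "matrix_zpow A (j + 1) = (((**) (matrix_inv A)) ^^ n) (mat 1)"
    using False n by (cases "j = - 1") (auto simp: matrix_zpow_def)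
  ultimately show ?thesis by simp
qed

lemma matrix_zpow_diff_1:
  fixes A :: "real^'n^'n"
  assumes A: "invertible A" shows "matrix_zpow A (j - 1) = matrix_inv A ** matrix_zpow A j"
  using matrix_zpow_add_1[OF A, of "j - 1"] A by (simp add: matrix_mul_assoc matrix_inv_left)

lemma invertible_matrix_zpow:
  fixes A :: "real^'n^'n"
  assumes A: "invertible A" shows "invertible (matrix_zpow A j)"
proof (induction j rule: int_induct[where k = 0])
  case base
  show ?case by (simp add: invertible_det_nz)
qed (simp_all add: matrix_zpow_add_1[OF A] matrix_zpow_diff_1[OF A] invertible_mult A invertible_matrix_inv)

lemma matrix_zpow_commute:
  fixes A :: "real^'n^'n"
  assumes A: "invertible A" shows "A ** matrix_zpow A j = matrix_zpow A j ** A"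
proof (induction j rule: int_induct[where k = 0])
  case base
  show ?case by simp
next
  case (step1 i)
  then have "A ** (matrix_zpow A i ** A) = A ** (A ** matrix_zpow A i)" by simp
  then show ?case by (simp only: matrix_zpow_add_1[OF A] matrix_mul_assoc[symmetric])
next
  case (step2 i)
  have "A ** (matrix_inv A ** matrix_zpow A i) = matrix_inv A ** (A ** matrix_zpow A i)"
    using A by (simp add: matrix_mul_assoc matrix_inv_left matrix_inv_right)
  then show ?case using step2 by (simp add: matrix_zpow_diff_1[OF A] matrix_mul_assoc)
qed

text \<open>Transposition reverses products; commutation of a matrix with its powers restores the
  order.\<close>

lemma matrix_zpow_transpose:
  fixes A :: "real^'n^'n"
  assumes A: "invertible A" shows "matrix_zpow (transpose A) j = transpose (matrix_zpow A j)"
proof -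
  note AT = invertible_transpose[OF A]
  have up: "matrix_zpow (transpose A) (i + 1) = transpose (matrix_zpow A (i + 1))"
    if "matrix_zpow (transpose A) i = transpose (matrix_zpow A i)" for i
    using that by (simp only: matrix_zpow_add_1[OF A] matrix_zpow_add_1[OF AT] matrix_zpow_commute[OF A] matrix_transpose_mul)
  have down: "matrix_zpow (transpose A) (i - 1) = transpose (matrix_zpow A (i - 1))"
    if i: "matrix_zpow (transpose A) i = transpose (matrix_zpow A i)" for i
  proof -
    have "transpose A ** matrix_zpow (transpose A) (i - 1) = transpose A ** transpose (matrix_zpow A (i - 1))"
      using i matrix_zpow_add_1[OF AT, of "i - 1"] matrix_zpow_add_1[OF A, of "i - 1"] matrix_zpow_commute[OF A, of "i - 1"]
      by (simp flip: matrix_transpose_mul)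
    then have "matrix_inv (transpose A) ** (transpose A ** matrix_zpow (transpose A) (i - 1))
        = matrix_inv (transpose A) ** (transpose A ** transpose (matrix_zpow A (i - 1)))" by simp
    then show ?thesis by (simp add: matrix_mul_assoc matrix_inv_left[OF AT])
  qed
  show ?thesis by (induction j rule: int_induct[where k = 0]) (simp_all add: transpose_mat up down)
qed

lemma abs_det_matrix_zpow:
  fixes A :: "real^'n^'n"
  assumes A: "invertible A" shows "\<bar>det (matrix_zpow A j)\<bar> = \<bar>det A\<bar> powr (of_int j)"
proof -
  have d: "0 < \<bar>det A\<bar>" using A by (simp add: invertible_det_nz)
  have i: "\<bar>det (matrix_inv A)\<bar> = \<bar>det A\<bar> powr (- 1)"
  proof -
    have "\<bar>det A\<bar> * \<bar>det (matrix_inv A)\<bar> = 1" using A by (simp add: matrix_inv_right flip: abs_mult det_mul)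
    then show ?thesis using d by (simp add: powr_minus field_simps)
  qed
  show ?thesis
  proof (induction j rule: int_induct[where k = 0])
    case base
    show ?case using d by simp
  next
    case (step1 j)
    then show ?case using d by (simp add: matrix_zpow_add_1[OF A] det_mul abs_mult powr_add)
  next
    case (step2 j)
    then show ?case using d
      by (simp add: matrix_zpow_diff_1[OF A] det_mul abs_mult i powr_diff powr_minus divide_inverse mult.commute)
  qed
qed

lemma image_matrix:
  fixes M :: "real^'n^'n"
  assumes "invertible M" shows "x \<in> (*v) M ` S \<longleftrightarrow> matrix_inv M *v x \<in> S"
  using assms by (auto simp: image_iff intro!: bexI[of _ "matrix_inv M *v x"])

lemma sets_image_matrix:
  fixes M :: "real^'n^'n"
  assumes M: "invertible M" and S: "S \<in> sets lebesgue" shows "(*v) M ` S \<in> sets lebesgue"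
proof -
  have "(*v) M ` S = (*v) (matrix_inv M) -` S \<inter> space lebesgue"
    using image_matrix[OF M] by (auto simp: set_eq_iff)
  also have "\<dots> \<in> sets lebesgue"
    by (rule measurable_sets[OF measurable_matrix_lebesgue[OF invertible_matrix_inv[OF M]] S])
  finally show ?thesis .
qed

lemma L2_on_cong_AE: "f \<in> L2_on S \<Longrightarrow> g \<in> L2 \<Longrightarrow> AE x in lebesgue. f x = g x \<Longrightarrow> g \<in> L2_on S"
  by (auto simp: L2_on_def elim: eventually_elim2)

section \<open>Spaces determined by the support of the transform\<close>

lemma fourier_image_L2_spectrum: "fourier_image (L2_spectrum S) = L2_on S"
proof (intro equalityI subsetI)
  fix g assume "g \<in> fourier_image (L2_spectrum S)"
  then obtain f h where "has_fourier f g" "h \<in> L2_on S" "has_fourier f h"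
    by (auto simp: fourier_image_def L2_spectrum_def)
  then show "g \<in> L2_on S" using L2_on_cong_AE has_fourier_unique has_fourier_L2(2) by blast
next
  fix g assume g: "g \<in> L2_on S"
  then have "g \<in> L2" by (simp add: L2_on_def)
  then have h: "has_fourier (inv_fourier g) g" by (rule has_fourier_inv_fourier)
  then show "g \<in> fourier_image (L2_spectrum S)"
    using g has_fourier_L2(1)[OF h] by (auto simp: fourier_image_def L2_spectrum_def)
qed

lemma L2_spectrum_iff: "f \<in> L2_spectrum S \<longleftrightarrow> (\<exists>g\<in>L2_on S. has_fourier f g)"
  by (auto simp: L2_spectrum_def has_fourier_L2)

lemma L2_spectrum_has_fourier:
  assumes "f \<in> L2_spectrum S" "has_fourier f g" shows "g \<in> L2_on S"
  using assms fourier_image_L2_spectrum[of S] by (auto simp: fourier_image_def)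

lemma L2_spectrum_UNIV: "L2_spectrum UNIV = L2"
proof (intro equalityI subsetI)
  fix f :: "real^'a \<Rightarrow> complex" assume "f \<in> L2"
  then obtain g where "has_fourier f g" using has_fourier_exists by blast
  then show "f \<in> L2_spectrum UNIV" using has_fourier_L2(2) by (auto simp: L2_spectrum_iff L2_on_UNIV)
qed (simp add: L2_spectrum_def)

lemma orthonormal_basis_fourier:
  assumes "\<And>i. i \<in> I \<Longrightarrow> has_fourier (b i) (b' i)"
  shows "l2_orthonormal_basis I b (L2_spectrum S) \<Longrightarrow> l2_orthonormal_basis I b' (L2_on S)"
    and "l2_orthonormal_basis I b' (L2_on S) \<Longrightarrow> l2_orthonormal_basis I b (L2_spectrum S)"
proof -
  have 1: "{g. \<exists>f\<in>L2_spectrum S. has_fourier f g} = L2_on S"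
    using fourier_image_L2_spectrum[of S] by (simp add: fourier_image_def)
  have 2: "{f. \<exists>g\<in>L2_on S. has_fourier f g} = L2_spectrum S" by (auto simp: L2_spectrum_iff)
  show "l2_orthonormal_basis I b' (L2_on S)" if "l2_orthonormal_basis I b (L2_spectrum S)"
    using l2_unitary_orthonormal_basis[OF l2_unitary_fourier assms that] unfolding 1 .
  show "l2_orthonormal_basis I b (L2_spectrum S)" if "l2_orthonormal_basis I b' (L2_on S)"
    using l2_unitary_orthonormal_basis[OF l2_unitary_conversep[OF l2_unitary_fourier] assms that] unfolding 2 .
qed

lemma L2_spectrum_matrix_subset:
  fixes M :: "real^'n^'n"
  assumes M: "invertible M" and f: "f \<in> L2_spectrum K"
  shows "(\<lambda>x. f (M *v x)) \<in> L2_spectrum ((*v) (transpose M) ` K)"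
proof -
  obtain g where g: "g \<in> L2_on K" "has_fourier f g" using f by (auto simp: L2_spectrum_iff)
  let ?N = "matrix_inv (transpose M)"
  have MT: "invertible (transpose M)" by (rule invertible_transpose[OF M])
  note h = has_fourier_matrix[OF M g(2)]
  have "AE x in lebesgue. ?N *v x \<notin> K \<longrightarrow> g (?N *v x) = 0"
    using g(1) by (intro AE_matrix[OF invertible_matrix_inv[OF MT]]) (simp add: L2_on_def)
  then have "(\<lambda>l. of_real (1 / \<bar>det M\<bar>) * g (?N *v l)) \<in> L2_on ((*v) (transpose M) ` K)"
    using has_fourier_L2(2)[OF h] unfolding L2_on_def image_matrix[OF MT] by (auto elim: eventually_mono)
  then show ?thesis using h by (auto simp: L2_spectrum_iff)
qed

text \<open>One inclusion for \<open>M\<close>, applied also to its inverse, gives both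
  directions.\<close>

lemma L2_spectrum_matrix:
  fixes M :: "real^'n^'n"
  assumes M: "invertible M"
  shows "(\<lambda>f x. f (M *v x)) ` L2_spectrum K = L2_spectrum ((*v) (transpose M) ` K)"
proof (intro equalityI subsetI)
  fix f assume f: "f \<in> L2_spectrum ((*v) (transpose M) ` K)"
  have "(*v) (transpose (matrix_inv M)) ` (*v) (transpose M) ` K = K"
  proof -
    have "transpose (matrix_inv M) ** transpose M = mat 1"
      unfolding matrix_transpose_mul[symmetric] by (simp add: M matrix_inv_right transpose_mat)
    then show ?thesis unfolding image_image matrix_vector_mul_assoc by simp
  qed
  then have "(\<lambda>x. f (matrix_inv M *v x)) \<in> L2_spectrum K"
    using L2_spectrum_matrix_subset[OF invertible_matrix_inv[OF M] f] by simp
  then show "f \<in> (\<lambda>f x. f (M *v x)) ` L2_spectrum K"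
    by (rule rev_image_eqI) (simp add: M)
qed (use L2_spectrum_matrix_subset[OF M] in auto)

lemma scaling_spaces_eq:
  fixes A :: "real^'n^'n"
  assumes A: "invertible A"
  shows "scaling_spaces A K j = L2_spectrum ((*v) (matrix_zpow (transpose A) j) ` K)"
  unfolding scaling_spaces_def matrix_zpow_transpose[OF A]
  by (rule L2_spectrum_matrix[OF invertible_matrix_zpow[OF A]])

text \<open>A function in the complement can be tested against the inverse transform of its own
  spectral part in \<open>S\<close>; the resulting inner product is the squared norm of that
  part.\<close>

lemma orth_complement_L2_spectrum:
  fixes S S' :: "(real^'n) set"
  assumes S: "S \<in> sets lebesgue"
  shows "l2_orth_complement_in (L2_spectrum S') (L2_spectrum S) = L2_spectrum (S' - S)"
proof (intro equalityI subsetI)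
  fix f assume f: "f \<in> l2_orth_complement_in (L2_spectrum S') (L2_spectrum S)"
  then obtain g where g: "g \<in> L2_on S'" "has_fourier f g"
    by (auto simp: l2_orth_complement_in_def L2_spectrum_iff)
  note gL = has_fourier_L2(2)[OF g(2)]
  let ?h = "\<lambda>x. g x * indicator S x"
  have h: "?h \<in> L2_on S" by (rule L2_on_mult_indicator[OF gL S])
  then have hL: "?h \<in> L2" by (simp add: L2_on_def)
  note hF = has_fourier_inv_fourier[OF hL]
  have "l2_inner f (inv_fourier ?h) = 0"
    using f h hF by (auto simp: l2_orth_complement_in_def L2_spectrum_iff)
  then have "l2_inner g ?h = 0" using l2_unitary_inner[OF l2_unitary_fourier g(2) hF] by simp
  moreover have "l2_inner g ?h = l2_inner ?h ?h"
    unfolding l2_inner_def by (intro Bochner_Integration.integral_cong) (auto simp: indicator_def)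
  ultimately have "l2_norm ?h = 0" by (simp add: l2_inner_self)
  then have "AE x in lebesgue. ?h x = 0" using hL by (simp add: l2_norm_eq_0_iff)
  moreover have "AE x in lebesgue. x \<notin> S' \<longrightarrow> g x = 0" using g(1) by (simp add: L2_on_def)
  ultimately have "AE x in lebesgue. x \<notin> S' - S \<longrightarrow> g x = 0" by eventually_elim (auto split: split_indicator_asm)
  then have "g \<in> L2_on (S' - S)" using gL by (simp add: L2_on_def)
  then show "f \<in> L2_spectrum (S' - S)" using g(2) by (auto simp: L2_spectrum_iff)
next
  fix f assume "f \<in> L2_spectrum (S' - S)"
  then obtain g where g: "g \<in> L2_on (S' - S)" "has_fourier f g" by (auto simp: L2_spectrum_iff)
  have "g \<in> L2_on S'" using g(1) L2_on_mono[of "S' - S" S'] by auto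
  then have "f \<in> L2_spectrum S'" using g(2) by (auto simp: L2_spectrum_iff)
  moreover have "l2_inner f f' = 0" if f': "f' \<in> L2_spectrum S" for f'
  proof -
    obtain g' where g': "g' \<in> L2_on S" "has_fourier f' g'" using f' by (auto simp: L2_spectrum_iff)
    have "AE x in lebesgue. x \<notin> S' - S \<longrightarrow> g x = 0" "AE x in lebesgue. x \<notin> S \<longrightarrow> g' x = 0"
      using g(1) g'(1) by (simp_all add: L2_on_def)
    then have "AE x in lebesgue. g x * cnj (g' x) = 0" by eventually_elim auto
    then have "l2_inner g g' = 0" unfolding l2_inner_def by (rule integral_eq_zero_AE)
    then show ?thesis using l2_unitary_inner[OF l2_unitary_fourier g(2) g'(2)] by simp
  qed
  ultimately show "f \<in> l2_orth_complement_in (L2_spectrum S') (L2_spectrum S)"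
    by (simp add: l2_orth_complement_in_def)
qed

text \<open>Finite measure makes the indicator of \<open>S\<close> itself a test function. This
  turns the nesting of spaces into inclusion of sets.\<close>

lemma AE_subset_if_L2_spectrum_subset:
  assumes "L2_spectrum S \<subseteq> L2_spectrum S'" "S \<in> lmeasurable"
  shows "AE x in lebesgue. x \<in> S \<longrightarrow> x \<in> S'"
proof -
  have h: "has_fourier (inv_fourier (indicator S)) (indicator S)"
    by (rule has_fourier_inv_fourier[OF L2_indicator[OF assms(2)]])
  have "(indicator S :: real^'a \<Rightarrow> complex) \<in> L2_on S" using L2_indicator[OF assms(2)] by (simp add: L2_on_def)
  then have "inv_fourier (indicator S) \<in> L2_spectrum S" using h by (auto simp: L2_spectrum_iff)
  then have "inv_fourier (indicator S) \<in> L2_spectrum S'" using assms(1) by blast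
  then have "indicator S \<in> L2_on S'" using h by (rule L2_spectrum_has_fourier)
  then have "AE x in lebesgue. x \<notin> S' \<longrightarrow> (indicator S x :: complex) = 0" by (simp add: L2_on_def)
  then show ?thesis by eventually_elim (auto split: split_indicator_asm)
qed

text \<open>The constant 1 is not square integrable, so indicators of growing balls serve as test
  functions. Each is a limit of functions supported in the union, hence supported there
  itself.\<close>

lemma AE_UN_if_L2_spectrum_dense:
  fixes S :: "'i \<Rightarrow> (real^'n) set"
  assumes I: "countable I" and S: "\<And>i. i \<in> I \<Longrightarrow> S i \<in> sets lebesgue" and dense: "l2_closure (\<Union>i\<in>I. L2_spectrum (S i)) = L2"
  shows "AE x in lebesgue. \<exists>i\<in>I. x \<in> S i"
proof -
  let ?U = "\<Union>i\<in>I. S i"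
  have U: "?U \<in> sets lebesgue" using I S by (rule sets.countable_UN'')
  have V: "(\<Union>i\<in>I. L2_spectrum (S i)) \<subseteq> L2" by (auto simp: L2_spectrum_def)
  have "AE x in lebesgue. x \<in> ball 0 (real n) \<longrightarrow> x \<in> ?U" for n
  proof -
    let ?b = "indicator (ball 0 (real n)) :: real^'n \<Rightarrow> complex"
    have bL: "?b \<in> L2" by (rule L2_indicator) simp
    note bF = has_fourier_inv_fourier[OF bL]
    have "?b \<in> L2_on ?U"
    proof (rule L2_on_closed[OF U bL])
      fix e :: real assume "0 < e"
      moreover have "inv_fourier ?b \<in> l2_closure (\<Union>i\<in>I. L2_spectrum (S i))"
        unfolding dense using has_fourier_L2(1)[OF bF] .
      ultimately obtain f i where f: "i \<in> I" "f \<in> L2_spectrum (S i)" "l2_norm (\<lambda>x. inv_fourier ?b x - f x) < e"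
        unfolding l2_closure_iff[OF V] by blast
      then obtain g where g: "g \<in> L2_on (S i)" "has_fourier f g" by (auto simp: L2_spectrum_iff)
      have "g \<in> L2_on ?U" using g(1) L2_on_mono[of "S i" ?U] f(1) by auto
      moreover have "l2_norm (\<lambda>x. ?b x - g x) < e"
        using has_fourier_norm[OF has_fourier_diff[OF bF g(2)]] f(3) by simp
      ultimately show "\<exists>g\<in>L2_on ?U. l2_norm (\<lambda>x. ?b x - g x) < e" by blast
    qed
    then have "AE x in lebesgue. x \<notin> ?U \<longrightarrow> ?b x = 0" by (simp add: L2_on_def)
    then show ?thesis by eventually_elim (auto simp: indicator_def split: if_splits)
  qed
  then have "AE x in lebesgue. \<forall>n. x \<in> ball 0 (real n) \<longrightarrow> x \<in> ?U" by (simp only: AE_all_countable) simp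
  then show ?thesis
  proof eventually_elim
    case (elim x)
    obtain n where "norm x < real n" using reals_Archimedean2 by blast
    then show ?case using elim by auto
  qed
qed

text \<open>The inverse transform of the indicator of the intersection belongs to every space in the
  family, so it vanishes, and by Plancherel so does the indicator.\<close>

lemma AE_not_INT_if_L2_spectrum_trivial:
  fixes S :: "'i \<Rightarrow> (real^'n) set"
  assumes I: "countable I" "i \<in> I" and S: "\<And>i. i \<in> I \<Longrightarrow> S i \<in> sets lebesgue" "S i \<in> lmeasurable"
    and triv: "(\<Inter>i\<in>I. L2_spectrum (S i)) \<subseteq> {f. AE x in lebesgue. f x = 0}"
  shows "AE x in lebesgue. \<exists>i\<in>I. x \<notin> S i"
proof -
  let ?D = "\<Inter>i\<in>I. S i"
  have D: "?D \<in> sets lebesgue" using I S by (intro sets.countable_INT'') auto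
  have "S i \<inter> ?D \<in> lmeasurable" by (rule fmeasurable_Int_fmeasurable[OF S(2) D])
  moreover have "S i \<inter> ?D = ?D" using I(2) by blast
  ultimately have Dm: "?D \<in> lmeasurable" by simp
  let ?d = "indicator ?D :: real^'n \<Rightarrow> complex"
  have dL: "?d \<in> L2" by (rule L2_indicator[OF Dm])
  note dF = has_fourier_inv_fourier[OF dL]
  have "?d \<in> L2_on (S i)" if "i \<in> I" for i using dL that by (auto simp: L2_on_def indicator_def)
  then have "inv_fourier ?d \<in> (\<Inter>i\<in>I. L2_spectrum (S i))" using dF by (auto simp: L2_spectrum_iff)
  then have "AE x in lebesgue. inv_fourier ?d x = 0" using triv by blast
  then have "l2_norm (inv_fourier ?d) = 0" using has_fourier_L2(1)[OF dF] by (simp add: l2_norm_eq_0_iff)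
  then have "l2_norm ?d = 0" using has_fourier_norm[OF dF] by simp
  then have "AE x in lebesgue. ?d x = 0" using dL by (simp add: l2_norm_eq_0_iff)
  then show ?thesis by eventually_elim (auto simp: indicator_def split: if_splits)
qed

section \<open>The tiling property of the wavelet sets\<close>

lemma coset_representatives_Ex1:
  assumes H: "additive_subgroup H" and c: "coset_representatives G H q v" and s: "s \<in> G"
  shows "\<exists>!i. i < q \<and> v i - s \<in> H"
proof -
  have v: "v i \<in> G" if "i < q" for i using c that by (auto simp: coset_representatives_def)
  have bij: "bij_betw (\<lambda>i. coset_rel G H `` {v i}) {..<q} (G // coset_rel G H)"
    using c by (simp add: coset_representatives_def)
  have "coset_rel G H `` {s} \<in> G // coset_rel G H" using s by (rule quotientI)
  then have "coset_rel G H `` {s} \<in> (\<lambda>i. coset_rel G H `` {v i}) ` {..<q}"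
    using bij by (simp add: bij_betw_def)
  then obtain i where "i \<in> {..<q}" "coset_rel G H `` {s} = coset_rel G H `` {v i}" by (rule imageE)
  then have i: "i < q" "coset_rel G H `` {v i} = coset_rel G H `` {s}" by simp_all
  have "s \<in> coset_rel G H `` {s}" using s additive_subgroupD(1)[OF H] by (simp add: coset_rel_def)
  then have "s \<in> coset_rel G H `` {v i}" unfolding i(2) .
  then have vi: "v i - s \<in> H" by (simp add: coset_rel_def)
  show ?thesis
  proof (rule ex1I[of _ i])
    show "i < q \<and> v i - s \<in> H" using i vi by simp
    fix j assume j: "j < q \<and> v j - s \<in> H"
    have vij: "v i - v j \<in> H" "v j - v i \<in> H"
      using additive_subgroupD(4)[OF H, of "v i - s" "v j - s"] additive_subgroupD(4)[OF H, of "v j - s" "v i - s"] vi j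
      by simp_all
    have "v i - y \<in> H \<longleftrightarrow> v j - y \<in> H" for y
      using additive_subgroupD(3)[OF H vij(1), of "v j - y"] additive_subgroupD(3)[OF H vij(2), of "v i - y"] by auto
    then have "coset_rel G H `` {v i} = coset_rel G H `` {v j}"
      using v i(1) j by (auto simp: coset_rel_def)
    then show "j = i" using bij i(1) j by (auto simp: bij_betw_def inj_on_def)
  qed
qed

text \<open>For \<open>w = v\<^sub>i\<close> this is the set \<open>\<Omega>\<^sub>i\<close>.\<close>

definition wavelet_piece :: "real^'n^'n \<Rightarrow> (real^'n) set \<Rightarrow> (real^'n) set \<Rightarrow> real^'n \<Rightarrow> (real^'n) set" where
  "wavelet_piece B T K w = {x \<in> (*v) B ` K. \<exists>u\<in>(*v) B ` T. x + (u - w) \<in> K}"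

text \<open>Multiplication by \<open>B\<close> clears the inverses; the lattice vector changes sign
  because it is moved to the side of \<open>x\<close>.\<close>

lemma image_frequency_piece:
  fixes B :: "real^'n^'n"
  assumes B: "invertible B" and T: "additive_subgroup T"
  shows "(*v) B ` frequency_piece B T K w = wavelet_piece B T K w"
proof (rule set_eqI)
  fix x
  have "(\<exists>k t. matrix_inv B *v x = matrix_inv B *v k + matrix_inv B *v w + t \<and> k \<in> K \<and> t \<in> T)
      \<longleftrightarrow> (\<exists>u\<in>(*v) B ` T. x + (u - w) \<in> K)"
  proof
    assume "\<exists>k t. matrix_inv B *v x = matrix_inv B *v k + matrix_inv B *v w + t \<and> k \<in> K \<and> t \<in> T"
    then obtain k t where kt: "matrix_inv B *v x = matrix_inv B *v k + matrix_inv B *v w + t" "k \<in> K" "t \<in> T" by blast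
    have "x = k + w + B *v t"
      using arg_cong[OF kt(1), of "(*v) B"] B by (simp add: matrix_vector_right_distrib)
    then have "x + (B *v (- t) - w) = k" by (simp add: matrix_vector_mult_diff_distrib[of B 0, simplified])
    then show "\<exists>u\<in>(*v) B ` T. x + (u - w) \<in> K"
      using kt additive_subgroupD(2)[OF T kt(3)] by (intro bexI[of _ "B *v (- t)"]) auto
  next
    assume "\<exists>u\<in>(*v) B ` T. x + (u - w) \<in> K"
    then obtain t where t: "t \<in> T" "x + (B *v t - w) \<in> K" by blast
    have "matrix_inv B *v x = matrix_inv B *v (x + (B *v t - w)) + matrix_inv B *v w + (- t)"
      using B by (simp add: matrix_vector_right_distrib matrix_vector_mult_diff_distrib)
    then show "\<exists>k t. matrix_inv B *v x = matrix_inv B *v k + matrix_inv B *v w + t \<and> k \<in> K \<and> t \<in> T"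
      using t additive_subgroupD(2)[OF T t(1)] by blast
  qed
  then show "x \<in> (*v) B ` frequency_piece B T K w \<longleftrightarrow> x \<in> wavelet_piece B T K w"
    unfolding wavelet_piece_def image_matrix[OF B] frequency_piece_def by auto
qed

lemma additive_subgroup_image_matrix:
  fixes B :: "real^'n^'m"
  assumes "additive_subgroup T" shows "additive_subgroup ((*v) B ` T)"
  using assms unfolding additive_subgroup_def
  by (auto simp flip: matrix_vector_mult_diff_distrib intro: image_eqI[of _ _ 0])

lemma tiles_image_matrix:
  fixes B :: "real^'n^'n"
  assumes B: "invertible B" and K: "tiles T K"
  shows "tiles ((*v) B ` T) ((*v) B ` K)"
  using AE_matrix[OF invertible_matrix_inv[OF B] K[unfolded tiles_def]] unfolding tiles_def
proof eventually_elim
  case (elim x)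
  then obtain s where s: "s \<in> T" "matrix_inv B *v x + s \<in> K"
    "\<And>u. u \<in> T \<Longrightarrow> matrix_inv B *v x + u \<in> K \<Longrightarrow> u = s" by blast
  have iff: "x + B *v u \<in> (*v) B ` K \<longleftrightarrow> matrix_inv B *v x + u \<in> K" for u
    unfolding image_matrix[OF B] using B by (simp add: matrix_vector_right_distrib)
  show ?case
  proof (rule ex1I[of _ "B *v s"])
    show "B *v s \<in> (*v) B ` T \<and> x + B *v s \<in> (*v) B ` K" unfolding iff using s(1,2) by blast
    show "u = B *v s" if u: "u \<in> (*v) B ` T \<and> x + u \<in> (*v) B ` K" for u
    proof -
      obtain u' where u': "u = B *v u'" "u' \<in> T" using u by blast
      then have "u' = s" using u iff s(3)[OF u'(2)] by simp
      then show ?thesis using u'(1) by simp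
    qed
  qed
qed

text \<open>Collects what the argument about sets needs, without function spaces. The last condition
  is the inclusion of \<open>V 0\<close> in \<open>V 1\<close> read on the frequency side.\<close>

locale wavelet_tiling =
  fixes B :: "real^'n^'n" and T K :: "(real^'n) set"
  assumes B: "invertible B" and T: "countable T" "additive_subgroup T" and BT: "(*v) B ` T \<subseteq> T"
    and K: "K \<in> sets lebesgue" "tiles T K" and KB: "AE x in lebesgue. x \<in> K \<longrightarrow> x \<in> (*v) B ` K"
begin

lemmas subgroup_BT = additive_subgroup_image_matrix[OF T(2), of B]

lemma wavelet_piece_sets: "wavelet_piece B T K w \<in> sets lebesgue"
proof -
  have "{x. x + a \<in> K} \<in> sets lebesgue" for a
    using measurable_sets[OF measurable_translation_lebesgue K(1), of a] by (simp add: vimage_def add.commute)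
  then have "(*v) B ` K \<inter> (\<Union>u\<in>(*v) B ` T. {x. x + (u - w) \<in> K}) \<in> sets lebesgue"
    using T(1) by (intro sets.Int sets_image_matrix[OF B K(1)] sets.countable_UN'') auto
  also have "(*v) B ` K \<inter> (\<Union>u\<in>(*v) B ` T. {x. x + (u - w) \<in> K}) = wavelet_piece B T K w"
    by (auto simp: wavelet_piece_def)
  finally show ?thesis .
qed

text \<open>As \<open>u - w\<close> lies in \<open>T\<close>, it must be the unique vector
  \<open>s\<close> that takes \<open>x\<close> into \<open>K\<close>. Membership thereby becomes a
  congruence modulo the sublattice \<open>B T\<close>.\<close>

lemma wavelet_piece_iff:
  assumes w: "w \<in> T" and s: "s \<in> T" "x + s \<in> K" "\<And>u. u \<in> T \<Longrightarrow> x + u \<in> K \<Longrightarrow> u = s"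
  shows "x \<in> wavelet_piece B T K w \<longleftrightarrow> x \<in> (*v) B ` K \<and> s + w \<in> (*v) B ` T"
proof -
  have "(\<exists>u\<in>(*v) B ` T. x + (u - w) \<in> K) \<longleftrightarrow> s + w \<in> (*v) B ` T"
  proof
    assume "\<exists>u\<in>(*v) B ` T. x + (u - w) \<in> K"
    then obtain u where u: "u \<in> (*v) B ` T" "x + (u - w) \<in> K" by blast
    then have "u - w = s" using BT additive_subgroupD(4)[OF T(2) _ w] by (intro s(3)) auto
    then have "s + w = u" by auto
    then show "s + w \<in> (*v) B ` T" using u(1) by simp
  next
    assume "s + w \<in> (*v) B ` T"
    then show "\<exists>u\<in>(*v) B ` T. x + (u - w) \<in> K" using s(2) by (intro bexI[of _ "s + w"]) auto
  qed
  then show ?thesis by (auto simp: wavelet_piece_def)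
qed

text \<open>If \<open>s\<close> takes \<open>x\<close> into \<open>K\<close>, then
  \<open>x + r\<close> can lie in the piece only for \<open>r\<close> in the coset of
  \<open>s + w\<close> modulo \<open>B T\<close>. Within this coset the tiling by \<open>B K\<close>
  under \<open>B T\<close> singles out exactly one \<open>r\<close>.\<close>

lemma tiles_wavelet_piece:
  assumes w: "w \<in> T" shows "tiles T (wavelet_piece B T K w)"
proof -
  let ?BK = "(*v) B ` K" and ?BT = "(*v) B ` T"
  have "AE x in lebesgue. \<forall>r\<in>T. \<exists>!u. u \<in> ?BT \<and> (x + r) + u \<in> ?BK"
    by (rule AE_all_translates[OF T(1)]) (use tiles_image_matrix[OF B K(2)] in \<open>simp add: tiles_def\<close>)
  with K(2)[unfolded tiles_def] show ?thesis unfolding tiles_def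
  proof eventually_elim
    case (elim x)
    obtain s where s: "s \<in> T" "x + s \<in> K" "\<And>u. u \<in> T \<Longrightarrow> x + u \<in> K \<Longrightarrow> u = s" using elim(1) by blast
    have iff: "x + r \<in> wavelet_piece B T K w \<longleftrightarrow> x + r \<in> ?BK \<and> (s - r) + w \<in> ?BT" if r: "r \<in> T" for r
    proof (rule wavelet_piece_iff[OF w])
      show "s - r \<in> T" using s(1) r by (rule additive_subgroupD(4)[OF T(2)])
      show "x + r + (s - r) \<in> K" using s(2) by simp
      show "u = s - r" if "u \<in> T" "x + r + u \<in> K" for u
        using s(3)[of "r + u"] that additive_subgroupD(3)[OF T(2) r] by (auto simp: add.assoc)
    qed
    have sw: "s + w \<in> T" using additive_subgroupD(3)[OF T(2) s(1) w] .
    obtain u where u: "u \<in> ?BT" "x + (s + w) + u \<in> ?BK" "\<And>u'. u' \<in> ?BT \<Longrightarrow> x + (s + w) + u' \<in> ?BK \<Longrightarrow> u' = u"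
      using bspec[OF elim(2) sw] by blast
    have rT: "s + w + u \<in> T" using additive_subgroupD(3)[OF T(2) sw, of u] u(1) BT by blast
    show ?case
    \<comment> \<open>Here \<open>s + w\<close> selects the coset and \<open>u\<close> is the vector
      of \<open>B T\<close> that moves \<open>x + (s + w)\<close> into \<open>B K\<close>.\<close>
    proof (rule ex1I[of _ "s + w + u"])
      have "s - (s + w + u) + w = - u" by simp
      then show "s + w + u \<in> T \<and> x + (s + w + u) \<in> wavelet_piece B T K w"
        using rT u(2) additive_subgroupD(2)[OF subgroup_BT u(1)] by (simp add: iff add.assoc)
      fix r assume r: "r \<in> T \<and> x + r \<in> wavelet_piece B T K w"
      then have r': "x + r \<in> ?BK" "s - r + w \<in> ?BT" using iff by auto
      have "r - (s + w) = u"
      proof (rule u(3))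
        have "- (s - r + w) \<in> ?BT" by (rule additive_subgroupD(2)[OF subgroup_BT r'(2)])
        then show "r - (s + w) \<in> ?BT" by (simp add: algebra_simps)
        show "x + (s + w) + (r - (s + w)) \<in> ?BK" using r'(1) by simp
      qed
      then show "r = s + w + u" by auto
    qed
  qed
qed

text \<open>For \<open>w\<close> in \<open>B T\<close> the choice \<open>u = w\<close> shows that
  almost all of \<open>K\<close> lies in the piece. Both sets tile under \<open>T\<close>, and a
  tile cannot properly contain another up to null sets.\<close>

lemma wavelet_piece_trivial:
  assumes w: "w \<in> (*v) B ` T"
  shows "AE x in lebesgue. x \<in> wavelet_piece B T K w \<longleftrightarrow> x \<in> K"
proof -
  have wT: "w \<in> T" using w BT by blast
  have "AE x in lebesgue. \<forall>s\<in>T. x + s \<in> K \<longrightarrow> x + s \<in> (*v) B ` K"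
    by (rule AE_all_translates[OF T(1) KB])
  with K(2)[unfolded tiles_def] tiles_wavelet_piece[OF wT, unfolded tiles_def]
  show ?thesis
  proof eventually_elim
    case (elim x)
    have sub: "x + s \<in> wavelet_piece B T K w" if "s \<in> T" "x + s \<in> K" for s
    proof -
      have "\<exists>u\<in>(*v) B ` T. x + s + (u - w) \<in> K" using w that(2) by (intro bexI[of _ w]) simp_all
      then show ?thesis using elim(3) that unfolding wavelet_piece_def by simp
    qed
    obtain s where s: "s \<in> T" "x + s \<in> K" using elim(1) by blast
    show ?case
    proof
      assume "x \<in> wavelet_piece B T K w"
      then have "0 \<in> T \<and> x + 0 \<in> wavelet_piece B T K w" using additive_subgroupD(1)[OF T(2)] by simp
      then have "s = 0" using elim(2) sub[OF s] s(1) by blast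
      then show "x \<in> K" using s(2) by simp
    next
      assume "x \<in> K"
      then show "x \<in> wavelet_piece B T K w" using sub[of 0] additive_subgroupD(1)[OF T(2)] by simp
    qed
  qed
qed

text \<open>By the congruence criterion the index is determined by the coset of \<open>- s\<close>,
  which has exactly one representative among the \<open>v i\<close>.\<close>

lemma wavelet_pieces_partition:
  assumes c: "coset_representatives T ((*v) B ` T) q v"
  shows "AE x in lebesgue. x \<in> (*v) B ` K \<longrightarrow> (\<exists>!i. i < q \<and> x \<in> wavelet_piece B T K (v i))"
  using K(2)[unfolded tiles_def]
proof eventually_elim
  case (elim x)
  obtain s where s: "s \<in> T" "x + s \<in> K" "\<And>u. u \<in> T \<Longrightarrow> x + u \<in> K \<Longrightarrow> u = s" using elim by blast
  have v: "v i \<in> T" if "i < q" for i using c that by (simp add: coset_representatives_def)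
  show ?case
  proof
    assume x: "x \<in> (*v) B ` K"
    have "x \<in> wavelet_piece B T K (v i) \<longleftrightarrow> v i - (- s) \<in> (*v) B ` T" if "i < q" for i
      using wavelet_piece_iff[OF v[OF that] s] x by (simp add: add.commute)
    then show "\<exists>!i. i < q \<and> x \<in> wavelet_piece B T K (v i)"
      using coset_representatives_Ex1[OF subgroup_BT c additive_subgroupD(2)[OF T(2) s(1)]] by (auto cong: conj_cong)
  qed
qed

end

section \<open>Dilated bases and the wavelet theorem\<close>

lemma l2_orthonormal_basis_cong:
  assumes "\<And>i. i \<in> I \<Longrightarrow> b i = b' i" and "l2_orthonormal_basis I b V"
  shows "l2_orthonormal_basis I b' V"
proof -
  have sub: "l2_span I b \<subseteq> l2_span I b'" if "\<And>i. i \<in> I \<Longrightarrow> b i = b' i" for b b' :: "'a \<Rightarrow> real^'b \<Rightarrow> complex"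
  proof
    fix f assume "f \<in> l2_span I b"
    then obtain F c where F: "finite F" "F \<subseteq> I" "f = (\<lambda>x. \<Sum>i\<in>F. c i * b i x)"
      unfolding l2_span_def by blast
    have "f = (\<lambda>x. \<Sum>i\<in>F. c i * b' i x)"
      unfolding F(3) using that F(2) by (intro ext sum.cong) auto
    then show "f \<in> l2_span I b'" unfolding l2_span_def using F(1,2) by blast
  qed
  have "l2_span I b = l2_span I b'" by (intro equalityI sub) (simp_all add: assms(1))
  then show ?thesis using assms by (simp add: l2_orthonormal_basis_def)
qed

lemma dilate_L2_on:
  fixes M :: "real^'n^'n"
  assumes M: "invertible M"
  shows "{g. \<exists>f\<in>L2_on S. f \<in> L2 \<and> g = dilate M f} = L2_on {x. M *v x \<in> S}"
proof (intro equalityI subsetI)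
  fix g assume "g \<in> {g. \<exists>f\<in>L2_on S. f \<in> L2 \<and> g = dilate M f}"
  then obtain f where f: "f \<in> L2_on S" "f \<in> L2" "g = dilate M f" by blast
  have "AE x in lebesgue. M *v x \<notin> S \<longrightarrow> f (M *v x) = 0"
    by (rule AE_matrix[OF M]) (use f(1) in \<open>simp add: L2_on_def\<close>)
  moreover have "g \<in> L2" using l2_unitaryD(2)[OF l2_unitary_dilate[OF M]] f by blast
  ultimately show "g \<in> L2_on {x. M *v x \<in> S}"
    unfolding L2_on_def f(3) dilate_def by (auto elim: eventually_mono)
next
  fix g assume g: "g \<in> L2_on {x. M *v x \<in> S}"
  then have "g \<in> L2" by (simp add: L2_on_def)
  then obtain f where f: "f \<in> L2" "g = dilate M f" using l2_unitaryD(7)[OF l2_unitary_dilate[OF M]] by blast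
  have "AE x in lebesgue. matrix_inv M *v x \<notin> {x. M *v x \<in> S} \<longrightarrow> g (matrix_inv M *v x) = 0"
    by (rule AE_matrix[OF invertible_matrix_inv[OF M]]) (use g in \<open>simp add: L2_on_def\<close>)
  then have "AE x in lebesgue. x \<notin> S \<longrightarrow> f x = 0"
    using M by (simp add: f(2) dilate_def invertible_det_nz)
  then have "f \<in> L2_on S" using f(1) by (simp add: L2_on_def)
  then show "g \<in> {g. \<exists>f\<in>L2_on S. f \<in> L2 \<and> g = dilate M f}" using f by blast
qed

text \<open>An upward closed set of integers that is neither empty nor everything has a unique first
  element. Applied to the scales \<open>j\<close> whose set \<open>S j\<close> contains a given
  point, this singles out one dilate of \<open>W\<close>.\<close>

lemma int_Ex1_switch:
  fixes P :: "int \<Rightarrow> bool"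
  assumes step: "\<And>j. P j \<Longrightarrow> P (j + 1)" and a: "P a" and b: "\<not> P b"
  shows "\<exists>!j. P (j + 1) \<and> \<not> P j"
proof -
  have mono: "P j" if "i \<le> j" "P i" for i j
    using that by (induction j rule: int_ge_induct) (auto intro: step)
  have "\<exists>j. P (j + 1) \<and> \<not> P j"
  proof (rule ccontr)
    assume "\<nexists>j. P (j + 1) \<and> \<not> P j"
    then have down: "P j" if "P (j + 1)" for j using that by blast
    have "P j" if "j \<le> a" for j
      using that
    proof (induction j rule: int_le_induct)
      case (step i)
      then show ?case using down[of "i - 1"] by simp
    qed (rule a)
    then show False using mono[of "min a b" b] b by simp
  qed
  then obtain j where j: "P (j + 1)" "\<not> P j" by blast
  show ?thesis
  proof (rule ex1I[of _ j])
    show "P (j + 1) \<and> \<not> P j" using j by blast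
    show "k = j" if k: "P (k + 1) \<and> \<not> P k" for k
    proof (rule ccontr)
      assume "k \<noteq> j"
      then consider "k + 1 \<le> j" | "j + 1 \<le> k" by linarith
      then show False using mono j k by cases blast+
    qed
  qed
qed

text \<open>The wavelet normalization makes the time side dilation unitary, so its frequency side
  must be the unitary \<open>dilate\<close> by the inverse transposed power.\<close>

lemma has_fourier_dilate:
  fixes A :: "real^'n^'n"
  assumes A: "invertible A" and h: "has_fourier f g"
  shows "has_fourier (\<lambda>x. of_real (\<bar>det A\<bar> powr (of_int j / 2)) * f (matrix_zpow A j *v x))
    (dilate (matrix_inv (matrix_zpow (transpose A) j)) g)"
proof -
  let ?M = "matrix_zpow A j" and ?N = "matrix_inv (matrix_zpow (transpose A) j)"
  have M: "invertible ?M" by (rule invertible_matrix_zpow[OF A])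
  have d: "0 < \<bar>det A\<bar>" using A by (simp add: invertible_det_nz)
  have "det (transpose ?M) * det (matrix_inv (transpose ?M)) = 1"
    unfolding det_mul[symmetric] matrix_inv_right[OF invertible_transpose[OF M]] by simp
  then have "\<bar>det ?M\<bar> * \<bar>det ?N\<bar> = 1"
    by (simp add: matrix_zpow_transpose[OF A] det_transpose flip: abs_mult)
  then have "\<bar>det ?N\<bar> = 1 / \<bar>det ?M\<bar>" by (metis mult_zero_left nonzero_eq_divide_eq mult.commute zero_neq_one)
  also have "\<dots> = \<bar>det A\<bar> powr (- of_int j)"
    unfolding abs_det_matrix_zpow[OF A] by (simp add: powr_minus divide_inverse)
  finally have "sqrt \<bar>det ?N\<bar> = \<bar>det A\<bar> powr (- of_int j / 2)"
    using d by (simp add: powr_half_sqrt[symmetric] powr_powr)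
  \<comment> \<open>The normalizing exponent \<open>j / 2\<close> combines with the Jacobian
    exponent \<open>- j\<close> to \<open>- j / 2\<close>, the square root of the frequency side
    determinant.\<close>
  also have "\<dots> = \<bar>det A\<bar> powr (of_int j / 2 - of_int j)" by (simp add: field_simps)
  also have "\<dots> = \<bar>det A\<bar> powr (of_int j / 2) * (1 / \<bar>det ?M\<bar>)"
    unfolding abs_det_matrix_zpow[OF A] by (simp only: powr_diff divide_inverse mult_1_left)
  finally have c: "complex_of_real (sqrt \<bar>det ?N\<bar>) = of_real (\<bar>det A\<bar> powr (of_int j / 2)) * of_real (1 / \<bar>det ?M\<bar>)"
    by (simp only: of_real_mult)
  show ?thesis
    using has_fourier_cmult[OF has_fourier_matrix[OF M h], of "of_real (\<bar>det A\<bar> powr (of_int j / 2))"]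
    unfolding dilate_def[abs_def] c by (simp add: matrix_zpow_transpose[OF A] mult.assoc)
qed

theorem theorem3p5:
  fixes A B :: "real^'n^'n"
    and T K :: "(real^'n) set"
    and q :: nat
    and v :: "nat \<Rightarrow> real^'n"
    and K' \<Omega> :: "nat \<Rightarrow> (real^'n) set"
  assumes "invertible A"
    and "expansive A"
    and "B = transpose A"
    and "full_rank_lattice T"
    and "(*v) B ` T \<subseteq> T"
    and "real q = \<bar>det B\<bar>"
    and "coset_representatives T ((*v) B ` T) q v"
    and "v 0 \<in> (*v) B ` T"
    and "scaling_set A (dual_lattice T) K"
    and "\<And>i. i < q \<Longrightarrow> K' i = frequency_piece B T K (v i)"
    and "\<And>i. i < q \<Longrightarrow> \<Omega> i = (*v) B ` K' i"
  shows "(fourier_image (scaling_spaces A K 0) = L2_on K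
          \<and> (\<forall>j. fourier_image (scaling_spaces A K j) = L2_on ((*v) (matrix_zpow B j) ` K)))
       \<and> smra_multiwavelet A (dual_lattice T) (scaling_spaces A K) (q - 1)
            (\<lambda>i. inv_fourier (indicator (\<Omega> i)))"
proof -
  note A = assms(1) and reps = assms(7)
  let ?D = "dual_lattice T" and ?V = "scaling_spaces A K"
  define S where "S j = (*v) (matrix_zpow B j) ` K" for j
  define N where "N j = matrix_inv (matrix_zpow B j)" for j
  have B: "invertible B" unfolding assms(3) by (rule invertible_transpose[OF A])
  note Bj = invertible_matrix_zpow[OF B]
  have Ninv: "invertible (N j)" for j unfolding N_def by (rule invertible_matrix_inv[OF Bj])
  have V: "?V j = L2_spectrum (S j)" for j
    unfolding S_def assms(3) by (rule scaling_spaces_eq[OF A])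
  have S0: "S 0 = K" by (simp add: S_def)
  have S1: "S 1 = (*v) B ` K" using matrix_zpow_add_1[OF B, of 0] by (simp add: S_def)
  have Ks: "K \<in> sets lebesgue" and K1: "emeasure lebesgue K = 1" and mra: "mra A ?D ?V"
    and sf: "scaling_function ?D (?V 0) (inv_fourier (indicator K))"
    using assms(9) by (auto simp: scaling_set_def)
  have Km: "K \<in> lmeasurable" using Ks K1 by (auto simp: fmeasurable_def)
  have pre: "pre_mra A ?D ?V" and dense: "l2_closure (\<Union>j. ?V j) = L2" using mra by (auto simp: mra_def)
  have S_sets: "S j \<in> sets lebesgue" for j unfolding S_def by (rule sets_image_matrix[OF Bj Ks])
  have waves: "has_fourier (\<lambda>x. inv_fourier (indicator E) (x + t)) (\<lambda>l. wave t l * indicator E l)"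
    if "E \<in> lmeasurable" for E and t :: "real^'n"
    by (intro has_fourier_translation has_fourier_inv_fourier L2_indicator that)
  have onbK: "l2_orthonormal_basis ?D (\<lambda>t l. wave t l * indicator K l) (L2_on K)"
    by (rule orthonormal_basis_fourier(1)[where b = "\<lambda>t x. inv_fourier (indicator K) (x + t)"])
      (use sf waves[OF Km] in \<open>simp_all add: scaling_function_def V S0\<close>)
  have tilesK: "tiles T K" by (rule tiles_if_orthonormal_waves[OF assms(4) Ks K1 onbK])
  obtain P where P: "invertible P" "T = lattice_of P" using assms(4) by (rule full_rank_latticeE)
  have Tc: "countable T" "additive_subgroup T" unfolding P(2) by (rule countable_lattice_of additive_subgroup_lattice_of)+
  have "?V 0 \<subseteq> ?V (0 + 1)" using pre unfolding pre_mra_def by blast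
  then have "L2_spectrum K \<subseteq> L2_spectrum ((*v) B ` K)" by (simp add: V S0 S1)
  then have KB: "AE x in lebesgue. x \<in> K \<longrightarrow> x \<in> (*v) B ` K"
    by (rule AE_subset_if_L2_spectrum_subset[OF _ Km])
  interpret wavelet_tiling B T K
    using B Tc assms(5) Ks tilesK KB by unfold_locales
  have \<Omega>: "\<Omega> i = wavelet_piece B T K (v i)" if "i < q" for i
    using image_frequency_piece[OF B Tc(2)] assms(10,11)[OF that] by simp
  have vT: "v i \<in> T" if "i < q" for i using reps that by (simp add: coset_representatives_def)
  have \<Omega>_sets: "\<Omega> i \<in> sets lebesgue" if "i < q" for i unfolding \<Omega>[OF that] by (rule wavelet_piece_sets)
  have \<Omega>_tiles: "tiles T (\<Omega> i)" if "i < q" for i unfolding \<Omega>[OF that] by (rule tiles_wavelet_piece[OF vT[OF that]])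
  \<comment> \<open>Tiles under the same lattice have equal measure, so each
    \<open>\<Omega> i\<close> has measure 1 like \<open>K\<close>, and its indicator has an inverse
    transform.\<close>
  have \<Omega>m: "\<Omega> i \<in> lmeasurable" if "i < q" for i
    using emeasure_tiles_eq[OF Tc \<Omega>_tiles[OF that] \<Omega>_sets[OF that] tilesK Ks] \<Omega>_sets[OF that] K1
    by (auto simp: fmeasurable_def)
  have onb\<Omega>: "l2_orthonormal_basis ?D (\<lambda>t l. wave t l * indicator (\<Omega> i) l) (L2_on (\<Omega> i))" if "i < q" for i
    by (rule orthonormal_waves_tiles[OF Tc tilesK Km \<Omega>_tiles[OF that] \<Omega>_sets[OF that] _ onbK])
      (simp add: dual_lattice_def)
  have "0 < real q" unfolding assms(6) using B by (simp add: invertible_det_nz)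
  then have q: "0 < q" by simp
  define W where "W = (*v) B ` K - K"
  have part: "AE x in lebesgue. x \<in> (*v) B ` K \<longrightarrow> (\<exists>!i. i < q \<and> x \<in> \<Omega> i)"
    using wavelet_pieces_partition[OF reps] by (simp add: \<Omega> cong: conj_cong)
  have \<Omega>_sub: "\<Omega> i \<subseteq> (*v) B ` K" if "i < q" for i using \<Omega>[OF that] by (auto simp: wavelet_piece_def)
  have disj: "AE x in lebesgue. \<not> (x \<in> \<Omega> i \<and> x \<in> \<Omega> j)" if "i < q" "j < q" "i \<noteq> j" for i j
    using part by eventually_elim (use that \<Omega>_sub in blast)
  \<comment> \<open>Because \<open>v 0\<close> represents the trivial coset,
    \<open>\<Omega> 0\<close> is \<open>K\<close> up to a null set. This is why the wavelets are
    numbered from 1 and there are \<open>q - 1\<close> of them.\<close>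
  have W_eq: "AE x in lebesgue. x \<in> (\<Union>i\<in>{1..q - 1}. \<Omega> i) \<longleftrightarrow> x \<in> W"
    using part wavelet_piece_trivial[OF assms(8)]
  proof eventually_elim
    case (elim x)
    then have x0: "x \<in> \<Omega> 0 \<longleftrightarrow> x \<in> K" using \<Omega>[OF q] by simp
    show ?case
    proof
      assume "x \<in> (\<Union>i\<in>{1..q - 1}. \<Omega> i)"
      then obtain i where i: "1 \<le> i" "i < q" "x \<in> \<Omega> i" using q by auto
      then have xB: "x \<in> (*v) B ` K" using \<Omega>_sub by blast
      have "x \<notin> \<Omega> 0"
      proof
        assume "x \<in> \<Omega> 0"
        then have "i = 0" using elim(1) xB i(2,3) q by blast
        then show False using i(1) by simp
      qed
      then show "x \<in> W" using xB x0 by (simp add: W_def)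
    next
      assume x: "x \<in> W"
      then obtain i where i: "i < q" "x \<in> \<Omega> i" using elim(1) by (auto simp: W_def)
      have "i \<noteq> 0"
      proof
        assume "i = 0"
        then show False using i(2) x x0 by (simp add: W_def)
      qed
      then show "x \<in> (\<Union>i\<in>{1..q - 1}. \<Omega> i)" using i by (intro UN_I[of i]) auto
    qed
  qed
  define b where "b k l = wave (snd k) l * indicator (\<Omega> (fst k)) l" for k and l :: "real^'n"
  have onbW: "l2_orthonormal_basis ({1..q - 1} \<times> ?D) b (L2_on W)"
  proof -
    have "l2_orthonormal_basis ({1..q - 1} \<times> ?D) b (L2_on (\<Union>i\<in>{1..q - 1}. \<Omega> i))"
    proof (rule l2_orthonormal_basis_UN[where p = fst])
      fix i assume i: "i \<in> {1..q - 1}"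
      then have iq: "i < q" using q by auto
      have "bij_betw snd {k \<in> {1..q - 1} \<times> ?D. fst k = i} ?D"
        by (rule bij_betw_byWitness[where f' = "\<lambda>t. (i, t)"]) (use i in auto)
      from l2_orthonormal_basis_reindex[OF this onb\<Omega>[OF iq]]
      show "l2_orthonormal_basis {k \<in> {1..q - 1} \<times> ?D. fst k = i} b (L2_on (\<Omega> i))"
        by (rule l2_orthonormal_basis_cong[rotated]) (auto simp: b_def)
    qed (use q \<Omega>_sets disj in auto)
    then show ?thesis unfolding L2_on_cong[OF W_eq] .
  qed
  have b_fourier: "has_fourier (\<lambda>x. inv_fourier (indicator (\<Omega> (fst k))) (x + snd k)) (b k)"
    if "k \<in> {1..q - 1} \<times> ?D" for k
    unfolding b_def[abs_def] using that q by (intro waves \<Omega>m) auto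
  have onb1: "l2_orthonormal_basis ({1..q - 1} \<times> ?D) (\<lambda>(i, t) x. inv_fourier (indicator (\<Omega> i)) (x + t))
      (l2_orth_complement_in (?V 1) (?V 0))"
  proof -
    have "l2_orth_complement_in (?V 1) (?V 0) = L2_spectrum W"
      unfolding V S0 S1 W_def by (rule orth_complement_L2_spectrum[OF Ks])
    then show ?thesis
      using orthonormal_basis_fourier(2)[OF b_fourier onbW] by (simp add: case_prod_unfold)
  qed
  have S_iff: "x \<in> S j \<longleftrightarrow> N j *v x \<in> K" for x j
    unfolding S_def N_def by (rule image_matrix[OF Bj])
  have S_Suc_iff: "x \<in> S (j + 1) \<longleftrightarrow> N j *v x \<in> (*v) B ` K" for x j
  proof -
    have "S (j + 1) = (*v) (matrix_zpow B j) ` ((*v) B ` K)"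
      unfolding S_def matrix_zpow_add_1[OF B] matrix_zpow_commute[OF B]
      by (simp add: image_image matrix_vector_mul_assoc)
    then show ?thesis unfolding N_def by (simp only: image_matrix[OF Bj])
  qed
  have W_iff: "N j *v x \<in> W \<longleftrightarrow> x \<in> S (j + 1) \<and> x \<notin> S j" for x j
    unfolding W_def Diff_iff S_Suc_iff by (simp only: S_iff)
  \<comment> \<open>The inclusion at scale \<open>j\<close> is the one at scale 0 pulled back along
    \<open>N j\<close>; countability of the scales allows a single exceptional null set.\<close>
  have mono: "AE x in lebesgue. \<forall>j. x \<in> S j \<longrightarrow> x \<in> S (j + 1)"
    unfolding AE_all_countable
  proof
    show "AE x in lebesgue. x \<in> S j \<longrightarrow> x \<in> S (j + 1)" for j
      using AE_matrix[OF Ninv KB, of j] unfolding S_Suc_iff by (simp only: S_iff)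
  qed
  have cover: "AE x in lebesgue. \<exists>j\<in>UNIV. x \<in> S j"
    by (rule AE_UN_if_L2_spectrum_dense) (use dense S_sets in \<open>simp_all add: V\<close>)
  \<comment> \<open>Scale 0 provides the set of finite measure, namely \<open>K\<close>, that makes
    the indicator of the intersection square integrable.\<close>
  have small: "AE x in lebesgue. \<exists>j\<in>UNIV. x \<notin> S j"
  proof (rule AE_not_INT_if_L2_spectrum_trivial[where i = 0])
    show "(\<Inter>i\<in>UNIV. L2_spectrum (S i)) \<subseteq> {f. AE x in lebesgue. f x = 0}"
      using pre by (auto simp: pre_mra_def V)
  qed (use S_sets Km in \<open>simp_all add: S0\<close>)
  \<comment> \<open>Almost every point lies in some \<open>S j\<close> but not in all of them.
    Monotonicity then puts it into exactly one difference \<open>S (j + 1) - S j\<close>, which is a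
    dilate of \<open>W\<close>.\<close>
  have switch: "AE x in lebesgue. \<exists>!j. N j *v x \<in> W"
    using mono cover small
  proof eventually_elim
    case (elim x)
    then obtain a c where "x \<in> S a" "x \<notin> S c" by blast
    then show ?case unfolding W_iff using elim(1) by (intro int_Ex1_switch[of "\<lambda>j. x \<in> S j" a c]) auto
  qed
  have W_sets: "{x. N j *v x \<in> W} \<in> sets lebesgue" for j
  proof -
    have "{x. N j *v x \<in> W} = S (j + 1) - S j" by (auto simp: W_iff)
    then show ?thesis using S_sets by (simp add: sets.Diff)
  qed
  have onb2: "l2_orthonormal_basis ({1..q - 1} \<times> (UNIV :: int set) \<times> ?D)
      (\<lambda>(i, j, t) x. of_real (\<bar>det A\<bar> powr (of_int j / 2)) * inv_fourier (indicator (\<Omega> i)) (matrix_zpow A j *v x + t))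
      (l2_closure (\<Union>j. ?V j))"
  proof -
    let ?J = "{1..q - 1} \<times> (UNIV :: int set) \<times> ?D"
    \<comment> \<open>The frequency side of the full system. The triple \<open>(i, j, t)\<close> is
      regrouped into the scale \<open>j\<close>, which selects a dilate of \<open>W\<close>, and the
      index \<open>(i, t)\<close> of the basis on \<open>W\<close>.\<close>
    define d where "d k = dilate (N (fst (snd k))) (b (fst k, snd (snd k)))" for k
    have "l2_orthonormal_basis ?J d (L2_on (\<Union>j\<in>UNIV. {x. N j *v x \<in> W}))"
    proof (rule l2_orthonormal_basis_UN[where p = "\<lambda>k. fst (snd k)"])
      fix j :: int
      have bL: "b k \<in> L2 \<and> dilate (N j) (b k) = dilate (N j) (b k)" if "k \<in> {1..q - 1} \<times> ?D" for k
        using has_fourier_L2(2)[OF b_fourier[OF that]] by simp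
      have onbj: "l2_orthonormal_basis ({1..q - 1} \<times> ?D) (\<lambda>k. dilate (N j) (b k)) (L2_on {x. N j *v x \<in> W})"
        using l2_unitary_orthonormal_basis[OF l2_unitary_dilate[OF Ninv] bL onbW]
        unfolding dilate_L2_on[OF Ninv] .
      have bij: "bij_betw (\<lambda>k. (fst k, snd (snd k))) {k \<in> ?J. fst (snd k) = j} ({1..q - 1} \<times> ?D)"
        by (rule bij_betw_byWitness[where f' = "\<lambda>k. (fst k, j, snd k)"]) auto
      from l2_orthonormal_basis_reindex[OF bij onbj]
      show "l2_orthonormal_basis {k \<in> ?J. fst (snd k) = j} d (L2_on {x. N j *v x \<in> W})"
        by (rule l2_orthonormal_basis_cong[rotated]) (auto simp: d_def)
    next
      fix i j :: int assume "i \<noteq> j"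
      show "AE x in lebesgue. \<not> (x \<in> {x. N i *v x \<in> W} \<and> x \<in> {x. N j *v x \<in> W})"
        using switch by eventually_elim (use \<open>i \<noteq> j\<close> in blast)
    qed (use W_sets in auto)
    moreover have "L2_on (\<Union>j\<in>UNIV. {x. N j *v x \<in> W}) = L2_on UNIV"
      by (rule L2_on_cong) (use switch in eventually_elim, auto)
    ultimately have onbd: "l2_orthonormal_basis ?J d (L2_on UNIV)" by simp
    have "has_fourier ((\<lambda>(i, j, t) x. of_real (\<bar>det A\<bar> powr (of_int j / 2))
        * inv_fourier (indicator (\<Omega> i)) (matrix_zpow A j *v x + t)) k) (d k)" if "k \<in> ?J" for k
      using has_fourier_dilate[OF A b_fourier[of "(fst k, snd (snd k))"], of "fst (snd k)"] that
      by (auto simp: d_def N_def assms(3) case_prod_unfold)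
    from orthonormal_basis_fourier(2)[OF this onbd]
    show ?thesis unfolding dense L2_spectrum_UNIV .
  qed
  \<comment> \<open>The union of the spaces is already dense in \<open>L2\<close>, so the whole
    frequency space serves as the set \<open>M\<close> of the subspace analysis.\<close>
  have "l2_closure (\<Union>j. ?V j) = L2_spectrum UNIV" by (simp only: dense L2_spectrum_UNIV)
  then have smra: "smra A ?D ?V"
    unfolding smra_def by (intro conjI pre bexI[of _ UNIV]) simp_all
  have sm: "smra_multiwavelet A ?D ?V (q - 1) (\<lambda>i. inv_fourier (indicator (\<Omega> i)))"
    unfolding smra_multiwavelet_def by (intro conjI smra onb1 onb2)
  have fi: "fourier_image (?V j) = L2_on (S j)" for j
    unfolding V by (rule fourier_image_L2_spectrum)
  show ?thesis
    by (intro conjI allI fi[of 0, unfolded S0] fi[unfolded S_def] sm)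
qed



end
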